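(* Let $m>1$, $n\ge1$. There are three orbits of cominuscule parabolic sets of roots of $\mathfrak{g}=\mathfrak{osp}(2m|2n)$ under the action of the Weyl group $W_{\mathfrak{so}(2m)}\times W_{\mathfrak{sp}(2n)}$ of $\mathfrak{g}_{\bar0}$. Representatives $P$, with the corresponding Levi subalgebras $\mathfrak{l}$ and nilradicals $\mathfrak{n}^+$ (considered as $\mathfrak{l}$-modules), are: (i) $P_{\mathfrak{osp}(2m|2n)}(m)=L(m)\sqcup N^+(m)$, with $\mathfrak{l}\cong\mathfrak{gl}(m|n)$ and $\mathfrak{n}^+\cong\bigwedge^2V^{m|n}$; (ii) $P_{\mathfrak{osp}(2m|2n)}(1)=L(1)\sqcup N^+(1)$, with $\mathfrak{l}\cong\mathfrak{osp}(2m-2|2n)\oplus\mathbb{C}$ and $\mathfrak{n}^+\cong V^{2m-2|2n}$; (iii) $\overline P_{\mathfrak{osp}(2m|2n)}(m)=\bar\theta L(m)\sqcup\bar\theta N^+(m)$, with $\mathfrak{l}\cong\mathfrak{gl}(m|n)$ and $\mathfrak{n}^+\cong\bigwedge^2V^{m|n}$.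
   Context: $\mathfrak{g}_{\bar0}\cong\mathfrak{so}(2m)\oplus\mathfrak{sp}(2n)$, $\mathfrak{h}$ is the standard Cartan subalgebra, and $\Delta=\{\pm\varepsilon_i\pm\varepsilon_j,\ \pm\delta_k\pm\delta_l,\ \pm2\delta_k\mid i\ne j,\ k\neq l\}\sqcup\{\pm\varepsilon_i\pm\delta_k\}$, $1\le i,j\le m$, $1\le k,l\le n$. The Weyl group acts by permutations and even numbers of sign changes of the $\varepsilon_i$ and by signed permutations of the $\delta_k$. A proper subset $P\subsetneq\Delta$ is parabolic if $\Delta=P\cup(-P)$ and ($\alpha,\beta\in P$, $\alpha+\beta\in\Delta$ imply $\alpha+\beta\in P$). Put $L=P\cap(-P)$, $N^+=P\setminus(-P)$, $\mathfrak{p}_P=\mathfrak{h}\oplus\bigoplus_{\alpha\in P}\mathfrak{g}^\alpha$, Levi subalgebra $\mathfrak{l}=\mathfrak{h}\oplus\bigoplus_{\alpha\in L}\mathfrak{g}^\alpha$, nilradical $\mathfrak{n}^+=\bigoplus_{\alpha\in N^+}\mathfrak{g}^\alpha$. $P$ is cominuscule if $\mathfrak{n}^+$ is abelian. Sets: $L(m)=\{\varepsilon_i-\varepsilon_j\mid i\ne j\}\sqcup\{\delta_k-\delta_l\mid k\neq l\}\sqcup\{\pm(\varepsilon_i-\delta_k)\}$; $N^+(m)=\{\varepsilon_i+\varepsilon_j\mid i\neq j\}\sqcup\{\delta_k+\delta_l,\ 2\delta_k\mid k\ne l\}\sqcup\{\varepsilon_i+\delta_k\}$; $L(1)=\{\pm\varepsilon_i\pm\varepsilon_j\mid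 i\neq j,\ i,j>1\}\sqcup\{\pm\delta_k\pm\delta_l,\ \pm2\delta_k\mid k\ne l\}\sqcup\{\pm\varepsilon_i\pm\delta_k\mid i>1\}$; $N^+(1)=\{\varepsilon_1\pm\varepsilon_j\mid j>1\}\sqcup\{\varepsilon_1\pm\delta_k\}$. $\bar\theta$ is the automorphism of $\Delta$ sending $\varepsilon_m\mapsto-\varepsilon_m$ and fixing all other $\varepsilon_i$ and all $\delta_k$ (the diagram automorphism interchanging the last two simple roots of the base $\{\delta_1-\delta_2,\dots,\delta_n-\varepsilon_1,\varepsilon_1-\varepsilon_2,\dots,\varepsilon_{m-1}-\varepsilon_m,\varepsilon_{m-1}+\varepsilon_m\}$). $V^{p|q}$ is the standard representation, $\bigwedge^2$ the super exterior square; in (ii) the summand $\mathbb{C}$ acts by scalars. *)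

theory Defs
  imports Complex_Main "HOL-Library.Function_Algebras" "HOL-Combinatorics.Permutations"
begin

section \<open>Super vector spaces and Lie superalgebras over the complex numbers\<close>

text \<open>Parities are Booleans, \<open>True\<close> being odd. \<open>hpart V a\<close> is the homogeneous component of
  parity \<open>a\<close>.\<close>

record 'v superspace =
  vcarrier :: "'v set"
  vadd :: "'v \<Rightarrow> 'v \<Rightarrow> 'v"
  vscale :: "complex \<Rightarrow> 'v \<Rightarrow> 'v"
  hpart :: "bool \<Rightarrow> 'v set"

record 'v superalgebra = "'v superspace" +
  brk :: "'v \<Rightarrow> 'v \<Rightarrow> 'v"

definition ksign :: "bool \<Rightarrow> bool \<Rightarrow> complex" where
  "ksign a b = (if a \<and> b then - 1 else 1)"

definition super_iso ::
    "('v, 'r) superspace_scheme \<Rightarrow> ('w, 's) superspace_scheme \<Rightarrow> ('v \<Rightarrow> 'w) \<Rightarrow> bool" where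
  "super_iso V W f \<longleftrightarrow>
     bij_betw f (vcarrier V) (vcarrier W) \<and>
     (\<forall>x\<in>vcarrier V. \<forall>y\<in>vcarrier V. f (vadd V x y) = vadd W (f x) (f y)) \<and>
     (\<forall>c. \<forall>x\<in>vcarrier V. f (vscale V c x) = vscale W c (f x)) \<and>
     (\<forall>a. f ` hpart V a = hpart W a)"

definition lie_iso ::
    "('v, 'r) superalgebra_scheme \<Rightarrow> ('w, 's) superalgebra_scheme \<Rightarrow> ('v \<Rightarrow> 'w) \<Rightarrow> bool" where
  "lie_iso L M f \<longleftrightarrow>
     super_iso L M f \<and>
     (\<forall>x\<in>vcarrier L. \<forall>y\<in>vcarrier L. f (brk L x y) = brk M (f x) (f y))"

text \<open>\<open>L \<cong> L'\<close> as Lie superalgebras and, along the same isomorphism, \<open>V \<cong> V'\<close> as modules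
  (by an even intertwiner), where \<open>act\<close> and \<open>act'\<close> are the actions.\<close>

definition lie_module_iso ::
    "('l, 'a) superalgebra_scheme \<Rightarrow> ('v, 'b) superspace_scheme \<Rightarrow> ('l \<Rightarrow> 'v \<Rightarrow> 'v) \<Rightarrow>
     ('k, 'c) superalgebra_scheme \<Rightarrow> ('w, 'd) superspace_scheme \<Rightarrow> ('k \<Rightarrow> 'w \<Rightarrow> 'w) \<Rightarrow> bool" where
  "lie_module_iso L V act L' V' act' \<longleftrightarrow>
     (\<exists>\<phi> \<psi>. lie_iso L L' \<phi> \<and> super_iso V V' \<psi> \<and>
       (\<forall>x\<in>vcarrier L. \<forall>v\<in>vcarrier V. \<psi> (act x v) = act' (\<phi> x) (\<psi> v)))"

definition restrict_superspace ::
    "('v, 'r) superspace_scheme \<Rightarrow> 'v set \<Rightarrow> ('v, 'r) superspace_scheme" where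
  "restrict_superspace V S =
     V\<lparr>vcarrier := vcarrier V \<inter> S, hpart := (\<lambda>a. hpart V a \<inter> S)\<rparr>"

definition coset :: "('v, 'r) superspace_scheme \<Rightarrow> 'v set \<Rightarrow> 'v \<Rightarrow> 'v set" where
  "coset V R t = {vadd V t r | r. r \<in> R}"

definition quotient_superspace ::
    "('v, 'r) superspace_scheme \<Rightarrow> 'v set \<Rightarrow> 'v set superspace" where
  "quotient_superspace V R =
     \<lparr>vcarrier = coset V R ` vcarrier V,
      vadd = (\<lambda>S T. {vadd V s t | s t. s \<in> S \<and> t \<in> T}),
      vscale = (\<lambda>c S. \<Union>s\<in>S. coset V R (vscale V c s)),
      hpart = (\<lambda>a. coset V R ` hpart V a)\<rparr>"

definition quotient_act ::
    "('v, 'r) superspace_scheme \<Rightarrow> 'v set \<Rightarrow> ('l \<Rightarrow> 'v \<Rightarrow> 'v) \<Rightarrow> 'l \<Rightarrow> 'v set \<Rightarrow> 'v set" where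
  "quotient_act V R act X S = (\<Union>s\<in>S. coset V R (act X s))"

definition lie_sum ::
    "('v, 'r) superalgebra_scheme \<Rightarrow> ('w, 's) superalgebra_scheme \<Rightarrow> ('v \<times> 'w) superalgebra" where
  "lie_sum L M =
     \<lparr>vcarrier = vcarrier L \<times> vcarrier M,
      vadd = (\<lambda>(x, y) (x', y'). (vadd L x x', vadd M y y')),
      vscale = (\<lambda>c (x, y). (vscale L c x, vscale M c y)),
      hpart = (\<lambda>a. hpart L a \<times> hpart M a),
      brk = (\<lambda>(x, y) (x', y'). (brk L x x', brk M y y'))\<rparr>"

definition lie_C :: "complex superalgebra" where
  "lie_C =
     \<lparr>vcarrier = UNIV, vadd = (+), vscale = (*),
      hpart = (\<lambda>a. if a then {0} else UNIV), brk = (\<lambda>x y. 0)\<rparr>"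

section \<open>Coordinate spaces, matrices and tensors\<close>

text \<open>Vectors, matrices, tensors of order two and weights are all complex-valued functions on
  some index type; dimensions are controlled by requiring the support to lie in a given index
  set.\<close>

definition fscale :: "complex \<Rightarrow> ('x \<Rightarrow> complex) \<Rightarrow> 'x \<Rightarrow> complex"  (infixr \<open>\<odot>\<close> 75) where
  "c \<odot> f = (\<lambda>x. c * f x)"

interpretation cfun: vector_space "fscale :: complex \<Rightarrow> ('x \<Rightarrow> complex) \<Rightarrow> 'x \<Rightarrow> complex"
  by unfold_locales (auto simp: fscale_def fun_eq_iff algebra_simps)

definition fspace :: "'x set \<Rightarrow> ('x \<Rightarrow> bool) \<Rightarrow> ('x \<Rightarrow> complex) superspace" where
  "fspace J q =
     \<lparr>vcarrier = {f. \<forall>x. x \<notin> J \<longrightarrow> f x = 0}, vadd = (+), vscale = (\<odot>),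
      hpart = (\<lambda>a. {f. \<forall>x. x \<notin> J \<or> q x \<noteq> a \<longrightarrow> f x = 0})\<rparr>"

definition hproj :: "('x \<Rightarrow> bool) \<Rightarrow> bool \<Rightarrow> ('x \<Rightarrow> complex) \<Rightarrow> 'x \<Rightarrow> complex" where
  "hproj q a f = (\<lambda>x. if q x = a then f x else 0)"

text \<open>The parity of the matrix unit \<open>E\<^sub>i\<^sub>j\<close>, and of the tensor \<open>e\<^sub>i \<otimes> e\<^sub>j\<close>.\<close>

definition pair_parity :: "('i \<Rightarrow> bool) \<Rightarrow> 'i \<times> 'i \<Rightarrow> bool" where
  "pair_parity p = (\<lambda>(i, j). p i \<noteq> p j)"

type_synonym 'i cmat = "'i \<times> 'i \<Rightarrow> complex"

definition mmul :: "'i set \<Rightarrow> 'i cmat \<Rightarrow> 'i cmat \<Rightarrow> 'i cmat" where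
  "mmul I X Y = (\<lambda>(i, j). \<Sum>k\<in>I. X (i, k) * Y (k, j))"

definition mapply :: "'i set \<Rightarrow> 'i cmat \<Rightarrow> ('i \<Rightarrow> complex) \<Rightarrow> 'i \<Rightarrow> complex" where
  "mapply I X v = (\<lambda>i. \<Sum>k\<in>I. X (i, k) * v k)"

text \<open>The bilinear extension of \<open>[X, Y] = XY - (-1)\<^bsup>|X||Y|\<^esup> YX\<close> from homogeneous matrices.\<close>

definition superbracket :: "'i set \<Rightarrow> ('i \<Rightarrow> bool) \<Rightarrow> 'i cmat \<Rightarrow> 'i cmat \<Rightarrow> 'i cmat" where
  "superbracket I p X Y =
     (\<Sum>a\<in>UNIV. \<Sum>b\<in>UNIV.
        mmul I (hproj (pair_parity p) a X) (hproj (pair_parity p) b Y)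
        - ksign a b \<odot> mmul I (hproj (pair_parity p) b Y) (hproj (pair_parity p) a X))"

definition gl :: "'i set \<Rightarrow> ('i \<Rightarrow> bool) \<Rightarrow> 'i cmat superalgebra" where
  "gl I p = superspace.extend (fspace (I \<times> I) (pair_parity p)) \<lparr>brk = superbracket I p\<rparr>"

section \<open>The super exterior square\<close>

definition tensor :: "('i \<Rightarrow> complex) \<Rightarrow> ('i \<Rightarrow> complex) \<Rightarrow> 'i \<times> 'i \<Rightarrow> complex" where
  "tensor v w = (\<lambda>(i, j). v i * w j)"

definition tensor_square :: "'i set \<Rightarrow> ('i \<Rightarrow> bool) \<Rightarrow> ('i \<times> 'i \<Rightarrow> complex) superspace" where
  "tensor_square I p = fspace (I \<times> I) (pair_parity p)"

text \<open>The coordinate form of \<open>X \<cdot> (v \<otimes> w) = Xv \<otimes> w + (-1)\<^bsup>|X||v|\<^esup> v \<otimes> Xw\<close>;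
  see \<open>tensor_act_tensor\<close>.\<close>

definition tensor_act ::
    "'i set \<Rightarrow> ('i \<Rightarrow> bool) \<Rightarrow> 'i cmat \<Rightarrow> ('i \<times> 'i \<Rightarrow> complex) \<Rightarrow> 'i \<times> 'i \<Rightarrow> complex" where
  "tensor_act I p X t = (\<lambda>(i, j).
     \<Sum>a\<in>UNIV. (\<Sum>k\<in>I. hproj (pair_parity p) a X (i, k) * t (k, j))
             + ksign a (p i) * (\<Sum>k\<in>I. hproj (pair_parity p) a X (j, k) * t (i, k)))"

lemma hproj_hpart_gl:
  assumes "X \<in> hpart (gl I p) a"
  shows "hproj (pair_parity p) b X = (if b = a then X else 0)"
  using assms
  by (auto simp: gl_def superspace.defs superalgebra.defs fspace_def hproj_def fun_eq_iff)

lemma tensor_act_tensor: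
  assumes X: "X \<in> hpart (gl I p) a" and v: "v \<in> hpart (fspace I p) b"
  shows "tensor_act I p X (tensor v w) =
    tensor (mapply I X v) w + ksign a b \<odot> tensor v (mapply I X w)"
proof -
  have "ksign a (p i) * v i = ksign a b * v i" for i
    using v by (cases "p i = b") (auto simp: fspace_def)
  then have "ksign a (p i) * (v i * y) = ksign a b * (v i * y)" for i y
    by (metis mult.assoc)
  moreover have "(\<Sum>k\<in>I. X (j, k) * (v i * w k)) = v i * (\<Sum>k\<in>I. X (j, k) * w k)" for i j
    by (simp add: sum_distrib_left mult.left_commute)
  moreover have "(\<Sum>k\<in>I. X (i, k) * (v k * w j)) = (\<Sum>k\<in>I. X (i, k) * v k) * w j" for i j
    by (simp add: sum_distrib_right mult.assoc)
  ultimately show ?thesis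
    unfolding tensor_act_def hproj_hpart_gl [OF X]
    by (cases a) (auto simp: fun_eq_iff UNIV_bool tensor_def mapply_def fscale_def)
qed

definition ext_relations :: "'i set \<Rightarrow> ('i \<Rightarrow> bool) \<Rightarrow> ('i \<times> 'i \<Rightarrow> complex) set" where
  "ext_relations I p = cfun.span
     {tensor v w + ksign a b \<odot> tensor w v | v w a b.
        v \<in> hpart (fspace I p) a \<and> w \<in> hpart (fspace I p) b}"

definition ext_square :: "'i set \<Rightarrow> ('i \<Rightarrow> bool) \<Rightarrow> ('i \<times> 'i \<Rightarrow> complex) set superspace" where
  "ext_square I p = quotient_superspace (tensor_square I p) (ext_relations I p)"

definition ext_act ::
    "'i set \<Rightarrow> ('i \<Rightarrow> bool) \<Rightarrow> 'i cmat \<Rightarrow> ('i \<times> 'i \<Rightarrow> complex) set \<Rightarrow> ('i \<times> 'i \<Rightarrow> complex) set" where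
  "ext_act I p = quotient_act (tensor_square I p) (ext_relations I p) (tensor_act I p)"

section \<open>The Lie superalgebras \<open>\<gg>\<ll>(m|n)\<close> and \<open>\<oo>\<ss>\<pp>(2m|2n)\<close>\<close>

text \<open>\<open>Eps i\<close> (even) and \<open>Del k\<close> (odd) label the basis of \<open>V\<^bsup>m|n\<^esup>\<close> as well as the coordinates of
  weights. The basis of \<open>V\<^bsup>2m|2n\<^esup>\<close> is labelled by \<open>Pos a\<close> and \<open>Neg a\<close>, of weight plus or
  minus the basic weight \<open>a\<close>.\<close>

datatype idx = Eps nat | Del nat
datatype sidx = Pos idx | Neg idx

definition idx :: "nat \<Rightarrow> nat \<Rightarrow> idx set" where
  "idx m n = Eps ` {1..m} \<union> Del ` {1..n}"

definition sidx :: "nat \<Rightarrow> nat \<Rightarrow> sidx set" where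
  "sidx m n = Pos ` idx m n \<union> Neg ` idx m n"

fun idx_odd :: "idx \<Rightarrow> bool" where
  "idx_odd (Eps i) = False"
| "idx_odd (Del k) = True"

fun sidx_odd :: "sidx \<Rightarrow> bool" where
  "sidx_odd (Pos a) = idx_odd a"
| "sidx_odd (Neg a) = idx_odd a"

text \<open>The Gram matrix of the even form on \<open>V\<^bsup>2m|2n\<^esup>\<close>, which is symmetric on the even part and
  alternating on the odd part.\<close>

fun bform :: "sidx \<Rightarrow> sidx \<Rightarrow> complex" where
  "bform (Pos a) (Neg b) = (if a = b then 1 else 0)"
| "bform (Neg a) (Pos b) = (if a = b then (if idx_odd a then - 1 else 1) else 0)"
| "bform (Pos a) (Pos b) = 0"
| "bform (Neg a) (Neg b) = 0"

text \<open>A homogeneous \<open>X\<close> lies in \<open>\<oo>\<ss>\<pp>\<close> iff \<open>B(Xu, v) + (-1)\<^bsup>|X||u|\<^esup> B(u, Xv) = 0\<close>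
  (here for basis vectors \<open>u = e\<^sub>i\<close>, \<open>v = e\<^sub>j\<close>); a general \<open>X\<close> does iff its homogeneous
  components do.\<close>

definition osp_carrier :: "nat \<Rightarrow> nat \<Rightarrow> sidx cmat set" where
  "osp_carrier m n = {X \<in> vcarrier (gl (sidx m n) sidx_odd).
     \<forall>a. \<forall>i\<in>sidx m n. \<forall>j\<in>sidx m n.
       (\<Sum>k\<in>sidx m n. hproj (pair_parity sidx_odd) a X (k, i) * bform k j)
       + ksign a (sidx_odd i) *
         (\<Sum>k\<in>sidx m n. hproj (pair_parity sidx_odd) a X (k, j) * bform i k) = 0}"

definition gl_mn :: "nat \<Rightarrow> nat \<Rightarrow> idx cmat superalgebra" where
  "gl_mn m n = gl (idx m n) idx_odd"

definition osp :: "nat \<Rightarrow> nat \<Rightarrow> sidx cmat superalgebra" where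
  "osp m n = restrict_superspace (gl (sidx m n) sidx_odd) (osp_carrier m n)"

section \<open>Roots and parabolic sets\<close>

type_synonym weight = "idx \<Rightarrow> complex"

definition eps :: "nat \<Rightarrow> weight" where
  "eps i = (\<lambda>a. if a = Eps i then 1 else 0)"

definition del :: "nat \<Rightarrow> weight" where
  "del k = (\<lambda>a. if a = Del k then 1 else 0)"

abbreviation signs :: "complex set" where
  "signs \<equiv> {1, - 1}"

text \<open>See \<open>roots_eq\<close> below: these are exactly the nonzero weights with nonzero root space.\<close>

definition roots :: "nat \<Rightarrow> nat \<Rightarrow> weight set" where
  "roots m n =
     {s \<odot> eps i + t \<odot> eps j | s t i j. s \<in> signs \<and> t \<in> signs \<and> i \<in> {1..m} \<and> j \<in> {1..m} \<and> i \<noteq> j} \<union>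
     {s \<odot> del k + t \<odot> del l | s t k l. s \<in> signs \<and> t \<in> signs \<and> k \<in> {1..n} \<and> l \<in> {1..n} \<and> k \<noteq> l} \<union>
     {(2 * s) \<odot> del k | s k. s \<in> signs \<and> k \<in> {1..n}} \<union>
     {s \<odot> eps i + t \<odot> del k | s t i k. s \<in> signs \<and> t \<in> signs \<and> i \<in> {1..m} \<and> k \<in> {1..n}}"

definition cartan :: "nat \<Rightarrow> nat \<Rightarrow> sidx cmat set" where
  "cartan m n = {H \<in> vcarrier (osp m n). \<forall>i j. i \<noteq> j \<longrightarrow> H (i, j) = 0}"

text \<open>\<open>\<epsilon>\<^sub>i\<close> and \<open>\<delta>\<^sub>k\<close> read off the diagonal entries of \<open>H\<close> on the \<open>Pos\<close> half of the basis.\<close>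

definition weight_eval :: "nat \<Rightarrow> nat \<Rightarrow> weight \<Rightarrow> sidx cmat \<Rightarrow> complex" where
  "weight_eval m n \<alpha> H = (\<Sum>a\<in>idx m n. \<alpha> a * H (Pos a, Pos a))"

definition root_space :: "nat \<Rightarrow> nat \<Rightarrow> weight \<Rightarrow> sidx cmat set" where
  "root_space m n \<alpha> = {X \<in> vcarrier (osp m n).
     \<forall>H\<in>cartan m n. brk (osp m n) H X = weight_eval m n \<alpha> H \<odot> X}"

definition parabolic :: "nat \<Rightarrow> nat \<Rightarrow> weight set \<Rightarrow> bool" where
  "parabolic m n P \<longleftrightarrow>
     P \<subset> roots m n \<and> roots m n = P \<union> uminus ` P \<and>
     (\<forall>\<alpha>\<in>P. \<forall>\<beta>\<in>P. \<alpha> + \<beta> \<in> roots m n \<longrightarrow> \<alpha> + \<beta> \<in> P)"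

definition levi_roots :: "weight set \<Rightarrow> weight set" where
  "levi_roots P = P \<inter> uminus ` P"

definition nil_roots :: "weight set \<Rightarrow> weight set" where
  "nil_roots P = P - uminus ` P"

definition levi :: "nat \<Rightarrow> nat \<Rightarrow> weight set \<Rightarrow> sidx cmat superalgebra" where
  "levi m n P = restrict_superspace (osp m n)
     (cfun.span (cartan m n \<union> (\<Union>\<alpha>\<in>levi_roots P. root_space m n \<alpha>)))"

definition nilradical :: "nat \<Rightarrow> nat \<Rightarrow> weight set \<Rightarrow> sidx cmat superalgebra" where
  "nilradical m n P = restrict_superspace (osp m n)
     (cfun.span (\<Union>\<alpha>\<in>nil_roots P. root_space m n \<alpha>))"

definition cominuscule :: "nat \<Rightarrow> nat \<Rightarrow> weight set \<Rightarrow> bool" where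
  "cominuscule m n P \<longleftrightarrow>
     parabolic m n P \<and>
     (\<forall>X\<in>vcarrier (nilradical m n P). \<forall>Y\<in>vcarrier (nilradical m n P). brk (osp m n) X Y = 0)"

section \<open>The Weyl group of the even part\<close>

text \<open>A signed permutation with permutations \<open>\<sigma>\<close>, \<open>\<tau>\<close> and signs \<open>s\<close>, \<open>t\<close> sends \<open>eps (\<sigma> i)\<close> to
  \<open>s i \<odot> eps i\<close> and \<open>del (\<tau> k)\<close> to \<open>t k \<odot> del k\<close>.\<close>

definition signed_perm ::
    "(nat \<Rightarrow> nat) \<Rightarrow> (nat \<Rightarrow> complex) \<Rightarrow> (nat \<Rightarrow> nat) \<Rightarrow> (nat \<Rightarrow> complex) \<Rightarrow> weight \<Rightarrow> weight" where
  "signed_perm \<sigma> s \<tau> t \<alpha> =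
     (\<lambda>a. case a of Eps i \<Rightarrow> s i * \<alpha> (Eps (\<sigma> i)) | Del k \<Rightarrow> t k * \<alpha> (Del (\<tau> k)))"

definition weyl :: "nat \<Rightarrow> nat \<Rightarrow> (weight \<Rightarrow> weight) set" where
  "weyl m n = {signed_perm \<sigma> s \<tau> t | \<sigma> s \<tau> t.
     \<sigma> permutes {1..m} \<and> \<tau> permutes {1..n} \<and> range s \<subseteq> signs \<and> range t \<subseteq> signs \<and>
     even (card {i \<in> {1..m}. s i = - 1})}"

definition weyl_orbit :: "nat \<Rightarrow> nat \<Rightarrow> weight set \<Rightarrow> weight set set" where
  "weyl_orbit m n P = {w ` P | w. w \<in> weyl m n}"

section \<open>The representatives\<close>

definition L_m :: "nat \<Rightarrow> nat \<Rightarrow> weight set" where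
  "L_m m n =
     {eps i - eps j | i j. i \<in> {1..m} \<and> j \<in> {1..m} \<and> i \<noteq> j} \<union>
     {del k - del l | k l. k \<in> {1..n} \<and> l \<in> {1..n} \<and> k \<noteq> l} \<union>
     {s \<odot> (eps i - del k) | s i k. s \<in> signs \<and> i \<in> {1..m} \<and> k \<in> {1..n}}"

definition N_m :: "nat \<Rightarrow> nat \<Rightarrow> weight set" where
  "N_m m n =
     {eps i + eps j | i j. i \<in> {1..m} \<and> j \<in> {1..m} \<and> i \<noteq> j} \<union>
     {del k + del l | k l. k \<in> {1..n} \<and> l \<in> {1..n} \<and> k \<noteq> l} \<union>
     {2 \<odot> del k | k. k \<in> {1..n}} \<union>
     {eps i + del k | i k. i \<in> {1..m} \<and> k \<in> {1..n}}"

definition L_1 :: "nat \<Rightarrow> nat \<Rightarrow> weight set" where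
  "L_1 m n =
     {s \<odot> eps i + t \<odot> eps j | s t i j. s \<in> signs \<and> t \<in> signs \<and> i \<in> {2..m} \<and> j \<in> {2..m} \<and> i \<noteq> j} \<union>
     {s \<odot> del k + t \<odot> del l | s t k l. s \<in> signs \<and> t \<in> signs \<and> k \<in> {1..n} \<and> l \<in> {1..n} \<and> k \<noteq> l} \<union>
     {(2 * s) \<odot> del k | s k. s \<in> signs \<and> k \<in> {1..n}} \<union>
     {s \<odot> eps i + t \<odot> del k | s t i k. s \<in> signs \<and> t \<in> signs \<and> i \<in> {2..m} \<and> k \<in> {1..n}}"

definition N_1 :: "nat \<Rightarrow> nat \<Rightarrow> weight set" where
  "N_1 m n =
     {eps 1 + s \<odot> eps j | s j. s \<in> signs \<and> j \<in> {2..m}} \<union>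
     {eps 1 + s \<odot> del k | s k. s \<in> signs \<and> k \<in> {1..n}}"

definition theta_bar :: "nat \<Rightarrow> weight \<Rightarrow> weight" where
  "theta_bar m \<alpha> = (\<lambda>a. if a = Eps m then - \<alpha> a else \<alpha> a)"

definition P_m :: "nat \<Rightarrow> nat \<Rightarrow> weight set" where
  "P_m m n = L_m m n \<union> N_m m n"

definition P_1 :: "nat \<Rightarrow> nat \<Rightarrow> weight set" where
  "P_1 m n = L_1 m n \<union> N_1 m n"

definition P_m_bar :: "nat \<Rightarrow> nat \<Rightarrow> weight set" where
  "P_m_bar m n = theta_bar m ` L_m m n \<union> theta_bar m ` N_m m n"

text \<open>\<open>osp m n \<oplus> \<complex>\<close> acts on the standard representation of \<open>osp m n\<close>, the summand \<open>\<complex>\<close> by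
  scalars.\<close>

definition std_scalar_act ::
    "nat \<Rightarrow> nat \<Rightarrow> sidx cmat \<times> complex \<Rightarrow> (sidx \<Rightarrow> complex) \<Rightarrow> sidx \<Rightarrow> complex" where
  "std_scalar_act m n = (\<lambda>(X, c) v. mapply (sidx m n) X v + c \<odot> v)"

section \<open>The explicit root set is the set of roots of \<open>\<oo>\<ss>\<pp>(2m|2n)\<close>\<close>

lemma gl_simps:
  "vcarrier (gl I p) = {f. \<forall>x. x \<notin> I \<times> I \<longrightarrow> f x = 0}"
  "brk (gl I p) = superbracket I p"
  by (auto simp: gl_def superspace.defs superalgebra.defs fspace_def)

lemma osp_simps: "vcarrier (osp m n) = osp_carrier m n" "brk (osp m n) = superbracket (sidx m n) sidx_odd"
  by (auto simp: osp_def restrict_superspace_def osp_carrier_def gl_simps)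

text \<open>The basis vectors labelled \<open>i\<close> and \<open>dual i\<close> are paired by \<open>bform\<close>.\<close>

fun dual :: "sidx \<Rightarrow> sidx" where "dual (Pos a) = Neg a" | "dual (Neg a) = Pos a"

lemma finite_sidx: "finite (sidx m n)" by (simp add: sidx_def idx_def)
lemma dual_in [simp]: "dual i \<in> sidx m n \<longleftrightarrow> i \<in> sidx m n" by (cases i) (auto simp: sidx_def)
lemma dual_dual [simp]: "dual (dual i) = i" by (cases i) auto
lemma dual_odd [simp]: "sidx_odd (dual i) = sidx_odd i" by (cases i) auto
lemma bform_eq: "bform i j = (if j = dual i then bform i (dual i) else 0)"
  by (cases i; cases j) auto
lemma bform_eq': "bform i j = (if i = dual j then bform (dual j) j else 0)"
  by (cases i; cases j) auto

lemma osp_carrier_iff: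
  "X \<in> osp_carrier m n \<longleftrightarrow> (\<forall>x. x \<notin> sidx m n \<times> sidx m n \<longrightarrow> X x = 0) \<and>
    (\<forall>i\<in>sidx m n. \<forall>j\<in>sidx m n. X (dual j, i) * bform (dual j) j +
       ksign (sidx_odd i \<noteq> sidx_odd j) (sidx_odd i) * (X (dual i, j) * bform i (dual i)) = 0)"
proof -
  have 1: "(\<Sum>k\<in>sidx m n. hproj (pair_parity sidx_odd) a X (k, i) * bform k j) =
     hproj (pair_parity sidx_odd) a X (dual j, i) * bform (dual j) j" if "j \<in> sidx m n" for i j a
    by (subst bform_eq') (simp add: if_distrib finite_sidx that sum.delta cong: if_cong)
  have 2: "(\<Sum>k\<in>sidx m n. hproj (pair_parity sidx_odd) a X (k, j) * bform i k) =
     hproj (pair_parity sidx_odd) a X (dual i, j) * bform i (dual i)" if "i \<in> sidx m n" for i j a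
    by (subst bform_eq) (simp add: if_distrib finite_sidx that sum.delta cong: if_cong)
  have 3: "(\<forall>a. hproj (pair_parity sidx_odd) a X (dual j, i) * b +
        ksign a (sidx_odd i) * (hproj (pair_parity sidx_odd) a X (dual i, j) * c) = 0) \<longleftrightarrow>
      X (dual j, i) * b + ksign (sidx_odd i \<noteq> sidx_odd j) (sidx_odd i) * (X (dual i, j) * c) = 0"
    for i j b c
    by (cases "sidx_odd i"; cases "sidx_odd j")
      (auto simp: hproj_def pair_parity_def ksign_def all_bool_eq)
  have "X \<in> osp_carrier m n \<longleftrightarrow> (\<forall>x. x \<notin> sidx m n \<times> sidx m n \<longrightarrow> X x = 0) \<and>
    (\<forall>i\<in>sidx m n. \<forall>j\<in>sidx m n. \<forall>a. hproj (pair_parity sidx_odd) a X (dual j, i) * bform (dual j) j +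
        ksign a (sidx_odd i) * (hproj (pair_parity sidx_odd) a X (dual i, j) * bform i (dual i)) = 0)"
    unfolding osp_carrier_def gl_simps by (auto simp: 1 2)
  then show ?thesis by (simp only: 3)
qed

text \<open>The weight of the basis vector labelled \<open>i\<close>.\<close>

fun wt :: "sidx \<Rightarrow> weight" where
  "wt (Pos a) = (\<lambda>b. if b = a then 1 else 0)"
| "wt (Neg a) = (\<lambda>b. if b = a then - 1 else 0)"

lemma superbracket_entry:
  "superbracket I p X Y (i, j) = (\<Sum>k\<in>I. X (i,k) * Y (k,j)
     - ksign (p i \<noteq> p k) (p k \<noteq> p j) * (Y (i,k) * X (k,j)))"
proof -
  have "superbracket I p X Y (i, j) = (\<Sum>k\<in>I. \<Sum>a\<in>UNIV. \<Sum>b\<in>UNIV.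
      hproj (pair_parity p) a X (i,k) * hproj (pair_parity p) b Y (k,j)
     - ksign a b * (hproj (pair_parity p) b Y (i,k) * hproj (pair_parity p) a X (k,j)))"
    unfolding superbracket_def
    by (simp add: UNIV_bool mmul_def fscale_def sum_subtractf sum.distrib sum_distrib_left)
  also have "\<dots> = (\<Sum>k\<in>I. X (i,k) * Y (k,j)
     - ksign (p i \<noteq> p k) (p k \<noteq> p j) * (Y (i,k) * X (k,j)))"
    by (rule sum.cong) (auto simp: UNIV_bool hproj_def pair_parity_def ksign_def)
  finally show ?thesis .
qed

lemma bform_nz: "bform (dual i) i \<noteq> 0" "bform i (dual i) \<noteq> 0" by (cases i; simp)+

lemma cartan_dual:
  assumes "H \<in> cartan m n" shows "H (dual i, dual i) = - H (i, i)"
proof (cases "i \<in> sidx m n")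
  case True
  have "H \<in> osp_carrier m n" using assms by (simp add: cartan_def osp_simps)
  with True have "H (dual (dual i), i) * bform (dual (dual i)) (dual i) + ksign (sidx_odd i \<noteq> sidx_odd (dual i)) (sidx_odd i) * (H (dual i, dual i) * bform i (dual i)) = 0"
    unfolding osp_carrier_iff using dual_in by blast
  then have "(H (i,i) + H (dual i, dual i)) * bform i (dual i) = 0" by (simp add: ksign_def algebra_simps)
  then show ?thesis using bform_nz by (simp add: eq_neg_iff_add_eq_0 add.commute)
next
  case False
  have "H \<in> osp_carrier m n" using assms by (simp add: cartan_def osp_simps)
  with False show ?thesis by (simp add: osp_carrier_iff)
qed

lemma finite_idx: "finite (idx m n)" by (simp add: idx_def)
lemma idx_delta: "b \<in> idx m n \<Longrightarrow> (\<Sum>a\<in>idx m n. (if a = b then c else 0) * f a) = c * (f b :: complex)"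
proof -
  assume b: "b \<in> idx m n"
  have "(\<Sum>a\<in>idx m n. (if a = b then c else 0) * f a) = (\<Sum>a\<in>idx m n. if a = b then c * f a else 0)"
    by (rule sum.cong) auto
  then show ?thesis using b by (simp add: finite_idx)
qed

lemma weight_eval_wt:
  assumes "H \<in> cartan m n" "i \<in> sidx m n"
  shows "weight_eval m n (wt i) H = H (i, i)"
  using assms(2)
proof (cases i)
  case (Pos a) with assms show ?thesis
    by (auto simp: weight_eval_def sidx_def idx_delta)
next
  case (Neg a) with assms cartan_dual[OF assms(1), of "Pos a"] show ?thesis
    by (auto simp: weight_eval_def sidx_def idx_delta)
qed

lemma cartan_brk:
  assumes "H \<in> cartan m n" "X \<in> osp_carrier m n"
  shows "superbracket (sidx m n) sidx_odd H X (i, j) = (H (i,i) - H (j,j)) * X (i,j)"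
proof -
  have H0: "H (i, j) = 0" if "i \<noteq> j" for i j using assms(1) that by (auto simp: cartan_def)
  have "superbracket (sidx m n) sidx_odd H X (i, j) =
    (\<Sum>k\<in>sidx m n. (if k = i then H (i,i) * X (i,j) else 0) - (if k = j then X (i,j) * H (j,j) else 0))"
    unfolding superbracket_entry using H0 by (intro sum.cong) (auto simp: ksign_def)
  also have "\<dots> = (H (i,i) - H (j,j)) * X (i,j)"
    using assms(2) by (auto simp: sum_subtractf finite_sidx osp_carrier_iff algebra_simps)
  finally show ?thesis .
qed

definition cartan_basis :: "idx \<Rightarrow> sidx cmat" where
  "cartan_basis a = (\<lambda>x. if x = (Pos a, Pos a) then 1 else if x = (Neg a, Neg a) then -1 else 0)"

lemma cartan_basis_cartan: "a \<in> idx m n \<Longrightarrow> cartan_basis a \<in> cartan m n"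
  unfolding cartan_def osp_simps mem_Collect_eq osp_carrier_iff
  apply (intro conjI ballI allI impI)
    apply (auto simp: cartan_basis_def sidx_def)[1]
  subgoal for i j by (cases i; cases j) (auto simp: cartan_basis_def sidx_def ksign_def)
  apply (auto simp: cartan_basis_def)
  done

lemma root_space_iff:
  "X \<in> root_space m n \<alpha> \<longleftrightarrow> X \<in> osp_carrier m n \<and>
     (\<forall>i j. X (i,j) \<noteq> 0 \<longrightarrow> (\<forall>a\<in>idx m n. \<alpha> a = wt i a - wt j a))"
proof (intro iffI conjI allI impI ballI)
  assume X: "X \<in> root_space m n \<alpha>"
  then show X': "X \<in> osp_carrier m n" by (simp add: root_space_def osp_simps)
  fix i j a assume nz: "X (i,j) \<noteq> 0" and a: "a \<in> idx m n"
  have "superbracket (sidx m n) sidx_odd (cartan_basis a) X (i,j) = weight_eval m n \<alpha> (cartan_basis a) * X (i,j)"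
    using X cartan_basis_cartan[OF a] by (simp add: root_space_def osp_simps fscale_def)
  then have "cartan_basis a (i,i) - cartan_basis a (j,j) = weight_eval m n \<alpha> (cartan_basis a)"
    using cartan_brk[OF cartan_basis_cartan[OF a] X'] nz by simp
  moreover have "weight_eval m n \<alpha> (cartan_basis a) = \<alpha> a"
  proof -
    have "cartan_basis a (Pos b, Pos b) = (if b = a then 1 else 0)" for b by (simp add: cartan_basis_def)
    then show ?thesis using idx_delta[OF a, of 1 \<alpha>] by (simp add: weight_eval_def mult.commute)
  qed
  moreover have "cartan_basis a (i,i) = wt i a" for i by (cases i) (auto simp: cartan_basis_def)
  ultimately show "\<alpha> a = wt i a - wt j a" by simp
next
  assume *: "X \<in> osp_carrier m n \<and>
     (\<forall>i j. X (i,j) \<noteq> 0 \<longrightarrow> (\<forall>a\<in>idx m n. \<alpha> a = wt i a - wt j a))"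
  show "X \<in> root_space m n \<alpha>"
    unfolding root_space_def osp_simps
  proof (intro CollectI conjI ballI ext)
    show "X \<in> osp_carrier m n" using * by simp
    fix H and x :: "sidx \<times> sidx" assume H: "H \<in> cartan m n"
    obtain i j where x: "x = (i,j)" by (cases x)
    show "superbracket (sidx m n) sidx_odd H X x = (weight_eval m n \<alpha> H \<odot> X) x"
    proof (cases "X (i,j) = 0")
      case True then show ?thesis using cartan_brk[OF H] * by (simp add: x fscale_def)
    next
      case False
      then have "weight_eval m n \<alpha> H = weight_eval m n (wt i) H - weight_eval m n (wt j) H"
        unfolding weight_eval_def sum_subtractf [symmetric]
        by (intro sum.cong refl) (use * in \<open>auto simp: left_diff_distrib\<close>)
      moreover have "i \<in> sidx m n" "j \<in> sidx m n" using False * by (auto simp: osp_carrier_iff)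
      ultimately show ?thesis using cartan_brk[OF H] * weight_eval_wt[OF H] by (simp add: x fscale_def)
    qed
  qed
qed


lemma wt_dual: "wt (dual i) = - wt i" by (cases i) (auto simp: fun_eq_iff)
lemma eps_wt: "eps i = wt (Pos (Eps i))" by (simp add: eps_def)
lemma del_wt: "del k = wt (Pos (Del k))" by (simp add: del_def)
lemma signs_wt: "s \<in> signs \<Longrightarrow> s \<odot> wt i = wt (if s = 1 then i else dual i)"
  by (auto simp: fscale_def wt_dual fun_eq_iff)

lemma roots_wt:
  "roots m n = {wt i - wt j | i j. i \<in> sidx m n \<and> j \<in> sidx m n \<and> i \<noteq> j \<and> (j = dual i \<longrightarrow> sidx_odd i)}"
  (is "_ = ?R")
proof (intro set_eqI iffI)
  have A: "wt x + wt y \<in> ?R" if "x \<in> sidx m n" "y \<in> sidx m n" "x \<noteq> dual y" "x = y \<longrightarrow> sidx_odd x" for x y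
  proof -
    have "wt x + wt y = wt x - wt (dual y)" by (simp add: wt_dual)
    with that show ?thesis by (smt (verit) dual_dual dual_in mem_Collect_eq)
  qed
  fix \<alpha> assume "\<alpha> \<in> roots m n"
  then consider
    (1) s t i j where "\<alpha> = s \<odot> eps i + t \<odot> eps j" "s \<in> signs" "t \<in> signs" "i \<in> {1..m}" "j \<in> {1..m}" "i \<noteq> j"
  | (2) s t k l where "\<alpha> = s \<odot> del k + t \<odot> del l" "s \<in> signs" "t \<in> signs" "k \<in> {1..n}" "l \<in> {1..n}" "k \<noteq> l"
  | (3) s k where "\<alpha> = (2 * s) \<odot> del k" "s \<in> signs" "k \<in> {1..n}"
  | (4) s t i k where "\<alpha> = s \<odot> eps i + t \<odot> del k" "s \<in> signs" "t \<in> signs" "i \<in> {1..m}" "k \<in> {1..n}"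
    unfolding roots_def by blast
  then show "\<alpha> \<in> ?R"
  proof cases
    case 1 show ?thesis unfolding 1(1) eps_wt signs_wt[OF 1(2)] signs_wt[OF 1(3)]
      by (rule A) (use 1 in \<open>auto simp: sidx_def idx_def\<close>)
  next
    case 2 show ?thesis unfolding 2(1) del_wt signs_wt[OF 2(2)] signs_wt[OF 2(3)]
      by (rule A) (use 2 in \<open>auto simp: sidx_def idx_def\<close>)
  next
    case 3
    have "(2 * s) \<odot> del k = s \<odot> del k + s \<odot> del k" by (simp add: fscale_def fun_eq_iff)
    then show ?thesis unfolding 3(1) apply (simp only:) unfolding del_wt signs_wt[OF 3(2)]
      by (rule A) (use 3 in \<open>auto simp: sidx_def idx_def\<close>)
  next
    case 4 show ?thesis unfolding 4(1) eps_wt del_wt signs_wt[OF 4(2)] signs_wt[OF 4(3)]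
      by (rule A) (use 4 in \<open>auto simp: sidx_def idx_def\<close>)
  qed
next
  fix \<alpha> assume "\<alpha> \<in> ?R"
  then obtain i j where *: "\<alpha> = wt i - wt j" "i \<in> sidx m n" "j \<in> sidx m n" "i \<noteq> j" "j = dual i \<longrightarrow> sidx_odd i"
    by blast
  define x where "x = dual j"
  have x: "\<alpha> = wt i + wt x" "x \<in> sidx m n" "x \<noteq> dual i" "x = i \<longrightarrow> sidx_odd i"
    unfolding x_def using * by (simp add: wt_dual, simp, metis dual_dual, metis dual_dual)
  obtain s a where i: "wt i = s \<odot> wt (Pos a)" "s \<in> signs" "a \<in> idx m n" "i = (if s = 1 then Pos a else Neg a)"
  proof (cases i)
    case (Pos a) with that[of 1 a] *(2) show ?thesis by (auto simp: sidx_def fscale_def)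
  next
    case (Neg a) with that[of "-1" a] *(2) show ?thesis by (auto simp: sidx_def fscale_def fun_eq_iff)
  qed
  obtain t b where j: "wt x = t \<odot> wt (Pos b)" "t \<in> signs" "b \<in> idx m n" "x = (if t = 1 then Pos b else Neg b)"
  proof (cases x)
    case (Pos a) with that[of 1 a] x(2) show ?thesis by (auto simp: sidx_def fscale_def)
  next
    case (Neg a) with that[of "-1" a] x(2) show ?thesis by (auto simp: sidx_def fscale_def fun_eq_iff)
  qed
  have \<alpha>: "\<alpha> = s \<odot> wt (Pos a) + t \<odot> wt (Pos b)" using x i j by simp
  show "\<alpha> \<in> roots m n"
  proof (cases "a = b")
    case True
    with x(3,4) i(2,4) j(2,4) have st: "s = t" "idx_odd a" by (auto split: if_splits)
    then obtain k where k: "a = Del k" by (cases a) auto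
    have "\<alpha> = (2 * s) \<odot> del k" using \<alpha> st True k by (simp add: fun_eq_iff fscale_def del_wt)
    moreover have "k \<in> {1..n}" using i(3) k by (auto simp: idx_def)
    ultimately show ?thesis using i(2) unfolding roots_def by blast
  next
    case ab: False
    show ?thesis
    proof (cases a)
      case a: (Eps k)
      have k: "k \<in> {1..m}" using a i(3) by (auto simp: idx_def)
      show ?thesis
      proof (cases b)
        case b: (Eps l)
        have "l \<in> {1..m}" "k \<noteq> l" using b a j(3) ab by (auto simp: idx_def)
        then show ?thesis using \<alpha> i(2) j(2) k unfolding roots_def a b eps_wt del_wt by blast
      next
        case b: (Del l)
        have "l \<in> {1..n}" using b j(3) by (auto simp: idx_def)
        then show ?thesis using \<alpha> i(2) j(2) k unfolding roots_def a b eps_wt del_wt by blast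
      qed
    next
      case a: (Del k)
      have k: "k \<in> {1..n}" using a i(3) by (auto simp: idx_def)
      show ?thesis
      proof (cases b)
        case b: (Eps l)
        have "l \<in> {1..m}" using b j(3) by (auto simp: idx_def)
        moreover have "\<alpha> = t \<odot> wt (Pos (Eps l)) + s \<odot> wt (Pos (Del k))"
          using \<alpha> a b by (simp add: add.commute)
        ultimately show ?thesis using i(2) j(2) k unfolding roots_def eps_wt del_wt by blast
      next
        case b: (Del l)
        have "l \<in> {1..n}" "k \<noteq> l" using b a j(3) ab by (auto simp: idx_def)
        then show ?thesis using \<alpha> i(2) j(2) k unfolding roots_def a b eps_wt del_wt by blast
      qed
    qed
  qed
qed

lemma wt_inj: "wt i = wt j \<Longrightarrow> i = j"
  by (cases i; cases j) (auto simp: fun_eq_iff split: if_splits)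

lemma wt_outside: "i \<in> sidx m n \<Longrightarrow> a \<notin> idx m n \<Longrightarrow> wt i a = 0"
  by (cases i) (auto simp: sidx_def)

lemma roots_eq:
  "roots m n = {\<alpha>. (\<forall>a. a \<notin> idx m n \<longrightarrow> \<alpha> a = 0) \<and> \<alpha> \<noteq> 0 \<and> root_space m n \<alpha> \<noteq> {0}}"
proof (intro set_eqI iffI)
  fix \<alpha> assume "\<alpha> \<in> roots m n"
  then obtain i j where *: "\<alpha> = wt i - wt j" "i \<in> sidx m n" "j \<in> sidx m n" "i \<noteq> j" "j = dual i \<longrightarrow> sidx_odd i"
    unfolding roots_wt by blast
  define c where "c = - ksign (sidx_odd i \<noteq> sidx_odd j) (sidx_odd j) * bform i (dual i) * bform j (dual j)"
  define X :: "sidx cmat" where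
    "X = (\<lambda>x. if x = (i, j) then 1 else if x = (dual j, dual i) then c else 0)"
  have "X \<in> osp_carrier m n"
    unfolding osp_carrier_iff
  proof (intro conjI allI impI ballI)
    fix x assume "x \<notin> sidx m n \<times> sidx m n" then show "X x = 0" using * by (auto simp: X_def)
  next
    fix i' j'
    have d: "dual j' = i \<longleftrightarrow> j' = dual i" "dual i' = i \<longleftrightarrow> i' = dual i"
        "dual j' = dual j \<longleftrightarrow> j' = j" "dual i' = dual j \<longleftrightarrow> i' = j"
      by (metis dual_dual)+
    have b: "bform u (dual u) * bform u (dual u) = 1" "bform u (dual u) * (bform u (dual u) * z) = z"
      "bform (dual u) u = (if sidx_odd u then - 1 else 1) * bform u (dual u)" for u z
      by (cases u; simp)+
    have ne: "dual i \<noteq> j \<longleftrightarrow> i \<noteq> dual j" by (metis dual_dual)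
    have cases: "j' = dual i \<and> i' = j \<or> j' = j \<and> i' = dual i \<or> X (dual j', i') = 0 \<and> X (dual i', j') = 0"
      unfolding X_def prod.inject using d by simp
    show "X (dual j', i') * bform (dual j') j' +
       ksign (sidx_odd i' \<noteq> sidx_odd j') (sidx_odd i') * (X (dual i', j') * bform i' (dual i')) = 0"
    proof (cases "j = dual i")
      case True
      then have "sidx_odd i" using * by simp
      then have "X (dual i, dual i) = 0" "X (i, i) = 0" using \<open>i \<noteq> j\<close> True by (auto simp: X_def)
      with cases True \<open>sidx_odd i\<close> show ?thesis by (auto simp: b ksign_def)
    next
      case False
      then have "X (i, j) = 1" "X (dual j, dual i) = c" using ne by (auto simp: X_def)
      with cases show ?thesis
        by (cases "sidx_odd i"; cases "sidx_odd j") (auto simp: c_def ksign_def b mult.assoc mult.left_commute)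
    qed
  qed
  moreover have "\<alpha> a = wt i' a - wt j' a" if "X (i', j') \<noteq> 0" for i' j' a
    using that *(1) by (auto simp: X_def wt_dual split: if_splits)
  ultimately have "X \<in> root_space m n \<alpha>" unfolding root_space_iff by blast
  moreover have "X (i, j) = 1" by (simp add: X_def)
  then have "X \<noteq> 0" by auto
  moreover have "\<alpha> \<noteq> 0" using * wt_inj by auto
  moreover have "\<forall>a. a \<notin> idx m n \<longrightarrow> \<alpha> a = 0" using * wt_outside by simp
  ultimately show "\<alpha> \<in> {\<alpha>. (\<forall>a. a \<notin> idx m n \<longrightarrow> \<alpha> a = 0) \<and> \<alpha> \<noteq> 0 \<and> root_space m n \<alpha> \<noteq> {0}}"
    by auto
next
  fix \<alpha> assume "\<alpha> \<in> {\<alpha>. (\<forall>a. a \<notin> idx m n \<longrightarrow> \<alpha> a = 0) \<and> \<alpha> \<noteq> 0 \<and> root_space m n \<alpha> \<noteq> {0}}"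
  then have out: "\<And>a. a \<notin> idx m n \<Longrightarrow> \<alpha> a = 0" and nz: "\<alpha> \<noteq> 0" and "root_space m n \<alpha> \<noteq> {0}" by auto
  moreover have "0 \<in> root_space m n \<alpha>" by (simp add: root_space_iff osp_carrier_iff)
  ultimately obtain X where X: "X \<in> root_space m n \<alpha>" "X \<noteq> 0" by blast
  then obtain i j where ij: "X (i, j) \<noteq> 0" by (auto simp: fun_eq_iff)
  have osp: "X \<in> osp_carrier m n" using X(1) by (simp add: root_space_iff)
  have in_idx: "i \<in> sidx m n" "j \<in> sidx m n" using osp ij by (auto simp: osp_carrier_iff)
  have "\<alpha> a = wt i a - wt j a" for a
    by (cases "a \<in> idx m n") (use X(1) ij out in_idx wt_outside in \<open>auto simp: root_space_iff\<close>)
  then have \<alpha>: "\<alpha> = wt i - wt j" by (simp add: fun_eq_iff)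
  moreover have "i \<noteq> j" using \<alpha> nz by auto
  moreover have "sidx_odd i" if "j = dual i"
  proof (rule ccontr)
    assume even: "\<not> sidx_odd i"
    have "X (dual j, j) * bform (dual j) j +
       ksign (sidx_odd j \<noteq> sidx_odd j) (sidx_odd j) * (X (dual j, j) * bform j (dual j)) = 0"
      using osp in_idx unfolding osp_carrier_iff by blast
    then show False using that ij even by (cases i) (auto simp: ksign_def)
  qed
  ultimately show "\<alpha> \<in> roots m n" unfolding roots_wt using in_idx by blast
qed

end

theory Submission
  imports Defs
begin

text \<open>
  The whole argument takes place on the labels of the basis of \<open>V\<^bsup>2m|2n\<^esup>\<close>, which \<open>dual\<close> matches in
  pairs. Every root is a difference \<open>wt i - wt j\<close>, and \<open>(i, j)\<close> is determined by it up to passing to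
  \<open>(dual j, dual i)\<close>. A set of roots is therefore a relation \<open>i \<succeq> j\<close> on labels that is reversed by
  \<open>dual\<close>, and parabolic means that this relation is a nontrivial total preorder, apart from comparisons
  of an even label \<open>i\<close> with \<open>dual i\<close>, which are void because \<open>wt i - wt (dual i)\<close> is not a root. Root vectors for
  \<open>wt i - wt j\<close> and \<open>wt j - wt k\<close> have a nonzero bracket as soon as \<open>wt i - wt k\<close> is a root, so
  cominuscule means that there are no two consecutive strict steps \<open>i \<succ> j \<succ> k\<close> with \<open>wt i - wt k\<close> a root
  (\<open>cominuscule_iff\<close>).

  Two shapes survive (\<open>cominuscule_preorder_cases\<close>). If some odd \<open>d\<close> satisfies \<open>d \<succ> dual d\<close>, then every
  label is equivalent to exactly one of \<open>d\<close> and \<open>dual d\<close>, so there are two levels, and the upper one is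
  a Lagrangian half of the labels. If every odd label is equivalent to its dual, then a strict step
  yields an even label \<open>e\<close> that lies strictly above all labels other than \<open>dual e\<close>, and those are equivalent to each
  other; these are the roots of the stabilizer of an isotropic line. Signed permutations act on both
  shapes. All isotropic even labels are conjugate, since \<open>m > 1\<close> leaves room for a second sign change, while
  for Lagrangian halves the parity of the number of negative \<open>\<epsilon>\<close>-labels is the only invariant. This
  gives the three orbits (\<open>cominuscule_orbits\<close>).

  For the module structure, membership in \<open>\<oo>\<ss>\<pp>\<close> says that the entries at \<open>(i, j)\<close> and
  \<open>(dual j, dual i)\<close> agree up to a fixed sign (\<open>osp_iff\<close>). Hence a Levi element of Lagrangian type is
  its diagonal block, an arbitrary element of \<open>\<gg>\<ll>(m|n)\<close>, and an element of the nilradical is an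
  off-diagonal block that is super-antisymmetric. Antisymmetrizing maps \<open>V \<otimes> V\<close> onto such blocks with
  kernel the relations of the exterior square, and the first isomorphism theorem for modules
  (\<open>lie_module_iso_quotient\<close>) gives cases (i) and (iii) at once (\<open>lie_module_iso_lagr\<close>). In case (ii)
  a Levi element is a block of \<open>\<oo>\<ss>\<pp>(2m-2|2n)\<close> together with one diagonal scalar, and an element of
  the nilradical is a single column (\<open>lie_module_iso_line\<close>).
\<close>

section \<open>Roots as pairs of labels\<close>

text \<open>The pairs left out, an even label and its dual, have difference \<open>\<plusminus>2\<epsilon>\<^sub>i\<close>.\<close>

definition root_pair :: "nat \<Rightarrow> nat \<Rightarrow> sidx \<Rightarrow> sidx \<Rightarrow> bool" where
  "root_pair m n i j \<longleftrightarrow> i \<in> sidx m n \<and> j \<in> sidx m n \<and> i \<noteq> j \<and> (j = dual i \<longrightarrow> sidx_odd i)"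

lemma roots_root_pair: "roots m n = {wt i - wt j | i j. root_pair m n i j}"
  by (simp add: roots_wt root_pair_def)

lemma dual_eq_iff [simp]: "dual i = dual j \<longleftrightarrow> i = j"
  by (metis dual_dual)

lemma dual_swap: "dual i = j \<longleftrightarrow> i = dual j"
  by (metis dual_dual)

lemma dual_ne [simp]: "dual i \<noteq> i" "i \<noteq> dual i"
  by (cases i; simp)+

lemma root_pair_dual [simp]: "root_pair m n (dual j) (dual i) \<longleftrightarrow> root_pair m n i j"
  by (auto simp: root_pair_def dual_swap)

lemma root_pair_commute: "root_pair m n j i \<longleftrightarrow> root_pair m n i j"
  by (auto simp: root_pair_def)

text \<open>The coordinate of a weight along a signed label, which turns identities between weights into
  case distinctions on labels.\<close>

fun coef :: "weight \<Rightarrow> sidx \<Rightarrow> complex" where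
  "coef \<alpha> (Pos a) = \<alpha> a"
| "coef \<alpha> (Neg a) = - \<alpha> a"

lemma coef_wt: "coef (wt i) z = (if i = z then 1 else if i = dual z then - 1 else 0)"
  by (cases i; cases z) auto

lemma coef_diff: "coef (\<alpha> - \<beta>) z = coef \<alpha> z - coef \<beta> z"
  by (cases z) auto

lemma coef_eqI: "(\<And>z. coef \<alpha> z = coef \<beta> z) \<Longrightarrow> \<alpha> = \<beta>"
  by (metis coef.simps(1) ext)

lemma wt_diff_dual: "wt (dual j) - wt (dual i) = wt i - wt j"
  by (simp add: wt_dual)

text \<open>The coordinate along \<open>i\<close> of the left-hand side is positive, so \<open>i\<close> must be \<open>k\<close> or
  \<open>dual l\<close>; cancelling it determines the other label.\<close>

lemma wt_diff_eq_iff: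
  assumes "i \<noteq> j"
  shows "wt i - wt j = wt k - wt l \<longleftrightarrow> (k = i \<and> l = j) \<or> (k = dual j \<and> l = dual i)"
proof
  assume eq: "wt i - wt j = wt k - wt l"
  then have "coef (wt i - wt j) i = coef (wt k - wt l) i" by simp
  then have "k = i \<or> l = dual i"
    using assms by (auto simp: coef_diff coef_wt split: if_splits)
  then show "(k = i \<and> l = j) \<or> (k = dual j \<and> l = dual i)"
  proof
    assume "k = i"
    with eq have "wt j = wt l" by simp
    then show ?thesis using \<open>k = i\<close> wt_inj by blast
  next
    assume l: "l = dual i"
    with eq have "wt k = wt (dual j)" by (simp add: wt_dual)
    then show ?thesis using l wt_inj by blast
  qed
next
  assume "(k = i \<and> l = j) \<or> (k = dual j \<and> l = dual i)"
  then show "wt i - wt j = wt k - wt l" by (auto simp: wt_diff_dual)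
qed

lemma wt_diff_in_roots: "wt i - wt j \<in> roots m n \<longleftrightarrow> root_pair m n i j"
proof
  assume "wt i - wt j \<in> roots m n"
  then obtain k l where kl: "wt k - wt l = wt i - wt j" "root_pair m n k l"
    unfolding roots_root_pair by auto
  then have "k \<noteq> l" by (simp add: root_pair_def)
  with kl show "root_pair m n i j" by (auto simp: wt_diff_eq_iff)
qed (auto simp: roots_root_pair)

text \<open>Sets of roots are handled through relations on labels. As \<open>wt i - wt j\<close> also arises from
  \<open>(dual j, dual i)\<close>, membership reflects \<open>G\<close> faithfully when \<open>G\<close> has the symmetry \<open>dual_sym\<close>.\<close>

definition root_set :: "nat \<Rightarrow> nat \<Rightarrow> (sidx \<Rightarrow> sidx \<Rightarrow> bool) \<Rightarrow> weight set" where
  "root_set m n G = {wt i - wt j | i j. root_pair m n i j \<and> G i j}"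

definition dual_sym :: "(sidx \<Rightarrow> sidx \<Rightarrow> bool) \<Rightarrow> bool" where
  "dual_sym G \<longleftrightarrow> (\<forall>i j. G (dual j) (dual i) \<longleftrightarrow> G i j)"

lemma dual_symD: "dual_sym G \<Longrightarrow> G (dual j) (dual i) \<longleftrightarrow> G i j"
  by (simp add: dual_sym_def)

lemma wt_diff_in_root_set:
  assumes "dual_sym G"
  shows "wt i - wt j \<in> root_set m n G \<longleftrightarrow> root_pair m n i j \<and> G i j"
proof
  assume "wt i - wt j \<in> root_set m n G"
  then obtain k l where kl: "wt k - wt l = wt i - wt j" "root_pair m n k l" "G k l"
    unfolding root_set_def by auto
  then have "k \<noteq> l" by (simp add: root_pair_def)
  with kl show "root_pair m n i j \<and> G i j"
    using dual_symD[OF assms] by (auto simp: wt_diff_eq_iff)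
qed (auto simp: root_set_def)

lemma root_set_subset: "root_set m n G \<subseteq> roots m n"
  by (auto simp: root_set_def roots_root_pair)

lemma weight_set_eqI:
  assumes "P \<subseteq> roots m n" "Q \<subseteq> roots m n"
    and "\<And>i j. root_pair m n i j \<Longrightarrow> wt i - wt j \<in> P \<longleftrightarrow> wt i - wt j \<in> Q"
  shows "P = Q"
  using assms unfolding roots_root_pair by fast

lemma uminus_root_set: "uminus ` root_set m n G = root_set m n (\<lambda>i j. G j i)"
proof (intro set_eqI iffI)
  fix \<alpha> assume "\<alpha> \<in> uminus ` root_set m n G"
  then obtain i j where "\<alpha> = - (wt i - wt j)" "root_pair m n i j" "G i j"
    by (auto simp: root_set_def)
  then have "\<alpha> = wt j - wt i" "root_pair m n j i" "G i j"
    by (auto simp: root_pair_commute)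
  then show "\<alpha> \<in> root_set m n (\<lambda>i j. G j i)" unfolding root_set_def by blast
next
  fix \<alpha> assume "\<alpha> \<in> root_set m n (\<lambda>i j. G j i)"
  then obtain i j where "\<alpha> = wt i - wt j" "root_pair m n i j" "G j i"
    by (auto simp: root_set_def)
  then have "\<alpha> = - (wt j - wt i)" "root_pair m n j i" "G j i"
    by (auto simp: root_pair_commute)
  moreover from this have "wt j - wt i \<in> root_set m n G" unfolding root_set_def by blast
  ultimately show "\<alpha> \<in> uminus ` root_set m n G" by blast
qed

lemma dual_sym_converse: "dual_sym G \<Longrightarrow> dual_sym (\<lambda>i j. G j i)"
  by (simp add: dual_sym_def)

lemma levi_roots_root_set:
  assumes "dual_sym G"
  shows "levi_roots (root_set m n G) = root_set m n (\<lambda>i j. G i j \<and> G j i)"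
proof (rule weight_set_eqI)
  have "dual_sym (\<lambda>i j. G i j \<and> G j i)" using assms by (simp add: dual_sym_def)
  then show "wt i - wt j \<in> levi_roots (root_set m n G) \<longleftrightarrow>
      wt i - wt j \<in> root_set m n (\<lambda>i j. G i j \<and> G j i)" for i j
    using assms dual_sym_converse[OF assms]
    by (auto simp: levi_roots_def uminus_root_set wt_diff_in_root_set)
qed (use root_set_subset in \<open>auto simp: levi_roots_def\<close>)

lemma nil_roots_root_set:
  assumes "dual_sym G"
  shows "nil_roots (root_set m n G) = root_set m n (\<lambda>i j. G i j \<and> \<not> G j i)"
proof (rule weight_set_eqI)
  have "dual_sym (\<lambda>i j. G i j \<and> \<not> G j i)" using assms by (simp add: dual_sym_def)
  then show "wt i - wt j \<in> nil_roots (root_set m n G) \<longleftrightarrow>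
      wt i - wt j \<in> root_set m n (\<lambda>i j. G i j \<and> \<not> G j i)" for i j
    using assms dual_sym_converse[OF assms]
    by (auto simp: nil_roots_def uminus_root_set wt_diff_in_root_set)
qed (use root_set_subset in \<open>auto simp: nil_roots_def\<close>)

text \<open>Otherwise no two of \<open>i\<close>, \<open>dual j\<close>, \<open>k\<close>, \<open>dual l\<close> are dual to each other, so some choice of signs
  on the coordinates takes the value \<open>1\<close> on all four weights and \<open>4\<close> on the sum. On a root such a functional
  is at most \<open>2\<close>.\<close>

lemma root_sum_cancels:
  assumes "root_pair m n i j" "root_pair m n k l"
    and "(wt i - wt j) + (wt k - wt l) \<in> roots m n"
  shows "j = k \<or> i = l \<or> k = dual i \<or> l = dual j"
proof (rule ccontr)
  assume no: "\<not> ?thesis"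
  obtain p q where pq: "(wt i - wt j) + (wt k - wt l) = wt p - wt q"
    and "p \<in> sidx m n" "q \<in> sidx m n"
    using assms(3) unfolding roots_root_pair by (auto simp: root_pair_def)
  define Z where "Z = {i, dual j, k, dual l}"
  \<comment> \<open>signs for which all four labels in \<open>Z\<close> count \<open>1\<close>\<close>
  define s :: "idx \<Rightarrow> complex" where "s = (\<lambda>a. if Neg a \<in> Z then - 1 else 1)"
  define h where "h = (\<lambda>\<alpha>::weight. \<Sum>a\<in>idx m n. s a * \<alpha> a)"
  have Z: "dual x \<notin> Z" if "x \<in> Z" for x
    using that no assms(1,2) unfolding Z_def root_pair_def by (auto simp: dual_swap)
  have h_wt: "h (wt x) = coef s x" if "x \<in> sidx m n" for x
  proof -
    have "(\<Sum>a\<in>idx m n. s a * (if a = b then c else 0)) = s b * c" if "b \<in> idx m n" for b c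
      using idx_delta[OF that, of c s] by (simp add: mult.commute)
    then show ?thesis using that by (cases x) (auto simp: h_def sidx_def)
  qed
  have unit: "coef s x = 1 \<or> coef s x = - 1" for x by (cases x) (auto simp: s_def)
  have one: "coef s x = 1" if "x \<in> Z" for x
    using that Z[OF that] by (cases x) (auto simp: s_def)
  have neg: "coef s (dual x) = - coef s x" for x by (cases x) auto
  have "i \<in> Z" "k \<in> Z" "dual j \<in> Z" "dual l \<in> Z" by (auto simp: Z_def)
  then have co: "coef s i = 1" "coef s k = 1" "coef s j = - 1" "coef s l = - 1"
    using one neg[of j] neg[of l] by (auto simp: minus_equation_iff)
  have "h ((wt i - wt j) + (wt k - wt l)) = h (wt i) - h (wt j) + (h (wt k) - h (wt l))"
    by (simp add: h_def algebra_simps sum.distrib sum_subtractf)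
  also have "\<dots> = 4"
    using assms(1,2) co by (simp add: root_pair_def h_wt)
  finally have "h (wt p - wt q) = 4" by (simp add: pq)
  moreover have "h (wt p - wt q) = coef s p - coef s q"
    using \<open>p \<in> _\<close> \<open>q \<in> _\<close> by (simp add: h_wt[symmetric] h_def algebra_simps sum_subtractf)
  ultimately show False using unit[of p] unit[of q] by auto
qed

text \<open>Replacing a pair \<open>(i, j)\<close> by \<open>(dual j, dual i)\<close> brings the two labels that cancel into the middle, so
  closedness of a parabolic set becomes transitivity.\<close>

lemma root_sum_chain:
  assumes "\<alpha> \<in> roots m n" "\<beta> \<in> roots m n" "\<alpha> + \<beta> \<in> roots m n"
  shows "\<exists>i j k. root_pair m n i j \<and> root_pair m n j k \<and> root_pair m n i k \<and>
    \<alpha> = wt i - wt j \<and> \<beta> = wt j - wt k"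
proof -
  obtain i j k l where \<alpha>: "root_pair m n i j" "\<alpha> = wt i - wt j"
    and \<beta>: "root_pair m n k l" "\<beta> = wt k - wt l"
    using assms(1,2) unfolding roots_root_pair by auto
  have fin: ?thesis if "root_pair m n x y" "root_pair m n y z" "\<alpha> = wt x - wt y" "\<beta> = wt y - wt z" for x y z
  proof -
    have "\<alpha> + \<beta> = wt x - wt z" using that by simp
    then show ?thesis using that assms(3) wt_diff_in_roots by metis
  qed
  have "j = k \<or> i = l \<or> k = dual i \<or> l = dual j"
    using root_sum_cancels[OF \<alpha>(1) \<beta>(1)] assms(3) \<alpha> \<beta> by simp
  then consider "j = k" | "i = l" | "k = dual i" | "l = dual j" by blast
  then show ?thesis
  proof cases
    case 1 then show ?thesis using fin[of i j l] \<alpha> \<beta> by simp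
  next
    case 2 then show ?thesis using fin[of "dual j" "dual i" "dual k"] \<alpha> \<beta>
      by (simp add: wt_diff_dual)
  next
    case 3 then show ?thesis using fin[of "dual j" "dual i" l] \<alpha> \<beta>
      by (simp add: wt_diff_dual)
  next
    case 4 
    have "root_pair m n j (dual k)" using \<beta>(1) root_pair_dual[of m n l k] 4 by simp
    then show ?thesis using fin[of i j "dual k"] \<alpha> \<beta> 4 wt_diff_dual[of l k] by simp
  qed
qed

section \<open>Parabolic sets as preorders\<close>

lemma parabolic_root_set:
  assumes sym: "dual_sym G"
    and total: "\<And>i j. root_pair m n i j \<Longrightarrow> G i j \<or> G j i"
    and trans: "\<And>i j k. root_pair m n i j \<Longrightarrow> root_pair m n j k \<Longrightarrow> root_pair m n i k \<Longrightarrow>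
      G i j \<Longrightarrow> G j k \<Longrightarrow> G i k"
    and proper: "root_pair m n x y" "\<not> G x y"
  shows "parabolic m n (root_set m n G)"
  unfolding parabolic_def
proof (intro conjI ballI impI)
  have "wt x - wt y \<in> roots m n" "wt x - wt y \<notin> root_set m n G"
    using proper sym by (auto simp: wt_diff_in_root_set wt_diff_in_roots)
  then show "root_set m n G \<subset> roots m n" using root_set_subset by blast
  show "roots m n = root_set m n G \<union> uminus ` root_set m n G"
  proof (rule weight_set_eqI)
    show "root_set m n G \<union> uminus ` root_set m n G \<subseteq> roots m n"
      unfolding uminus_root_set using root_set_subset by simp
  qed (use total sym dual_sym_converse[OF sym] in
      \<open>auto simp: uminus_root_set wt_diff_in_root_set wt_diff_in_roots\<close>)
  fix \<alpha> \<beta> assume *: "\<alpha> \<in> root_set m n G" "\<beta> \<in> root_set m n G" "\<alpha> + \<beta> \<in> roots m n"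
  then obtain i j k where "root_pair m n i j" "root_pair m n j k" "root_pair m n i k"
    "\<alpha> = wt i - wt j" "\<beta> = wt j - wt k"
    using root_sum_chain root_set_subset by blast
  with * sym trans[of i j k] show "\<alpha> + \<beta> \<in> root_set m n G"
    by (simp add: wt_diff_in_root_set)
qed

lemma parabolicD:
  assumes "parabolic m n P"
  shows "root_pair m n i j \<Longrightarrow> wt i - wt j \<in> P \<or> wt j - wt i \<in> P"
    and "root_pair m n i k \<Longrightarrow> wt i - wt j \<in> P \<Longrightarrow> wt j - wt k \<in> P \<Longrightarrow> wt i - wt k \<in> P"
    and "\<exists>i j. root_pair m n i j \<and> wt i - wt j \<notin> P"
    and "P \<subseteq> roots m n"
proof -
  show sub: "P \<subseteq> roots m n" using assms by (auto simp: parabolic_def)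
  show "wt i - wt j \<in> P \<or> wt j - wt i \<in> P" if "root_pair m n i j"
  proof -
    have "wt i - wt j \<in> P \<union> uminus ` P"
      using assms that wt_diff_in_roots unfolding parabolic_def by blast
    moreover have "wt j - wt i = \<beta>" if "wt i - wt j = - \<beta>" for \<beta>
      using arg_cong[OF that, of uminus] by simp
    ultimately show ?thesis by blast
  qed
  show "wt i - wt k \<in> P" if "root_pair m n i k" "wt i - wt j \<in> P" "wt j - wt k \<in> P"
  proof -
    have sum: "(wt i - wt j) + (wt j - wt k) = wt i - wt k" by simp
    have "(wt i - wt j) + (wt j - wt k) \<in> roots m n \<longrightarrow> (wt i - wt j) + (wt j - wt k) \<in> P"
      using assms that(2,3) unfolding parabolic_def by blast
    then show ?thesis using that(1) unfolding sum wt_diff_in_roots by blast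
  qed
  show "\<exists>i j. root_pair m n i j \<and> wt i - wt j \<notin> P"
    using assms unfolding parabolic_def roots_root_pair by blast
qed

text \<open>Exactly the sets of labels whose basis vectors span a Lagrangian subspace.\<close>

definition lagrangian :: "nat \<Rightarrow> nat \<Rightarrow> sidx set \<Rightarrow> bool" where
  "lagrangian m n A \<longleftrightarrow> A \<subseteq> sidx m n \<and> (\<forall>j\<in>sidx m n. dual j \<in> A \<longleftrightarrow> j \<notin> A)"

text \<open>The roots of the stabilizer of the Lagrangian subspace spanned by the basis vectors in \<open>A\<close>.\<close>

definition lagr_parabolic :: "nat \<Rightarrow> nat \<Rightarrow> sidx set \<Rightarrow> weight set" where
  "lagr_parabolic m n A = root_set m n (\<lambda>i j. i \<in> A \<or> dual j \<in> A)"

text \<open>The roots of the stabilizer of the isotropic line spanned by the basis vector labelled \<open>e\<close> (for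
  even \<open>e\<close>).\<close>

definition line_parabolic :: "nat \<Rightarrow> nat \<Rightarrow> sidx \<Rightarrow> weight set" where
  "line_parabolic m n e = root_set m n (\<lambda>i j. i = e \<or> j = dual e \<or> (i \<noteq> dual e \<and> j \<noteq> e))"

lemma dual_sym_lagr: "dual_sym (\<lambda>i j. i \<in> A \<or> dual j \<in> A)"
  by (auto simp: dual_sym_def)

lemma dual_sym_line: "dual_sym (\<lambda>i j. i = e \<or> j = dual e \<or> (i \<noteq> dual e \<and> j \<noteq> e))"
  by (auto simp: dual_sym_def dual_swap)

lemma root_set_cong:
  "(\<And>i j. root_pair m n i j \<Longrightarrow> G i j \<longleftrightarrow> H i j) \<Longrightarrow> root_set m n G = root_set m n H"
  by (auto simp: root_set_def)

lemma Pos_Del_sidx: "n \<ge> 1 \<Longrightarrow> Pos (Del 1) \<in> sidx m n"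
  by (auto simp: sidx_def idx_def)

text \<open>The combinatorial core of the classification. The odd labels decide between the alternatives, as
  \<open>wt d - wt (dual d)\<close> is a root precisely for odd \<open>d\<close>. If \<open>dual d\<close> does not dominate \<open>d\<close>, then
  \<open>d \<succ> dual d\<close> is already a strict step, and anything strictly outside or strictly between would prolong it.
  If all odd labels are equivalent to their duals, any strict step leads to an even \<open>e\<close> above an odd \<open>d\<close>,
  and \<open>e \<succ> d \<succ> dual e\<close> is harmless because \<open>wt e - wt (dual e)\<close> is not a root.\<close>

lemma cominuscule_preorder_cases:
  fixes G :: "sidx \<Rightarrow> sidx \<Rightarrow> bool"
  assumes sym: "dual_sym G"
    and total: "\<And>i j. root_pair m n i j \<Longrightarrow> G i j \<or> G j i"
    and trans: "\<And>i j k. root_pair m n i j \<Longrightarrow> root_pair m n j k \<Longrightarrow> root_pair m n i k \<Longrightarrow>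
      G i j \<Longrightarrow> G j k \<Longrightarrow> G i k"
    and proper: "\<exists>i j. root_pair m n i j \<and> \<not> G i j"
    and abelian: "\<And>i j k. root_pair m n i j \<Longrightarrow> root_pair m n j k \<Longrightarrow> root_pair m n i k \<Longrightarrow>
      G i j \<Longrightarrow> \<not> G j i \<Longrightarrow> G j k \<Longrightarrow> \<not> G k j \<Longrightarrow> False"
    and "n \<ge> 1"
  shows "(\<exists>A. lagrangian m n A \<and> (\<forall>i j. root_pair m n i j \<longrightarrow> G i j = (i \<in> A \<or> dual j \<in> A))) \<or>
    (\<exists>e\<in>sidx m n. \<not> sidx_odd e \<and> (\<forall>i j. root_pair m n i j \<longrightarrow>
      G i j = (i = e \<or> j = dual e \<or> (i \<noteq> dual e \<and> j \<noteq> e))))"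
proof -
  note du = dual_symD[OF sym]
  have rp: "root_pair m n i j \<longleftrightarrow>
      i \<in> sidx m n \<and> j \<in> sidx m n \<and> i \<noteq> j \<and> (j = dual i \<longrightarrow> sidx_odd i)" for i j
    by (simp add: root_pair_def)
  show ?thesis
  proof (cases "\<exists>d\<in>sidx m n. sidx_odd d \<and> \<not> G (dual d) d")
    case True
    then obtain d where d: "d \<in> sidx m n" "sidx_odd d" "\<not> G (dual d) d" by blast
    have top: "G d (dual d)" using d total[of d "dual d"] by (auto simp: rp)
    \<comment> \<open>nothing lies strictly above \<open>d\<close>, since it would be followed by the step from \<open>d\<close> to \<open>dual d\<close>\<close>
    have h1: "G d j" if "j \<in> sidx m n" "j \<noteq> d" for j
    proof (cases "j = dual d")
      case False
      then have r: "root_pair m n j d" "root_pair m n d (dual d)" "root_pair m n j (dual d)"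
        using that d by (auto simp: rp dual_swap)
      show ?thesis using abelian[OF r] total[OF r(1)] top d(3) by blast
    qed (use top in simp)
    have h2: "G j (dual d)" if "j \<in> sidx m n" "j \<noteq> dual d" for j
      using h1[of "dual j"] that du[of "dual d" j] by (auto simp: dual_swap)
    \<comment> \<open>nothing lies strictly between \<open>d\<close> and \<open>dual d\<close>, and nothing is equivalent to both\<close>
    have h3: "G j d \<longleftrightarrow> \<not> G (dual d) j" if j: "j \<in> sidx m n" "j \<noteq> d" "j \<noteq> dual d" for j
    proof -
      have r: "root_pair m n d j" "root_pair m n j (dual d)" "root_pair m n d (dual d)"
        "root_pair m n (dual d) j" "root_pair m n j d" "root_pair m n (dual d) d"
        using j d by (auto simp: rp dual_swap)
      show ?thesis
        using abelian[OF r(1-3)] trans[OF r(4-6)] h1[of j] h2[of j] j d by blast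
    qed
    define A where "A = {j \<in> sidx m n. j = d \<or> (j \<noteq> dual d \<and> G j d)}"
    have lag: "lagrangian m n A"
      unfolding lagrangian_def
    proof (intro conjI ballI)
      show "A \<subseteq> sidx m n" by (auto simp: A_def)
      fix j assume j: "j \<in> sidx m n"
      show "dual j \<in> A \<longleftrightarrow> j \<notin> A"
      proof (cases "j = d \<or> j = dual d")
        case True then show ?thesis using j by (auto simp: A_def dual_swap)
      next
        case False
        then have "dual j \<in> A \<longleftrightarrow> G (dual d) j"
          using j du[of d "dual j"] by (auto simp: A_def dual_swap)
        moreover have "j \<in> A \<longleftrightarrow> G j d" using False j by (auto simp: A_def)
        ultimately show ?thesis using h3[OF j] False by blast
      qed
    qed
    have inA: "G i j" if "i \<in> A" and r: "root_pair m n i j" for i j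
    proof -
      have ij: "i \<in> sidx m n" "j \<in> sidx m n" "i \<noteq> j" using r by (auto simp: rp)
      consider "i = d" | "i \<noteq> d" "j = d" | "i \<noteq> d" "j = dual d" | "i \<noteq> d" "j \<noteq> d" "j \<noteq> dual d"
        by blast
      then show ?thesis
      proof cases
        case 1 then show ?thesis using h1 ij by auto
      next
        case 2 then show ?thesis using that by (auto simp: A_def)
      next
        case 3 then show ?thesis using h2 ij by auto
      next
        case 4
        then have "G i d" "root_pair m n i d" "root_pair m n d j" "G d j"
          using that ij d h1[of j] by (auto simp: A_def rp dual_swap)
        then show ?thesis using trans r by blast
      qed
    qed
    have "G i j = (i \<in> A \<or> dual j \<in> A)" if r: "root_pair m n i j" for i j
    proof
      assume G: "G i j"
      have ij: "i \<in> sidx m n" "j \<in> sidx m n" "i \<noteq> j" using r by (auto simp: rp)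
      show "i \<in> A \<or> dual j \<in> A"
      proof (rule ccontr)
        assume "\<not> ?thesis"
        then have "i \<notin> A" "j \<in> A" using lag ij by (auto simp: lagrangian_def)
        then have id: "i \<noteq> d" and jd: "j \<noteq> dual d" using ij by (auto simp: A_def)
        have Gid: "G i d"
        proof (cases "j = d")
          case False
          have "root_pair m n i d" "root_pair m n j d"
            using ij d id jd False unfolding rp by (metis dual_odd)+
          moreover have "G j d" using \<open>j \<in> A\<close> False by (simp add: A_def)
          ultimately show ?thesis using trans r G by blast
        qed (use G in simp)
        have "i \<noteq> dual d"
          using Gid d(3) by blast
        then show False using \<open>i \<notin> A\<close> Gid id ij d by (auto simp: A_def)
      qed
    next
      assume "i \<in> A \<or> dual j \<in> A"
      then show "G i j" using inA[of i j] inA[of "dual j" "dual i"] r du[of j i] by auto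
    qed
    then show ?thesis using lag by blast
  next
    case False
    then have odd: "G (dual d) d" "G d (dual d)" if "d \<in> sidx m n" "sidx_odd d" for d
      using that by (force, metis dual_dual dual_in dual_odd)
    define N where "N = (\<lambda>i j. G i j \<and> \<not> G j i)"
    have Ndu: "N (dual j) (dual i) \<longleftrightarrow> N i j" for i j using du by (auto simp: N_def)
    have Ntot: "G i j" if "root_pair m n i j" "\<not> N j i" for i j
      using that total by (auto simp: N_def)
    have ab: False if "root_pair m n i j" "root_pair m n j k" "root_pair m n i k" "N i j" "N j k" for i j k
      using abelian that by (auto simp: N_def)
    \<comment> \<open>comparing the two ends of a strict step with odd labels yields one from an even down to an odd label\<close>
    have "\<exists>e d. e \<in> sidx m n \<and> d \<in> sidx m n \<and> \<not> sidx_odd e \<and> sidx_odd d \<and> N e d"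
    proof -
      obtain j i where r: "root_pair m n i j" "N i j"
        using proper total unfolding N_def by (metis root_pair_commute)
      have ij: "i \<in> sidx m n" "j \<in> sidx m n" "i \<noteq> j" using r by (auto simp: rp)
      show ?thesis
      proof (cases "sidx_odd i")
        case i: True
        show ?thesis
        proof (cases "sidx_odd j")
          case True
          have ne: "j \<noteq> dual i" using odd[of i] ij i r by (auto simp: N_def)
          then have rs: "root_pair m n (dual i) j" "root_pair m n (dual i) i"
            "root_pair m n j (dual i)" "root_pair m n j i" "root_pair m n (dual j) i"
            "root_pair m n (dual j) j"
            using ij i True by (auto simp: rp dual_swap)
          have "G (dual i) j" using trans[OF rs(2) r(1) rs(1)] odd[of i] ij i r by (auto simp: N_def)
          moreover have "\<not> G j (dual i)"
            using trans[OF rs(3) rs(2) rs(4)] odd[of i] ij i r by (auto simp: N_def)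
          ultimately have "N (dual i) j" by (simp add: N_def)
          then have "N (dual j) i" using Ndu[of j "dual i"] Ndu[of "dual i" j] by simp
          then show ?thesis using ab[OF rs(5) r(1) rs(6)] r(2) by blast
        next
          case False
          then show ?thesis using ij i r Ndu[of j i] dual_in dual_odd by blast
        qed
      next
        case i: False
        show ?thesis
        proof (cases "sidx_odd j")
          case True then show ?thesis using ij i r by blast
        next
          case j: False
          let ?d = "Pos (Del 1)"
          have d: "?d \<in> sidx m n" "sidx_odd ?d" using Pos_Del_sidx[OF \<open>n \<ge> 1\<close>] by auto
          have dn: "?d \<noteq> x" "?d \<noteq> dual x" "x \<noteq> dual ?d" if "\<not> sidx_odd x" for x
            using that d(2) dual_odd by metis+
          have rs: "root_pair m n x ?d" "root_pair m n ?d x" if "x \<in> sidx m n" "\<not> sidx_odd x" for x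
            using that d dn[OF that(2)] by (auto simp: rp)
          have "\<not> (G j ?d \<and> G ?d i)"
            using trans[OF rs(1)[OF ij(2) j] rs(2)[OF ij(1) i]] r by (auto simp: N_def root_pair_commute)
          then consider "N ?d j" | "N i ?d"
            using Ntot rs ij i j by blast
          then show ?thesis
          proof cases
            case 1
            then have "N (dual j) (dual ?d)" by (subst Ndu)
            then show ?thesis using ij j d dual_in dual_odd by metis
          qed (use ij i d in blast)
        qed
      qed
    qed
    then obtain e d where e: "e \<in> sidx m n" "\<not> sidx_odd e" and d: "d \<in> sidx m n" "sidx_odd d"
      and ed: "N e d" by blast
    have ne: "x \<noteq> y" "x \<noteq> dual y" "y \<noteq> dual x" if "sidx_odd x" "\<not> sidx_odd y" for x y
      using that dual_odd by metis+
    have eo: "root_pair m n x y" "root_pair m n y x"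
      if "x \<in> sidx m n" "y \<in> sidx m n" "sidx_odd x" "\<not> sidx_odd y" for x y
      using that ne[OF that(3,4)] by (auto simp: rp)
    have e': "dual e \<in> sidx m n" "\<not> sidx_odd (dual e)" and d': "dual d \<in> sidx m n" "sidx_odd (dual d)"
      using e d by auto
    have ed': "N e (dual d)"
    proof -
      have rd: "root_pair m n d (dual d)" using d by (auto simp: rp)
      have "G e (dual d)"
        using trans[of e d "dual d"] eo[OF d(1) e(1) d(2) e(2)] eo[OF d'(1) e(1) d'(2) e(2)] rd odd[OF d] ed
        by (auto simp: N_def)
      moreover have "\<not> G (dual d) e"
        using trans[of d "dual d" e] eo[OF d(1) e(1) d(2) e(2)] eo[OF d'(1) e(1) d'(2) e(2)] rd
          odd[OF d] ed by (auto simp: N_def)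
      ultimately show ?thesis by (simp add: N_def)
    qed
    have de: "N d (dual e)" using ed' Ndu[of "dual d" e] by simp
    \<comment> \<open>otherwise \<open>x\<close>, being equivalent to its dual, would connect \<open>dual e\<close> to \<open>d\<close>\<close>
    have odd_below: "N e x" if x: "x \<in> sidx m n" "sidx_odd x" for x
    proof (rule ccontr)
      assume no: "\<not> N e x"
      have rx: "root_pair m n x e" "root_pair m n e x" using eo[OF x(1) e(1) x(2) e(2)] .
      have "G x e" using Ntot[OF rx(1) no] .
      have xd: "x \<noteq> d" "x \<noteq> dual d" using no ed ed' by auto
      have rs: "root_pair m n x d" "root_pair m n (dual x) x" using x d xd by (auto simp: rp dual_swap)
      have re: "root_pair m n (dual e) y" if "y \<in> sidx m n" "sidx_odd y" for y
        using eo(2)[OF that(1) e'(1) that(2) e'(2)] .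
      have "G x d" using trans[OF rx(1) _ rs(1)] \<open>G x e\<close> ed eo[OF d(1) e(1) d(2) e(2)]
        by (auto simp: N_def)
      have "G (dual e) (dual x)" using \<open>G x e\<close> du by simp
      then have "G (dual e) x"
        using trans[OF re[of "dual x"] rs(2) re[OF x]] odd[OF x] x by simp
      then have "G (dual e) d"
        using trans[OF re[OF x] rs(1) re[OF d]] \<open>G x d\<close> by simp
      then show False using de by (simp add: N_def)
    qed
    \<comment> \<open>an even \<open>f\<close> strictly above \<open>e\<close> would give the chain \<open>f\<close>, \<open>e\<close>, \<open>d\<close>, an equivalent one the chain \<open>e\<close>, \<open>dual d\<close>, \<open>dual f\<close>\<close>
    have even_below: "N e f" if f: "f \<in> sidx m n" "\<not> sidx_odd f" "f \<noteq> e" "f \<noteq> dual e" for f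
    proof -
      have fd: "root_pair m n f d" "root_pair m n d f" using eo[OF d(1) f(1) d(2) f(2)] by auto
      have ed_r: "root_pair m n e d" "root_pair m n d e" using eo[OF d(1) e(1) d(2) e(2)] by auto
      have fe: "root_pair m n f e" "root_pair m n e f" "root_pair m n e (dual f)"
        using f e by (auto simp: rp dual_swap)
      have "\<not> N f e" using ab[OF fe(1) ed_r(1) fd(1)] ed by blast
      then have "G e f" using Ntot[OF fe(2)] by blast
      moreover have "\<not> G f e"
      proof
        assume "G f e"
        then have "G f d" using trans[OF fe(1) ed_r(1) fd(1)] ed by (auto simp: N_def)
        moreover have "\<not> G d f" using trans[OF fd(2) fe(1) ed_r(2)] \<open>G f e\<close> ed by (auto simp: N_def)
        ultimately have "N (dual d) (dual f)" using Ndu by (simp add: N_def)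
        moreover have "root_pair m n (dual d) (dual f)" using fd by simp
        ultimately show False
          using ab[OF eo(2)[OF d'(1) e(1) d'(2) e(2)] _ fe(3)] ed' by blast
      qed
      ultimately show ?thesis by (simp add: N_def)
    qed
    have above_bottom: "N e x" if "x \<in> sidx m n" "x \<noteq> e" "x \<noteq> dual e" for x
      using odd_below even_below that by blast
    have "N x (dual e)" if "x \<in> sidx m n" "x \<noteq> e" "x \<noteq> dual e" for x
      using above_bottom[of "dual x"] that Ndu[of "dual x" e] by (auto simp: dual_swap)
    note below = above_bottom this
    have "G i j = (i = e \<or> j = dual e \<or> (i \<noteq> dual e \<and> j \<noteq> e))" if r: "root_pair m n i j" for i j
    proof -
      have ij: "i \<in> sidx m n" "j \<in> sidx m n" "i \<noteq> j" using r by (auto simp: rp)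
      have x1: "j \<noteq> dual e" if "i = e" using that r e by (auto simp: rp)
      have x2: "i \<noteq> dual e" if "j = e" using that r e by (auto simp: rp)
      have G': "G i j" if "i \<noteq> e" "i \<noteq> dual e" "j \<noteq> e" "j \<noteq> dual e"
      proof -
        have "root_pair m n e j" "root_pair m n e i" "root_pair m n j i"
          using that ij e r by (auto simp: rp)
        then have "\<not> N j i" using ab[of e j i] below ij that by blast
        then show ?thesis using Ntot r by blast
      qed
      show ?thesis
      proof (cases "i = e \<or> i = dual e \<or> j = e \<or> j = dual e")
        case True
        then show ?thesis using below[of i] below[of j] x1 x2 ij by (auto simp: N_def)
      qed (use G' in blast)
    qed
    then show ?thesis using e by blast
  qed
qed

section \<open>Weyl group orbits\<close>

text \<open>Any number of sign changes of the \<open>\<epsilon>\<^sub>i\<close> is admitted, so that the results below cover both the Weyl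
  group and the diagram automorphism \<open>theta_bar\<close>.\<close>

definition signed_data :: "nat \<Rightarrow> nat \<Rightarrow> (nat \<Rightarrow> nat) \<Rightarrow> (nat \<Rightarrow> complex) \<Rightarrow> (nat \<Rightarrow> nat) \<Rightarrow> (nat \<Rightarrow> complex) \<Rightarrow> bool" where
  "signed_data m n \<sigma> s \<tau> t \<longleftrightarrow>
     \<sigma> permutes {1..m} \<and> \<tau> permutes {1..n} \<and> range s \<subseteq> signs \<and> range t \<subseteq> signs"

fun reindex_idx :: "(nat \<Rightarrow> nat) \<Rightarrow> (nat \<Rightarrow> complex) \<Rightarrow> (nat \<Rightarrow> nat) \<Rightarrow> (nat \<Rightarrow> complex) \<Rightarrow> idx \<Rightarrow> sidx" where
  "reindex_idx \<sigma> s \<tau> t (Eps i) = (if s i = - 1 then Neg (Eps (\<sigma> i)) else Pos (Eps (\<sigma> i)))"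
| "reindex_idx \<sigma> s \<tau> t (Del k) = (if t k = - 1 then Neg (Del (\<tau> k)) else Pos (Del (\<tau> k)))"

text \<open>The permutation of labels inverse to the one by which \<open>signed_perm\<close> moves the weights \<open>wt i\<close>. The
  inverse is the convenient one: coordinates of the image of a weight are coordinates of the weight at the reindexed label,
  and the image of a set of roots is described by pulling its relation back.\<close>

fun reindex :: "(nat \<Rightarrow> nat) \<Rightarrow> (nat \<Rightarrow> complex) \<Rightarrow> (nat \<Rightarrow> nat) \<Rightarrow> (nat \<Rightarrow> complex) \<Rightarrow> sidx \<Rightarrow> sidx" where
  "reindex \<sigma> s \<tau> t (Pos a) = reindex_idx \<sigma> s \<tau> t a"
| "reindex \<sigma> s \<tau> t (Neg a) = dual (reindex_idx \<sigma> s \<tau> t a)"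

lemma reindex_dual [simp]: "reindex \<sigma> s \<tau> t (dual i) = dual (reindex \<sigma> s \<tau> t i)"
  by (cases i) auto

lemma reindex_odd [simp]: "sidx_odd (reindex \<sigma> s \<tau> t i) = sidx_odd i"
proof -
  have "sidx_odd (reindex \<sigma> s \<tau> t (Pos a)) = idx_odd a" for a by (cases a) auto
  then show ?thesis by (cases i) auto
qed

lemma sidx_simps [simp]:
  "Pos a \<in> sidx m n \<longleftrightarrow> a \<in> idx m n" "Neg a \<in> sidx m n \<longleftrightarrow> a \<in> idx m n"
  "Eps i \<in> idx m n \<longleftrightarrow> i \<in> {1..m}" "Del k \<in> idx m n \<longleftrightarrow> k \<in> {1..n}"
  by (auto simp: sidx_def idx_def)

context
  fixes m n \<sigma> s \<tau> t
  assumes sd: "signed_data m n \<sigma> s \<tau> t"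
begin

lemma signed_data_facts:
  "\<sigma> permutes {1..m}" "\<tau> permutes {1..n}" "s i = 1 \<or> s i = - 1" "t k = 1 \<or> t k = - 1"
  using sd by (auto simp: signed_data_def)

lemma reindex_in_sidx [simp]: "reindex \<sigma> s \<tau> t i \<in> sidx m n \<longleftrightarrow> i \<in> sidx m n"
proof -
  have "reindex \<sigma> s \<tau> t (Pos a) \<in> sidx m n \<longleftrightarrow> a \<in> idx m n" for a
    using permutes_in_image[OF signed_data_facts(1)] permutes_in_image[OF signed_data_facts(2)]
    by (cases a) auto
  then show ?thesis by (cases i) auto
qed

lemma coef_signed_perm: "coef (signed_perm \<sigma> s \<tau> t \<alpha>) z = coef \<alpha> (reindex \<sigma> s \<tau> t z)"
proof -
  have "coef (signed_perm \<sigma> s \<tau> t \<alpha>) (Pos a) = coef \<alpha> (reindex \<sigma> s \<tau> t (Pos a))" for a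
    using signed_data_facts(3,4) by (cases a) (auto simp: signed_perm_def)
  moreover have "coef \<beta> (dual y) = - coef \<beta> y" for \<beta> y by (cases y) auto
  ultimately show ?thesis by (cases z) (auto simp flip: coef.simps(1))
qed

lemma reindex_inj: "reindex \<sigma> s \<tau> t i = reindex \<sigma> s \<tau> t j \<longleftrightarrow> i = j"
proof
  have \<sigma>: "\<sigma> x = \<sigma> y \<longleftrightarrow> x = y" and \<tau>: "\<tau> x = \<tau> y \<longleftrightarrow> x = y" for x y
    using permutes_inj[OF signed_data_facts(1)] permutes_inj[OF signed_data_facts(2)] by (auto dest: injD)
  have 1: "a = b" if "reindex_idx \<sigma> s \<tau> t a = reindex_idx \<sigma> s \<tau> t b" for a b
    using that by (cases a; cases b) (auto simp: \<sigma> \<tau> split: if_splits)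
  have 2: "reindex_idx \<sigma> s \<tau> t a \<noteq> dual (reindex_idx \<sigma> s \<tau> t b)" for a b
  proof
    assume *: "reindex_idx \<sigma> s \<tau> t a = dual (reindex_idx \<sigma> s \<tau> t b)"
    then have "a = b" by (cases a; cases b) (auto simp: \<sigma> \<tau> split: if_splits)
    then show False using * by simp
  qed
  assume "reindex \<sigma> s \<tau> t i = reindex \<sigma> s \<tau> t j"
  then show "i = j" using 1 2 2[symmetric] by (cases i; cases j) auto
qed simp

lemma reindex_surj:
  assumes "i \<in> sidx m n" obtains j where "j \<in> sidx m n" "i = reindex \<sigma> s \<tau> t j"
proof -
  have "reindex \<sigma> s \<tau> t ` sidx m n = sidx m n"
    by (rule endo_inj_surj) (auto simp: finite_sidx inj_on_def reindex_inj)
  then show ?thesis using that assms by blast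
qed

lemma root_pair_reindex [simp]:
  "root_pair m n (reindex \<sigma> s \<tau> t i) (reindex \<sigma> s \<tau> t j) \<longleftrightarrow> root_pair m n i j"
  by (simp add: root_pair_def reindex_inj flip: reindex_dual)

lemma signed_perm_wt_diff:
  "signed_perm \<sigma> s \<tau> t (wt (reindex \<sigma> s \<tau> t i) - wt (reindex \<sigma> s \<tau> t j)) = wt i - wt j"
  by (rule coef_eqI) (simp add: coef_signed_perm coef_diff coef_wt reindex_inj flip: reindex_dual)

lemma signed_perm_root_set:
  "signed_perm \<sigma> s \<tau> t ` root_set m n G =
   root_set m n (\<lambda>i j. G (reindex \<sigma> s \<tau> t i) (reindex \<sigma> s \<tau> t j))"
proof (intro set_eqI iffI)
  fix \<alpha> assume "\<alpha> \<in> signed_perm \<sigma> s \<tau> t ` root_set m n G"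
  then obtain i j where *: "\<alpha> = signed_perm \<sigma> s \<tau> t (wt i - wt j)" "root_pair m n i j" "G i j"
    by (auto simp: root_set_def)
  obtain i' j' where "i = reindex \<sigma> s \<tau> t i'" "j = reindex \<sigma> s \<tau> t j'"
    using *(2) reindex_surj unfolding root_pair_def by metis
  with * show "\<alpha> \<in> root_set m n (\<lambda>i j. G (reindex \<sigma> s \<tau> t i) (reindex \<sigma> s \<tau> t j))"
    unfolding root_set_def by (auto simp: signed_perm_wt_diff)
next
  fix \<alpha> assume "\<alpha> \<in> root_set m n (\<lambda>i j. G (reindex \<sigma> s \<tau> t i) (reindex \<sigma> s \<tau> t j))"
  then obtain i j where *: "\<alpha> = wt i - wt j" "root_pair m n i j"
      "G (reindex \<sigma> s \<tau> t i) (reindex \<sigma> s \<tau> t j)"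
    by (auto simp: root_set_def)
  then have "wt (reindex \<sigma> s \<tau> t i) - wt (reindex \<sigma> s \<tau> t j) \<in> root_set m n G"
    unfolding root_set_def using root_pair_reindex by blast
  then show "\<alpha> \<in> signed_perm \<sigma> s \<tau> t ` root_set m n G"
    using * signed_perm_wt_diff by (metis imageI)
qed

lemma signed_perm_lagr: "signed_perm \<sigma> s \<tau> t ` lagr_parabolic m n A = lagr_parabolic m n (reindex \<sigma> s \<tau> t -` A)"
  by (simp add: lagr_parabolic_def signed_perm_root_set)

lemma signed_perm_line:
  "signed_perm \<sigma> s \<tau> t ` line_parabolic m n (reindex \<sigma> s \<tau> t e) = line_parabolic m n e"
  by (simp add: line_parabolic_def signed_perm_root_set reindex_inj flip: reindex_dual)

lemma lagrangian_reindex: "lagrangian m n A \<Longrightarrow> lagrangian m n (reindex \<sigma> s \<tau> t -` A)"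
  unfolding lagrangian_def using reindex_in_sidx by auto

end

definition neg_count :: "nat \<Rightarrow> sidx set \<Rightarrow> nat" where
  "neg_count m A = card {i \<in> {1..m}. Neg (Eps i) \<in> A}"

lemma even_card_xor:
  assumes "finite I"
  shows "even (card {i \<in> I. p i \<noteq> q i}) \<longleftrightarrow> (even (card {i \<in> I. p i}) \<longleftrightarrow> even (card {i \<in> I. q i}))"
  using assms
proof induction
  case (insert x I)
  have *: "{i \<in> insert x I. r i} = (if r x then insert x {i \<in> I. r i} else {i \<in> I. r i})" for r
    by auto
  show ?case using insert unfolding * by auto
qed simp

text \<open>The label \<open>Neg (Eps i)\<close> lies in the preimage iff exactly one of the two happens:
  \<open>Neg (Eps (\<sigma> i))\<close> lies in \<open>A\<close>, or the sign at \<open>i\<close> is negative.\<close>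

lemma neg_count_reindex:
  assumes sd: "signed_data m n \<sigma> s \<tau> t" and lag: "lagrangian m n A"
  shows "even (neg_count m (reindex \<sigma> s \<tau> t -` A)) \<longleftrightarrow>
    (even (neg_count m A) \<longleftrightarrow> even (card {i \<in> {1..m}. s i = - 1}))"
proof -
  have \<sigma>: "\<sigma> permutes {1..m}" using sd by (simp add: signed_data_def)
  have "Pos (Eps i) \<in> A \<longleftrightarrow> Neg (Eps i) \<notin> A" if "i \<in> {1..m}" for i
    using lag that unfolding lagrangian_def
    by (metis dual.simps(2) sidx_simps(2,3))
  then have "{i \<in> {1..m}. Neg (Eps i) \<in> reindex \<sigma> s \<tau> t -` A} =
      {i \<in> {1..m}. (Neg (Eps (\<sigma> i)) \<in> A) \<noteq> (s i = - 1)}"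
    using permutes_in_image[OF \<sigma>] by (auto split: if_splits)
  moreover have "card {i \<in> {1..m}. Neg (Eps (\<sigma> i)) \<in> A} = neg_count m A"
  proof -
    have "{i \<in> {1..m}. Neg (Eps i) \<in> A} = \<sigma> ` {i \<in> {1..m}. Neg (Eps (\<sigma> i)) \<in> A}"
      using permutes_in_image[OF \<sigma>] permutes_surj[OF \<sigma>] by (auto simp: image_iff) (metis surjD)
    moreover have "inj_on \<sigma> {i \<in> {1..m}. Neg (Eps (\<sigma> i)) \<in> A}"
      using permutes_inj[OF \<sigma>] by (rule inj_on_subset) simp
    ultimately show ?thesis by (simp add: neg_count_def card_image)
  qed
  ultimately show ?thesis
    unfolding neg_count_def[of m "reindex \<sigma> s \<tau> t -` A"]
    by (simp only: even_card_xor[OF finite_atLeastAtMost])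
qed

lemma weyl_iff:
  "w \<in> weyl m n \<longleftrightarrow> (\<exists>\<sigma> s \<tau> t. w = signed_perm \<sigma> s \<tau> t \<and> signed_data m n \<sigma> s \<tau> t \<and>
     even (card {i \<in> {1..m}. s i = - 1}))"
  unfolding weyl_def signed_data_def by blast

text \<open>The parity of the number of negative labels is invariant under even sign changes. Conversely, flipping the sign
  at every index where \<open>A\<close> and \<open>A'\<close> differ carries one to the other, and the number of flipped \<open>\<epsilon>\<^sub>i\<close> is
  even exactly when the parities agree; signs of the \<open>\<delta>\<^sub>k\<close> are unrestricted.\<close>

lemma weyl_orbit_lagr:
  assumes lag: "lagrangian m n A"
  shows "weyl_orbit m n (lagr_parabolic m n A) =
    {lagr_parabolic m n A' | A'. lagrangian m n A' \<and> (even (neg_count m A') \<longleftrightarrow> even (neg_count m A))}"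
proof (intro set_eqI iffI)
  fix Q assume "Q \<in> weyl_orbit m n (lagr_parabolic m n A)"
  then obtain \<sigma> s \<tau> t where Q: "Q = signed_perm \<sigma> s \<tau> t ` lagr_parabolic m n A"
    and sd: "signed_data m n \<sigma> s \<tau> t" and ev: "even (card {i \<in> {1..m}. s i = - 1})"
    unfolding weyl_orbit_def weyl_iff by blast
  show "Q \<in> {lagr_parabolic m n A' | A'. lagrangian m n A' \<and> (even (neg_count m A') \<longleftrightarrow> even (neg_count m A))}"
    using Q signed_perm_lagr[OF sd] lagrangian_reindex[OF sd lag] neg_count_reindex[OF sd lag] ev
    by auto
next
  fix Q assume "Q \<in> {lagr_parabolic m n A' | A'. lagrangian m n A' \<and> (even (neg_count m A') \<longleftrightarrow> even (neg_count m A))}"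
  then obtain A' where Q: "Q = lagr_parabolic m n A'" and lag': "lagrangian m n A'"
    and par: "even (neg_count m A') \<longleftrightarrow> even (neg_count m A)" by blast
  define s :: "nat \<Rightarrow> complex" where
    "s = (\<lambda>i. if (Neg (Eps i) \<in> A) \<noteq> (Neg (Eps i) \<in> A') then - 1 else 1)"
  define t :: "nat \<Rightarrow> complex" where
    "t = (\<lambda>k. if (Neg (Del k) \<in> A) \<noteq> (Neg (Del k) \<in> A') then - 1 else 1)"
  have sd: "signed_data m n id s id t"
    by (auto simp: signed_data_def permutes_id s_def t_def)
  have "Pos a \<in> A \<longleftrightarrow> Neg a \<notin> A" "Pos a \<in> A' \<longleftrightarrow> Neg a \<notin> A'" if "a \<in> idx m n" for a
    using lag lag' that unfolding lagrangian_def by (metis dual.simps(2) sidx_simps(2))+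
  then have "reindex id s id t (Pos a) \<in> A \<longleftrightarrow> Pos a \<in> A'"
    "reindex id s id t (Neg a) \<in> A \<longleftrightarrow> Neg a \<in> A'" if "a \<in> idx m n" for a
    using that by (cases a; auto simp: s_def t_def)+
  then have "reindex id s id t i \<in> A \<longleftrightarrow> i \<in> A'" if "i \<in> sidx m n" for i
    using that by (cases i) auto
  moreover have "A \<subseteq> sidx m n" "A' \<subseteq> sidx m n" using lag lag' by (auto simp: lagrangian_def)
  ultimately have "reindex id s id t -` A = A'"
    using reindex_in_sidx[OF sd] by blast
  then have "signed_perm id s id t ` lagr_parabolic m n A = Q"
    using signed_perm_lagr[OF sd] Q by simp
  moreover have "{i \<in> {1..m}. s i = - 1} = {i \<in> {1..m}. (Neg (Eps i) \<in> A) \<noteq> (Neg (Eps i) \<in> A')}"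
    by (auto simp: s_def)
  then have "even (card {i \<in> {1..m}. s i = - 1})"
    using par unfolding neg_count_def by (simp only: even_card_xor[OF finite_atLeastAtMost])
  ultimately show "Q \<in> weyl_orbit m n (lagr_parabolic m n A)"
    using sd unfolding weyl_orbit_def weyl_iff by blast
qed

text \<open>A transposition moves the index of \<open>e\<close> to that of \<open>e'\<close>. If the sign is wrong, it is flipped
  together with the sign at any other index, which does not affect \<open>e'\<close>; this is where \<open>m > 1\<close>
  enters.\<close>

lemma weyl_orbit_line:
  assumes "m > 1" and e: "e \<in> sidx m n" "\<not> sidx_odd e"
  shows "weyl_orbit m n (line_parabolic m n e) = {line_parabolic m n e' | e'. e' \<in> sidx m n \<and> \<not> sidx_odd e'}"
proof (intro set_eqI iffI)
  fix Q assume "Q \<in> weyl_orbit m n (line_parabolic m n e)"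
  then obtain \<sigma> s \<tau> t where Q: "Q = signed_perm \<sigma> s \<tau> t ` line_parabolic m n e"
    and sd: "signed_data m n \<sigma> s \<tau> t"
    unfolding weyl_orbit_def weyl_iff by blast
  obtain e' where e': "e' \<in> sidx m n" "e = reindex \<sigma> s \<tau> t e'"
    using reindex_surj[OF sd e(1)] by metis
  then have "Q = line_parabolic m n e'" "\<not> sidx_odd e'"
    using Q e(2) signed_perm_line[OF sd] by auto
  then show "Q \<in> {line_parabolic m n e' | e'. e' \<in> sidx m n \<and> \<not> sidx_odd e'}" using e' by blast
next
  fix Q assume "Q \<in> {line_parabolic m n e' | e'. e' \<in> sidx m n \<and> \<not> sidx_odd e'}"
  then obtain e' where Q: "Q = line_parabolic m n e'" and e': "e' \<in> sidx m n" "\<not> sidx_odd e'" by blast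
  have even_idx: "\<exists>i\<in>{1..m}. x = Pos (Eps i) \<or> x = Neg (Eps i)"
    if "x \<in> sidx m n" "\<not> sidx_odd x" for x
  proof (cases x)
    case (Pos a) with that show ?thesis by (cases a) auto
  next
    case (Neg a) with that show ?thesis by (cases a) auto
  qed
  obtain i where i: "i \<in> {1..m}" "e = Pos (Eps i) \<or> e = Neg (Eps i)"
    using even_idx[OF e] by blast
  obtain i' where i': "i' \<in> {1..m}" "e' = Pos (Eps i') \<or> e' = Neg (Eps i')"
    using even_idx[OF e'] by blast
  define \<sigma> where "\<sigma> = transpose i i'"
  define flip where "flip \<longleftrightarrow> (e = Pos (Eps i)) \<noteq> (e' = Pos (Eps i'))"
  \<comment> \<open>the indices whose sign changes; the second one only serves to make their number even\<close>
  define J where "J = (if flip then {i', if i' = 1 then 2 else 1} else {})"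
  define s :: "nat \<Rightarrow> complex" where "s = (\<lambda>x. if x \<in> J then - 1 else 1)"
  have sd: "signed_data m n \<sigma> s id (\<lambda>_. 1)"
    using i i' by (auto simp: signed_data_def permutes_id s_def \<sigma>_def permutes_swap_id)
  have "{x \<in> {1..m}. s x = - 1} = J" using i' \<open>m > 1\<close> by (auto simp: s_def J_def)
  then have "even (card {x \<in> {1..m}. s x = - 1})" by (auto simp: J_def)
  moreover have "reindex \<sigma> s id (\<lambda>_. 1) e' = e"
    using i(2) i'(2) by (auto simp: \<sigma>_def s_def J_def flip_def)
  then have "Q = signed_perm \<sigma> s id (\<lambda>_. 1) ` line_parabolic m n e"
    using signed_perm_line[OF sd, of e'] Q by simp
  ultimately show "Q \<in> weyl_orbit m n (line_parabolic m n e)"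
    using sd unfolding weyl_orbit_def weyl_iff by blast
qed

text \<open>If \<open>j\<close> lay in only one of the two sets, comparing \<open>j\<close> with both \<open>k\<close> and \<open>dual k\<close>, for \<open>k\<close> of the other
  parity, would put both of these into the other set.\<close>

lemma lagr_inj:
  assumes lag: "lagrangian m n A" "lagrangian m n A'" and "m \<ge> 1" "n \<ge> 1"
    and eq: "lagr_parabolic m n A = lagr_parabolic m n A'"
  shows "A = A'"
proof -
  have "j \<in> B'" if "j \<in> B" "lagrangian m n B" "lagrangian m n B'" "lagr_parabolic m n B = lagr_parabolic m n B'" for j B B'
  proof (rule ccontr)
    assume "j \<notin> B'"
    \<comment> \<open>a label of the other parity, so that both \<open>k\<close> and \<open>dual k\<close> form roots with \<open>j\<close>\<close>
    define k where "k = (if sidx_odd j then Pos (Eps 1) else Pos (Del 1))"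
    have j: "j \<in> sidx m n" using that by (auto simp: lagrangian_def)
    have k: "k \<in> sidx m n" "sidx_odd k \<noteq> sidx_odd j" using \<open>m \<ge> 1\<close> \<open>n \<ge> 1\<close> by (auto simp: k_def)
    have "root_pair m n j x" if "x = k \<or> x = dual k" for x
      using that j k by (auto simp: root_pair_def)
    then have "wt j - wt x \<in> lagr_parabolic m n B'" if "x = k \<or> x = dual k" for x
      using that \<open>j \<in> B\<close> \<open>lagr_parabolic m n B = lagr_parabolic m n B'\<close>
      by (metis lagr_parabolic_def wt_diff_in_root_set[OF dual_sym_lagr])
    then have "dual x \<in> B'" if "x = k \<or> x = dual k" for x
      using that \<open>j \<notin> B'\<close> wt_diff_in_root_set[OF dual_sym_lagr, of j x m n B']
      by (auto simp: lagr_parabolic_def)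
    from this[of k] this[of "dual k"] show False
      using k \<open>lagrangian m n B'\<close> by (auto simp: lagrangian_def)
  qed
  then show ?thesis using lag eq by blast
qed

text \<open>The two shapes are told apart by the long roots \<open>\<plusminus>2\<delta>\<^sub>1\<close>: both belong to the line type, only one to
  the Lagrangian type.\<close>

lemma lagr_ne_line:
  assumes lag: "lagrangian m n A" and "n \<ge> 1" and "\<not> sidx_odd e"
  shows "lagr_parabolic m n A \<noteq> line_parabolic m n e"
proof
  assume eq: "lagr_parabolic m n A = line_parabolic m n e"
  let ?d = "Pos (Del 1)"
  have d: "?d \<in> sidx m n" using \<open>n \<ge> 1\<close> by simp
  then have r: "root_pair m n ?d (dual ?d)" "root_pair m n (dual ?d) ?d" by (auto simp: root_pair_def)
  have "e \<noteq> ?d" "e \<noteq> dual ?d" "dual e \<noteq> ?d" "dual e \<noteq> dual ?d" 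
    using \<open>\<not> sidx_odd e\<close> dual_odd by (metis idx_odd.simps(2) sidx_odd.simps(1))+
  then have "wt ?d - wt (dual ?d) \<in> line_parabolic m n e" "wt (dual ?d) - wt ?d \<in> line_parabolic m n e"
    using r unfolding line_parabolic_def wt_diff_in_root_set[OF dual_sym_line] by auto
  then have "?d \<in> A" "dual ?d \<in> A"
    unfolding eq[symmetric] lagr_parabolic_def wt_diff_in_root_set[OF dual_sym_lagr] by auto
  then show False using lag d unfolding lagrangian_def by blast
qed

section \<open>Entries of orthosymplectic matrices\<close>

text \<open>The sign that relates the entries of an orthosymplectic matrix at \<open>(i, j)\<close> and at
  \<open>(dual j, dual i)\<close>.\<close>

definition osgn :: "sidx \<Rightarrow> sidx \<Rightarrow> complex" where
  "osgn i j = - ksign (sidx_odd i \<noteq> sidx_odd j) (sidx_odd j) * bform i (dual i) * bform j (dual j)"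

lemma bform_dual: "bform (dual i) i = (if sidx_odd i then - 1 else 1) * bform i (dual i)"
  by (cases i) auto

lemma bform_square [simp]: "bform i (dual i) * bform i (dual i) = 1"
  "bform i (dual i) * (bform i (dual i) * z) = z"
  by (cases i; simp)+

lemma osgn_dual: "osgn (dual j) (dual i) = osgn i j"
  by (auto simp: osgn_def bform_dual ksign_def)

lemma osgn_square [simp]: "osgn i j * osgn i j = 1" "osgn i j * (osgn i j * z) = z"
  by (auto simp: osgn_def ksign_def algebra_simps)

text \<open>This multiplicativity up to the Koszul sign is what makes \<open>\<oo>\<ss>\<pp>\<close> closed under the
  superbracket.\<close>

lemma osgn_mult:
  "osgn i k * osgn k j = - ksign (sidx_odd i \<noteq> sidx_odd k) (sidx_odd k \<noteq> sidx_odd j) * osgn i j"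
  by (auto simp: osgn_def ksign_def algebra_simps)

text \<open>Each row of the Gram matrix has a single nonzero entry, so invariance of the form relates only
  two entries of \<open>X\<close> at a time.\<close>

lemma osp_iff:
  "X \<in> osp_carrier m n \<longleftrightarrow> (\<forall>i j. X (i, j) \<noteq> 0 \<longrightarrow> i \<in> sidx m n \<and> j \<in> sidx m n) \<and>
     (\<forall>i j. X (dual j, dual i) = osgn i j * X (i, j))" (is "_ \<longleftrightarrow> ?supp \<and> ?sym")
proof -
  have eq: "X (dual j, i) * bform (dual j) j +
       ksign (sidx_odd i \<noteq> sidx_odd j) (sidx_odd i) * (X (dual i, j) * bform i (dual i)) = 0 \<longleftrightarrow>
      X (dual j, i) = osgn (dual i) j * X (dual i, j)" for i j
  proof -
    have "bform (dual j) j * bform (dual j) j = 1" using bform_square(1)[of "dual j"] by simp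
    then have "X (dual j, i) = osgn (dual i) j * X (dual i, j) \<longleftrightarrow>
      X (dual j, i) * bform (dual j) j = osgn (dual i) j * X (dual i, j) * bform (dual j) j"
      using bform_nz by simp
    moreover have "osgn (dual i) j * X (dual i, j) * bform (dual j) j =
      - (ksign (sidx_odd i \<noteq> sidx_odd j) (sidx_odd i) * (X (dual i, j) * bform i (dual i)))"
      by (auto simp: osgn_def ksign_def bform_dual algebra_simps)
    ultimately show ?thesis by (simp add: eq_neg_iff_add_eq_0)
  qed
  have "X \<in> osp_carrier m n \<longleftrightarrow> (\<forall>x. x \<notin> sidx m n \<times> sidx m n \<longrightarrow> X x = 0) \<and>
     (\<forall>i\<in>sidx m n. \<forall>j\<in>sidx m n. X (dual j, i) = osgn (dual i) j * X (dual i, j))"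
    unfolding osp_carrier_iff eq ..
  also have "(\<forall>x. x \<notin> sidx m n \<times> sidx m n \<longrightarrow> X x = 0) \<longleftrightarrow> ?supp" by auto
  also have "(?supp \<and> (\<forall>i\<in>sidx m n. \<forall>j\<in>sidx m n. X (dual j, i) = osgn (dual i) j * X (dual i, j))) \<longleftrightarrow>
     (?supp \<and> ?sym)"
  proof (intro conj_cong refl iffI allI ballI)
    fix i j assume supp: ?supp
      and *: "\<forall>i\<in>sidx m n. \<forall>j\<in>sidx m n. X (dual j, i) = osgn (dual i) j * X (dual i, j)"
    show "X (dual j, dual i) = osgn i j * X (i, j)"
    proof (cases "i \<in> sidx m n \<and> j \<in> sidx m n")
      case True then show ?thesis using *[rule_format, of "dual i" j] by simp
    next
      case False
      then have "X (i, j) = 0" "X (dual j, dual i) = 0" using supp dual_in by blast+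
      then show ?thesis by simp
    qed
  next
    fix i j assume ?sym
    from this[rule_format, of j "dual i"] show "X (dual j, i) = osgn (dual i) j * X (dual i, j)"
      by simp
  qed
  finally show ?thesis .
qed

lemma osp_support: "X \<in> osp_carrier m n \<Longrightarrow> X (i, j) \<noteq> 0 \<Longrightarrow> i \<in> sidx m n \<and> j \<in> sidx m n"
  by (simp add: osp_iff)

lemma osp_sym: "X \<in> osp_carrier m n \<Longrightarrow> X (dual j, dual i) = osgn i j * X (i, j)"
  by (simp add: osp_iff)

text \<open>For even \<open>i\<close> the entry at \<open>(i, dual i)\<close> is related to itself, with sign \<open>-1\<close>; this is why
  \<open>\<plusminus>2\<epsilon>\<^sub>i\<close> are not roots.\<close>

lemma osp_even_dual_zero:
  assumes "X \<in> osp_carrier m n" "\<not> sidx_odd i"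
  shows "X (i, dual i) = 0"
  using osp_sym[OF assms(1), of "dual i" i] assms(2)
  by (auto simp: osgn_def ksign_def bform_dual)

lemma osp_add: "X \<in> osp_carrier m n \<Longrightarrow> Y \<in> osp_carrier m n \<Longrightarrow> X + Y \<in> osp_carrier m n"
  unfolding osp_iff by (auto simp: distrib_left) (metis add_0)+

lemma osp_scale: "X \<in> osp_carrier m n \<Longrightarrow> c \<odot> X \<in> osp_carrier m n"
  by (auto simp: osp_iff fscale_def)

lemma osp_zero: "0 \<in> osp_carrier m n"
  by (simp add: osp_iff)

text \<open>Symmetrization into \<open>\<oo>\<ss>\<pp>\<close>. The embeddings \<open>levi_embed\<close>, \<open>nil_embed\<close> and \<open>vector_embed\<close>
  below prescribe half of the entries and obtain the others in this way.\<close>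

definition osym :: "sidx cmat \<Rightarrow> sidx cmat" where
  "osym M = (\<lambda>(i, j). M (i, j) + osgn i j * M (dual j, dual i))"

lemma osym_in_osp:
  assumes "\<And>i j. M (i, j) \<noteq> 0 \<Longrightarrow> i \<in> sidx m n \<and> j \<in> sidx m n"
  shows "osym M \<in> osp_carrier m n"
proof -
  have "i \<in> sidx m n \<and> j \<in> sidx m n" if "osym M (i, j) \<noteq> 0" for i j
    using that assms[of i j] assms[of "dual j" "dual i"]
    by (cases "M (i, j) = 0") (auto simp: osym_def)
  then show ?thesis by (auto simp: osp_iff osym_def osgn_dual distrib_left)
qed

lemma superbracket_nonzero:
  assumes "superbracket I p X Y (i, j) \<noteq> 0"
  shows "\<exists>k\<in>I. (X (i, k) \<noteq> 0 \<and> Y (k, j) \<noteq> 0) \<or> (Y (i, k) \<noteq> 0 \<and> X (k, j) \<noteq> 0)"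
proof (rule ccontr)
  assume "\<not> ?thesis"
  then have "superbracket I p X Y (i, j) = 0"
    unfolding superbracket_entry by (intro sum.neutral) auto
  with assms show False by simp
qed

text \<open>Reindexing the sum at \<open>(dual j, dual i)\<close> by \<open>dual\<close> interchanges the two terms of the bracket, and
  \<open>osgn_mult\<close> accounts for the Koszul sign.\<close>

lemma osp_superbracket:
  assumes X: "X \<in> osp_carrier m n" and Y: "Y \<in> osp_carrier m n"
  shows "superbracket (sidx m n) sidx_odd X Y \<in> osp_carrier m n"
  unfolding osp_iff
proof (intro conjI allI impI)
  fix i j
  show "i \<in> sidx m n" "j \<in> sidx m n" if "superbracket (sidx m n) sidx_odd X Y (i, j) \<noteq> 0"
    using superbracket_nonzero[OF that] X Y osp_support by blast+
  let ?f = "\<lambda>i k j. X (i,k) * Y (k,j)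
     - ksign (sidx_odd i \<noteq> sidx_odd k) (sidx_odd k \<noteq> sidx_odd j) * (Y (i,k) * X (k,j))"
  have "bij_betw dual (sidx m n) (sidx m n)"
    by (rule bij_betw_byWitness[of _ dual]) auto
  then have "superbracket (sidx m n) sidx_odd X Y (dual j, dual i) =
      (\<Sum>k\<in>sidx m n. ?f (dual j) (dual k) (dual i))"
    unfolding superbracket_entry by (rule sum.reindex_bij_betw[symmetric])
  also have "\<dots> = (\<Sum>k\<in>sidx m n. osgn i j * ?f i k j)"
  proof (rule sum.cong[OF refl])
    fix k
    have "X (dual j, dual k) * Y (dual k, dual i) = (osgn i k * osgn k j) * (Y (i,k) * X (k,j))"
         "Y (dual j, dual k) * X (dual k, dual i) = (osgn i k * osgn k j) * (X (i,k) * Y (k,j))"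
      by (simp_all add: osp_sym[OF X] osp_sym[OF Y])
    then show "?f (dual j) (dual k) (dual i) = osgn i j * ?f i k j"
      unfolding osgn_mult by (auto simp: ksign_def algebra_simps)
  qed
  also have "\<dots> = osgn i j * superbracket (sidx m n) sidx_odd X Y (i, j)"
    unfolding superbracket_entry by (simp add: sum_distrib_left)
  finally show "superbracket (sidx m n) sidx_odd X Y (dual j, dual i) =
      osgn i j * superbracket (sidx m n) sidx_odd X Y (i, j)" .
qed

lemma sum_fun_apply: "(\<Sum>a\<in>D. f a) x = (\<Sum>a\<in>D. f a x)"
  by (induction D rule: infinite_finite_induct) auto

section \<open>Levi subalgebras, nilradicals and the cominuscule condition\<close>

text \<open>The span of root spaces is cut out by a condition on the support: grouping the entries of \<open>X\<close> by
  the weight \<open>wt i - wt j\<close> decomposes \<open>X\<close>, and each component stays in \<open>\<oo>\<ss>\<pp>\<close> because \<open>(i, j)\<close> and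
  \<open>(dual j, dual i)\<close> have the same weight.\<close>

lemma span_root_spaces:
  assumes supp: "\<And>\<alpha> a. \<alpha> \<in> Q \<Longrightarrow> a \<notin> idx m n \<Longrightarrow> \<alpha> a = 0"
  shows "cfun.span (\<Union>\<alpha>\<in>Q. root_space m n \<alpha>) =
    {X \<in> osp_carrier m n. \<forall>i j. X (i, j) \<noteq> 0 \<longrightarrow> wt i - wt j \<in> Q}" (is "_ = ?R")
proof
  have "cfun.subspace ?R"
    unfolding cfun.subspace_def
  proof (intro conjI ballI allI)
    show "0 \<in> ?R" by (simp add: osp_zero)
    show "X + Y \<in> ?R" if "X \<in> ?R" "Y \<in> ?R" for X Y
      using that osp_add[of X m n Y] by (auto, metis add_0)
    show "c \<odot> X \<in> ?R" if "X \<in> ?R" for c X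
      using that osp_scale[of X] by (auto simp: fscale_def)
  qed
  moreover have "(\<Union>\<alpha>\<in>Q. root_space m n \<alpha>) \<subseteq> ?R"
  proof
    fix X assume "X \<in> (\<Union>\<alpha>\<in>Q. root_space m n \<alpha>)"
    then obtain \<alpha> where \<alpha>: "\<alpha> \<in> Q" and X: "X \<in> osp_carrier m n"
      and wt: "\<And>i j a. X (i, j) \<noteq> 0 \<Longrightarrow> a \<in> idx m n \<Longrightarrow> \<alpha> a = wt i a - wt j a"
      by (auto simp: root_space_iff)
    have "wt i - wt j = \<alpha>" if "X (i, j) \<noteq> 0" for i j
    proof
      fix a show "(wt i - wt j) a = \<alpha> a"
        using wt[OF that] supp[OF \<alpha>] wt_outside osp_support[OF X that] by (cases "a \<in> idx m n") auto
    qed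
    then show "X \<in> ?R" using X \<alpha> by auto
  qed
  ultimately show "cfun.span (\<Union>\<alpha>\<in>Q. root_space m n \<alpha>) \<subseteq> ?R"
    by (rule cfun.span_minimal[rotated])
  show "?R \<subseteq> cfun.span (\<Union>\<alpha>\<in>Q. root_space m n \<alpha>)"
  proof
    fix X assume X: "X \<in> ?R"
    define comp where "comp = (\<lambda>\<alpha> (i, j). if wt i - wt j = \<alpha> then X (i, j) else 0)"
    define D where "D = (\<lambda>(i, j). wt i - wt j) ` (sidx m n \<times> sidx m n)"
    have "finite D" by (simp add: D_def finite_sidx)
    have "X = (\<Sum>\<alpha>\<in>D. comp \<alpha>)"
    proof
      fix x :: "sidx \<times> sidx" obtain i j where x: "x = (i, j)" by (cases x)
      have "(\<Sum>\<alpha>\<in>D. comp \<alpha>) x = (\<Sum>\<alpha>\<in>D. if wt i - wt j = \<alpha> then X (i, j) else 0)"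
        by (simp add: sum_fun_apply x comp_def)
      also have "\<dots> = X (i, j)"
        using \<open>finite D\<close> osp_support[of X m n i j] X by (auto simp: D_def)
      finally show "X x = (\<Sum>\<alpha>\<in>D. comp \<alpha>) x" by (simp add: x)
    qed
    moreover have "comp \<alpha> \<in> cfun.span (\<Union>\<alpha>\<in>Q. root_space m n \<alpha>)" for \<alpha>
    proof (cases "\<alpha> \<in> Q")
      case True
      have "comp \<alpha> \<in> osp_carrier m n"
        using X by (auto simp: osp_iff comp_def wt_diff_dual)
      then have "comp \<alpha> \<in> root_space m n \<alpha>"
        by (auto simp: root_space_iff comp_def)
      then show ?thesis using True by (intro cfun.span_base) blast
    next
      case False
      then have "comp \<alpha> x = 0" for x using X by (cases x) (auto simp: comp_def)
      then have "comp \<alpha> = 0" by auto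
      then show ?thesis by (simp add: cfun.span_zero)
    qed
    ultimately show "X \<in> cfun.span (\<Union>\<alpha>\<in>Q. root_space m n \<alpha>)"
      by (metis cfun.span_sum)
  qed
qed

text \<open>This lets the Cartan subalgebra be treated as one more root space in the description of Levi
  subalgebras.\<close>

lemma cartan_root_space: "cartan m n = root_space m n 0"
proof -
  have "X (i, j) = 0" if "X \<in> osp_carrier m n" "i \<noteq> j"
    "\<And>i j. X (i, j) \<noteq> 0 \<Longrightarrow> (\<forall>a\<in>idx m n. 0 = wt i a - wt j a)" for X i j
  proof (rule ccontr)
    assume nz: "X (i, j) \<noteq> 0"
    have "wt i a = wt j a" for a
      using that(3)[OF nz] wt_outside osp_support[OF that(1) nz] by (cases "a \<in> idx m n") auto
    then show False using \<open>i \<noteq> j\<close> wt_inj by blast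
  qed
  moreover have "wt i a = wt j a" if "X (i, j) \<noteq> 0" "\<forall>i j. i \<noteq> j \<longrightarrow> X (i, j) = 0" for X :: "sidx cmat" and i j a
    using that by (cases "i = j") auto
  ultimately show ?thesis
    by (fastforce simp: cartan_def root_space_iff osp_simps)
qed

lemma wt_eq_iff: "wt i = wt j \<longleftrightarrow> i = j"
  using wt_inj by blast

lemma restrict_superspace_carrier: "vcarrier (restrict_superspace V S) = vcarrier V \<inter> S"
  by (simp add: restrict_superspace_def)

lemma roots_outside: "\<alpha> \<in> roots m n \<Longrightarrow> a \<notin> idx m n \<Longrightarrow> \<alpha> a = 0"
  by (auto simp: roots_root_pair root_pair_def wt_outside)

lemma levi_carrier:
  assumes "P \<subseteq> roots m n"
  shows "vcarrier (levi m n P) =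
    {X \<in> osp_carrier m n. \<forall>i j. X (i, j) \<noteq> 0 \<longrightarrow> i = j \<or> wt i - wt j \<in> levi_roots P}"
proof -
  have "cartan m n \<union> (\<Union>\<alpha>\<in>levi_roots P. root_space m n \<alpha>) =
      (\<Union>\<alpha>\<in>insert 0 (levi_roots P). root_space m n \<alpha>)"
    by (simp add: cartan_root_space)
  moreover have "cfun.span (\<Union>\<alpha>\<in>insert 0 (levi_roots P). root_space m n \<alpha>) =
      {X \<in> osp_carrier m n. \<forall>i j. X (i, j) \<noteq> 0 \<longrightarrow> wt i - wt j \<in> insert 0 (levi_roots P)}"
    using assms roots_outside by (intro span_root_spaces) (auto simp: levi_roots_def)
  ultimately show ?thesis
    by (auto simp: levi_def restrict_superspace_carrier osp_simps wt_eq_iff)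
qed

lemma nilradical_carrier:
  assumes "P \<subseteq> roots m n"
  shows "vcarrier (nilradical m n P) =
    {X \<in> osp_carrier m n. \<forall>i j. X (i, j) \<noteq> 0 \<longrightarrow> wt i - wt j \<in> nil_roots P}"
proof -
  have "cfun.span (\<Union>\<alpha>\<in>nil_roots P. root_space m n \<alpha>) =
      {X \<in> osp_carrier m n. \<forall>i j. X (i, j) \<noteq> 0 \<longrightarrow> wt i - wt j \<in> nil_roots P}"
    using assms roots_outside by (intro span_root_spaces) (auto simp: nil_roots_def)
  then show ?thesis by (auto simp: nilradical_def restrict_superspace_carrier osp_simps)
qed

lemma osp_ops:
  "vadd (osp m n) = (+)" "vscale (osp m n) = (\<odot>)"
  "hpart (osp m n) a = {X \<in> osp_carrier m n. \<forall>i j. X (i, j) \<noteq> 0 \<longrightarrow> (sidx_odd i \<noteq> sidx_odd j) = a}"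
  by (auto simp: osp_def gl_def superspace.defs superalgebra.defs fspace_def
      restrict_superspace_def pair_parity_def osp_carrier_def)

lemma levi_ops:
  "vadd (levi m n P) = (+)" "vscale (levi m n P) = (\<odot>)"
  "brk (levi m n P) = superbracket (sidx m n) sidx_odd"
  "hpart (levi m n P) a =
     {X \<in> vcarrier (levi m n P). \<forall>i j. X (i, j) \<noteq> 0 \<longrightarrow> (sidx_odd i \<noteq> sidx_odd j) = a}"
  using osp_ops[of m n] osp_simps[of m n] by (auto simp: levi_def restrict_superspace_def)

lemma nilradical_ops:
  "vadd (nilradical m n P) = (+)" "vscale (nilradical m n P) = (\<odot>)"
  "hpart (nilradical m n P) a =
     {X \<in> vcarrier (nilradical m n P). \<forall>i j. X (i, j) \<noteq> 0 \<longrightarrow> (sidx_odd i \<noteq> sidx_odd j) = a}"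
  using osp_ops[of m n] osp_simps[of m n] by (auto simp: nilradical_def restrict_superspace_def)

lemma root_vector:
  assumes r: "root_pair m n i j"
  obtains X where "X \<in> osp_carrier m n" "X (i, j) \<noteq> 0"
    "\<And>k l. X (k, l) \<noteq> 0 \<Longrightarrow> (k = i \<and> l = j) \<or> (k = dual j \<and> l = dual i)"
proof -
  have "wt i - wt j \<in> roots m n" using r by (simp add: wt_diff_in_roots)
  then have "root_space m n (wt i - wt j) \<noteq> {0}" unfolding roots_eq by blast
  moreover have "0 \<in> root_space m n (wt i - wt j)" by (simp add: root_space_iff osp_zero)
  ultimately obtain X where X: "X \<in> root_space m n (wt i - wt j)" "X \<noteq> 0" by blast
  have osp: "X \<in> osp_carrier m n" using X(1) by (simp add: root_space_iff)
  have "X \<in> cfun.span (\<Union>\<alpha>\<in>{wt i - wt j}. root_space m n \<alpha>)"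
    using X(1) by (auto intro: cfun.span_base)
  also have "\<dots> = {X \<in> osp_carrier m n. \<forall>k l. X (k, l) \<noteq> 0 \<longrightarrow> wt k - wt l \<in> {wt i - wt j}}"
    using r by (intro span_root_spaces) (auto simp: root_pair_def wt_outside)
  finally have ent: "(k = i \<and> l = j) \<or> (k = dual j \<and> l = dual i)" if "X (k, l) \<noteq> 0" for k l
    using that r wt_diff_eq_iff[of i j k l] by (auto simp: root_pair_def)
  obtain k l where "X (k, l) \<noteq> 0" using X(2) by (auto simp: fun_eq_iff)
  then have "X (i, j) \<noteq> 0"
    using ent[of k l] osp_sym[OF osp, of j i] by auto
  then show thesis using that osp ent by blast
qed

text \<open>If \<open>wt i - wt j\<close>, \<open>wt j - wt k\<close> and their sum are roots, the bracket of root vectors has a nonzero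
  entry at \<open>(i, k)\<close>, so such a chain cannot occur in an abelian nilradical. Conversely, a nonzero entry
  \<open>(i, j)\<close> of a bracket comes from a chain through some \<open>k\<close>; the two remaining cases in which
  \<open>wt i - wt j\<close> is not a root are \<open>i = j\<close>, impossible since the nilradical contains no opposite roots, and
  \<open>j = dual i\<close> even, where the entry of every orthosymplectic matrix vanishes.\<close>

lemma cominuscule_iff:
  assumes P: "P \<subseteq> roots m n"
  shows "cominuscule m n P \<longleftrightarrow> parabolic m n P \<and>
    (\<forall>i j k. root_pair m n i j \<longrightarrow> root_pair m n j k \<longrightarrow> root_pair m n i k \<longrightarrow>
       wt i - wt j \<in> nil_roots P \<longrightarrow> wt j - wt k \<notin> nil_roots P)"
proof (intro iffI conjI allI impI notI)
  assume com: "cominuscule m n P"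
  then show "parabolic m n P" by (simp add: cominuscule_def)
  fix i j k assume ij: "root_pair m n i j" and jk: "root_pair m n j k" and ik: "root_pair m n i k"
    and N: "wt i - wt j \<in> nil_roots P" "wt j - wt k \<in> nil_roots P"
  obtain X where X: "X \<in> osp_carrier m n" "X (i, j) \<noteq> 0"
    and Xe: "\<And>k l. X (k, l) \<noteq> 0 \<Longrightarrow> (k = i \<and> l = j) \<or> (k = dual j \<and> l = dual i)"
    using root_vector[OF ij] by blast
  obtain Y where Y: "Y \<in> osp_carrier m n" "Y (j, k) \<noteq> 0"
    and Ye: "\<And>k' l. Y (k', l) \<noteq> 0 \<Longrightarrow> (k' = j \<and> l = k) \<or> (k' = dual k \<and> l = dual j)"
    using root_vector[OF jk] by blast
  have "wt k - wt l \<in> nil_roots P" if "X (k, l) \<noteq> 0" for k l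
    using Xe[OF that] N(1) by (auto simp: wt_diff_dual)
  moreover have "wt k' - wt l \<in> nil_roots P" if "Y (k', l) \<noteq> 0" for k' l
    using Ye[OF that] N(2) by (auto simp: wt_diff_dual)
  ultimately have "X \<in> vcarrier (nilradical m n P)" "Y \<in> vcarrier (nilradical m n P)"
    unfolding nilradical_carrier[OF P] using X Y by auto
  then have zero: "superbracket (sidx m n) sidx_odd X Y (i, k) = 0"
    using com by (simp add: cominuscule_def osp_simps)
  \<comment> \<open>for \<open>k = dual i\<close> both halves of the superbracket contribute the same amount, so nothing cancels\<close>
  let ?s = "if k = dual i then 2 else 1"
  have "superbracket (sidx m n) sidx_odd X Y (i, k) =
    (\<Sum>l\<in>sidx m n. (if l = j then X (i,j) * Y (j,k) else 0) +
      (if l = dual j then (if k = dual i then X (i,j) * Y (j,k) else 0) else 0))"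
    unfolding superbracket_entry
  proof (rule sum.cong[OF refl])
    fix l
    have ne: "i \<noteq> j" "j \<noteq> k" "i \<noteq> k" using ij jk ik by (auto simp: root_pair_def)
    have 1: "X (i,l) * Y (l,k) = (if l = j then X (i,j) * Y (j,k) else 0)"
      using Xe[of i l] by (cases "X (i, l) = 0") auto
    have 2: "Y (i,l) * X (l,k) = (if l = dual j \<and> k = dual i then
        Y (dual k, dual j) * X (dual j, dual i) else 0)"
      using Ye[of i l] Xe[of l k] ne by (cases "Y (i, l) = 0"; cases "X (l, k) = 0") auto
    have 3: "ksign (sidx_odd i \<noteq> sidx_odd (dual j)) (sidx_odd (dual j) \<noteq> sidx_odd (dual i)) *
       (Y (dual (dual i), dual j) * X (dual j, dual i)) = - (X (i,j) * Y (j, dual i))" if "k = dual i"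
    proof -
      have "sidx_odd i" using ik that by (simp add: root_pair_def)
      have "osgn j (dual i) * osgn i j = osgn i j * osgn j (dual i)" by simp
      also have "\<dots> = - ksign (sidx_odd i \<noteq> sidx_odd j) (sidx_odd j \<noteq> sidx_odd (dual i)) * osgn i (dual i)"
        by (rule osgn_mult)
      also have "osgn i (dual i) = 1" using \<open>sidx_odd i\<close> by (simp add: osgn_def ksign_def bform_dual)
      finally have "ksign (sidx_odd i \<noteq> sidx_odd j) (sidx_odd j \<noteq> sidx_odd i) *
          (osgn j (dual i) * osgn i j) = - 1" by (simp add: ksign_def)
      moreover have "ksign (sidx_odd i \<noteq> sidx_odd (dual j)) (sidx_odd (dual j) \<noteq> sidx_odd (dual i)) *
          (Y (dual (dual i), dual j) * X (dual j, dual i)) =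
          ksign (sidx_odd i \<noteq> sidx_odd j) (sidx_odd j \<noteq> sidx_odd i) *
          (osgn j (dual i) * osgn i j) * (X (i,j) * Y (j, dual i))"
        unfolding osp_sym[OF X(1)] osp_sym[OF Y(1)] dual_odd by (simp only: mult_ac)
      ultimately show ?thesis by simp
    qed
    show "X (i,l) * Y (l,k)
     - ksign (sidx_odd i \<noteq> sidx_odd l) (sidx_odd l \<noteq> sidx_odd k) * (Y (i,l) * X (l,k)) =
     (if l = j then X (i,j) * Y (j,k) else 0) +
      (if l = dual j then (if k = dual i then X (i,j) * Y (j,k) else 0) else 0)"
      unfolding 1 2 using 3 by auto
  qed
  also have "\<dots> = ?s * (X (i,j) * Y (j,k))"
    using ij by (auto simp: sum.distrib finite_sidx root_pair_def)
  finally show False using zero X(2) Y(2) by (auto split: if_splits)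
next
  assume *: "parabolic m n P \<and> (\<forall>i j k. root_pair m n i j \<longrightarrow> root_pair m n j k \<longrightarrow> root_pair m n i k \<longrightarrow>
       wt i - wt j \<in> nil_roots P \<longrightarrow> wt j - wt k \<notin> nil_roots P)"
  show "cominuscule m n P"
    unfolding cominuscule_def osp_simps
  proof (intro conjI ballI)
    show "parabolic m n P" using * by simp
    fix X Y assume XY: "X \<in> vcarrier (nilradical m n P)" "Y \<in> vcarrier (nilradical m n P)"
    then have osp: "X \<in> osp_carrier m n" "Y \<in> osp_carrier m n"
      by (auto simp: nilradical_carrier[OF P])
    have "superbracket (sidx m n) sidx_odd X Y (i, j) = 0" for i j
    proof (rule ccontr)
      assume nz: "superbracket (sidx m n) sidx_odd X Y (i, j) \<noteq> 0"
      then obtain k where N: "wt i - wt k \<in> nil_roots P" "wt k - wt j \<in> nil_roots P"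
        using superbracket_nonzero[OF nz] XY unfolding nilradical_carrier[OF P] by blast
      then have "wt i - wt k \<in> roots m n" "wt k - wt j \<in> roots m n"
        using P by (auto simp: nil_roots_def)
      then have r: "root_pair m n i k" "root_pair m n k j" by (auto simp: wt_diff_in_roots)
      have "i \<noteq> j"
      proof
        assume "i = j"
        then have "wt i - wt k = - (wt k - wt j)" by simp
        then have "wt i - wt k \<in> uminus ` P" using N(2) unfolding nil_roots_def by blast
        then show False using N(1) by (simp add: nil_roots_def)
      qed
      moreover have "sidx_odd i" if "j = dual i"
        using osp_even_dual_zero[OF osp_superbracket[OF osp], of i] nz that by blast
      ultimately have "root_pair m n i j" using r by (auto simp: root_pair_def)
      then show False using * r N by blast
    qed
    then show "superbracket (sidx m n) sidx_odd X Y = 0" by (auto simp: fun_eq_iff)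
  qed
qed

lemma lagrangian_dual: "lagrangian m n A \<Longrightarrow> j \<in> sidx m n \<Longrightarrow> dual j \<in> A \<longleftrightarrow> j \<notin> A"
  by (simp add: lagrangian_def)

lemma nil_roots_lagr:
  "nil_roots (lagr_parabolic m n A) =
    root_set m n (\<lambda>i j. (i \<in> A \<or> dual j \<in> A) \<and> \<not> (j \<in> A \<or> dual i \<in> A))"
  unfolding lagr_parabolic_def by (rule nil_roots_root_set[OF dual_sym_lagr])

lemma dual_sym_nil: "dual_sym G \<Longrightarrow> dual_sym (\<lambda>i j. G i j \<and> \<not> G j i)"
  by (simp add: dual_sym_def)

text \<open>There are only two levels, hence no two consecutive strict steps.\<close>

lemma cominuscule_lagr:
  assumes lag: "lagrangian m n A" and "n \<ge> 1"
  shows "cominuscule m n (lagr_parabolic m n A)"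
proof -
  have S: "lagr_parabolic m n A \<subseteq> roots m n" by (simp add: lagr_parabolic_def root_set_subset)
  define d where "d = (if Pos (Del 1) \<in> A then Pos (Del 1) else dual (Pos (Del 1)))"
  have "d \<in> A" "d \<in> sidx m n" "sidx_odd d"
    using lagrangian_dual[OF lag, of "Pos (Del 1)"] \<open>n \<ge> 1\<close> by (auto simp: d_def)
  then have d: "root_pair m n (dual d) d" "dual d \<notin> A"
    using lagrangian_dual[OF lag, of d] by (auto simp: root_pair_def)
  have "parabolic m n (lagr_parabolic m n A)"
    unfolding lagr_parabolic_def
  proof (rule parabolic_root_set[OF dual_sym_lagr, where x = "dual d" and y = d])
    fix i j k assume "root_pair m n i j"
    then have ij: "i \<in> sidx m n" "j \<in> sidx m n" by (auto simp: root_pair_def)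
    show "(i \<in> A \<or> dual j \<in> A) \<or> (j \<in> A \<or> dual i \<in> A)"
      using ij lagrangian_dual[OF lag] by blast
    show "i \<in> A \<or> dual k \<in> A" if "i \<in> A \<or> dual j \<in> A" "j \<in> A \<or> dual k \<in> A"
      using that ij lagrangian_dual[OF lag] by blast
  qed (use d in auto)
  then show ?thesis
    using lagrangian_dual[OF lag]
    unfolding cominuscule_iff[OF S] nil_roots_lagr wt_diff_in_root_set[OF dual_sym_nil[OF dual_sym_lagr]]
    by (auto simp: root_pair_def)
qed

lemma nil_roots_line:
  "nil_roots (line_parabolic m n e) =
    root_set m n (\<lambda>i j. (i = e \<or> j = dual e \<or> (i \<noteq> dual e \<and> j \<noteq> e)) \<and>
      \<not> (j = e \<or> i = dual e \<or> (j \<noteq> dual e \<and> i \<noteq> e)))"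
  unfolding line_parabolic_def by (rule nil_roots_root_set[OF dual_sym_line])

text \<open>The only consecutive strict steps lead from \<open>e\<close> to \<open>dual e\<close>, and \<open>wt e - wt (dual e)\<close> is not a
  root.\<close>

lemma cominuscule_line:
  assumes e: "e \<in> sidx m n" "\<not> sidx_odd e" and "n \<ge> 1"
  shows "cominuscule m n (line_parabolic m n e)"
proof -
  have S: "line_parabolic m n e \<subseteq> roots m n" by (simp add: line_parabolic_def root_set_subset)
  let ?d = "Pos (Del 1)"
  have "sidx_odd ?d" by simp
  then have d: "?d \<in> sidx m n" "?d \<noteq> e" "?d \<noteq> dual e"
    using e \<open>n \<ge> 1\<close> by (simp, metis, metis dual_odd)
  have "dual e \<noteq> dual ?d" using d(2) by (metis dual_eq_iff)
  have "parabolic m n (line_parabolic m n e)"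
    unfolding line_parabolic_def
  proof (rule parabolic_root_set[OF dual_sym_line, where x = "dual e" and y = ?d])
    show "root_pair m n (dual e) ?d" using d e by (auto simp: root_pair_def)
  qed (use d e in \<open>auto simp: root_pair_def\<close>)
  then show ?thesis
    using e
    unfolding cominuscule_iff[OF S] nil_roots_line wt_diff_in_root_set[OF dual_sym_nil[OF dual_sym_line]]
    by (auto simp: root_pair_def)
qed

theorem cominuscule_cases:
  assumes "cominuscule m n P" and "n \<ge> 1"
  obtains (lagr_parabolic) A where "lagrangian m n A" "P = lagr_parabolic m n A"
  | (line_parabolic) e where "e \<in> sidx m n" "\<not> sidx_odd e" "P = line_parabolic m n e"
proof -
  have par: "parabolic m n P" using assms(1) by (simp add: cominuscule_def)
  note P = parabolicD[OF par]
  have ab: "root_pair m n i j \<Longrightarrow> root_pair m n j k \<Longrightarrow> root_pair m n i k \<Longrightarrow>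
      wt i - wt j \<in> nil_roots P \<Longrightarrow> wt j - wt k \<notin> nil_roots P" for i j k
    using assms(1) unfolding cominuscule_iff[OF P(4)] by blast
  have nil: "wt i - wt j \<in> nil_roots P" if "wt i - wt j \<in> P" "wt j - wt i \<notin> P" for i j
  proof -
    have "wt j - wt i = \<beta>" if "wt i - wt j = - \<beta>" for \<beta>
      using arg_cong[OF that, of uminus] by simp
    then show ?thesis using that by (auto simp: nil_roots_def)
  qed
  define G where "G = (\<lambda>i j. wt i - wt j \<in> P)"
  have "dual_sym G" by (simp add: dual_sym_def G_def wt_diff_dual)
  then have "(\<exists>A. lagrangian m n A \<and> (\<forall>i j. root_pair m n i j \<longrightarrow> G i j = (i \<in> A \<or> dual j \<in> A))) \<or>
    (\<exists>e\<in>sidx m n. \<not> sidx_odd e \<and> (\<forall>i j. root_pair m n i j \<longrightarrow>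
      G i j = (i = e \<or> j = dual e \<or> (i \<noteq> dual e \<and> j \<noteq> e))))"
    by (rule cominuscule_preorder_cases) (use P ab nil \<open>n \<ge> 1\<close> in \<open>unfold G_def, blast+\<close>)
  moreover have P_eq: "P = root_set m n H" if "\<And>i j. root_pair m n i j \<Longrightarrow> G i j = H i j" for H
  proof -
    have "root_set m n H = root_set m n G" by (rule root_set_cong) (simp add: that)
    also have "\<dots> = P"
      using P(4) unfolding root_set_def G_def roots_root_pair by blast
    finally show ?thesis by simp
  qed
  ultimately show thesis
  proof (elim disjE exE bexE conjE)
    fix A assume A: "lagrangian m n A" "\<forall>i j. root_pair m n i j \<longrightarrow> G i j = (i \<in> A \<or> dual j \<in> A)"
    have "P = lagr_parabolic m n A" unfolding lagr_parabolic_def by (rule P_eq) (use A(2) in blast)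
    with A(1) show thesis by (rule lagr_parabolic)
  next
    fix e assume e: "e \<in> sidx m n" "\<not> sidx_odd e" "\<forall>i j. root_pair m n i j \<longrightarrow>
      G i j = (i = e \<or> j = dual e \<or> (i \<noteq> dual e \<and> j \<noteq> e))"
    have "P = line_parabolic m n e" unfolding line_parabolic_def by (rule P_eq) (use e(3) in blast)
    with e(1,2) show thesis by (rule line_parabolic)
  qed
qed

section \<open>Quotients and the super exterior square\<close>

lemma fspace_ops:
  "vcarrier (fspace J q) = {f. \<forall>x. f x \<noteq> 0 \<longrightarrow> x \<in> J}"
  "vadd (fspace J q) = (+)" "vscale (fspace J q) = (\<odot>)"
  "hpart (fspace J q) a = {f. \<forall>x. f x \<noteq> 0 \<longrightarrow> x \<in> J \<and> q x = a}"
  by (auto simp: fspace_def)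

lemma gl_ops:
  "vcarrier (gl I p) = {X. \<forall>i j. X (i, j) \<noteq> 0 \<longrightarrow> i \<in> I \<and> j \<in> I}"
  "vadd (gl I p) = (+)" "vscale (gl I p) = (\<odot>)" "brk (gl I p) = superbracket I p"
  "hpart (gl I p) a = {X. \<forall>i j. X (i, j) \<noteq> 0 \<longrightarrow> i \<in> I \<and> j \<in> I \<and> (p i \<noteq> p j) = a}"
  by (auto simp: gl_def superspace.defs superalgebra.defs fspace_def pair_parity_def)

text \<open>First isomorphism theorem for modules over a Lie superalgebra. The cosets of the kernel are the
  fibres of \<open>T\<close>, so all operations on cosets can be computed on the values of \<open>T\<close>. Equivariance of
  \<open>T\<close> already forces the action to respect the kernel.\<close>

lemma lie_module_iso_quotient:
  fixes T :: "('x \<Rightarrow> complex) \<Rightarrow> 'y \<Rightarrow> complex" and J :: "'x set" and q :: "'x \<Rightarrow> bool"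
    and W :: "('y \<Rightarrow> complex, 'r) superspace_scheme"
  defines "V \<equiv> fspace J q"
  assumes lie: "lie_iso L L' \<phi>"
    and W: "vadd W = (+)" "vscale W = (\<odot>)"
    and T_add: "\<And>s t. T (s + t) = T s + T t"
    and T_scale: "\<And>c t. T (c \<odot> t) = c \<odot> T t"
    and T_carrier: "T ` vcarrier V = vcarrier W"
    and T_hpart: "\<And>a. T ` hpart V a = hpart W a"
    and R: "R = {t \<in> vcarrier V. T t = 0}"
    and act: "\<And>x t. x \<in> vcarrier L \<Longrightarrow> t \<in> vcarrier V \<Longrightarrow> act x t \<in> vcarrier V"
    and act_T: "\<And>x t. x \<in> vcarrier L \<Longrightarrow> t \<in> vcarrier V \<Longrightarrow> T (act x t) = act' (\<phi> x) (T t)"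
  shows "lie_module_iso L (quotient_superspace V R) (quotient_act V R act) L' W act'"
proof -
  have V_ops: "vadd V = (+)" "vscale V = (\<odot>)" by (simp_all add: V_def fspace_ops)
  have V_add: "s + t \<in> vcarrier V" if "s \<in> vcarrier V" "t \<in> vcarrier V" for s t
    using that unfolding V_def fspace_ops by (auto, metis add_0)
  have V_scale: "c \<odot> t \<in> vcarrier V" if "t \<in> vcarrier V" for c t
    using that by (auto simp: V_def fspace_ops fscale_def)
  have minus: "- t = (- 1) \<odot> t" for t :: "'z \<Rightarrow> complex"
    by (simp add: fscale_def fun_eq_iff)
  have V_diff: "s - t \<in> vcarrier V" if "s \<in> vcarrier V" "t \<in> vcarrier V" for s t
    using V_add[OF that(1) V_scale[OF that(2), of "- 1"]] by (simp flip: minus)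
  have T_diff: "T (s - t) = T s - T t" for s t
  proof -
    have "T (- t) = - T t" using T_scale[of "- 1" t] by (simp flip: minus)
    then show ?thesis using T_add[of s "- t"] by simp
  qed
  have h_sub: "hpart V a \<subseteq> vcarrier V" for a by (auto simp: V_def fspace_ops)
  have fiber: "coset V R t = {s \<in> vcarrier V. T s = T t}" if t: "t \<in> vcarrier V" for t
  proof (intro set_eqI iffI)
    fix s assume "s \<in> coset V R t"
    then show "s \<in> {s \<in> vcarrier V. T s = T t}"
      using t V_add by (auto simp: coset_def R T_add V_ops)
  next
    fix s assume "s \<in> {s \<in> vcarrier V. T s = T t}"
    then have "s - t \<in> R" "s = t + (s - t)" using t V_diff by (auto simp: R T_diff)
    then show "s \<in> coset V R t" unfolding coset_def V_ops by blast
  qed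
  define \<psi> where "\<psi> = (\<lambda>S. T (SOME s. s \<in> S))"
  have \<psi>: "\<psi> (coset V R t) = T t" if t: "t \<in> vcarrier V" for t
  proof -
    have "(SOME s. s \<in> coset V R t) \<in> coset V R t"
      by (rule someI[of _ t]) (simp add: fiber t)
    then show ?thesis by (simp add: \<psi>_def fiber t)
  qed
  have union: "(\<Union>s\<in>coset V R t. coset V R (g s)) = coset V R (g t)"
    if t: "t \<in> vcarrier V" and g: "\<And>s. s \<in> vcarrier V \<Longrightarrow> g s \<in> vcarrier V"
      and Tg: "\<And>s. s \<in> vcarrier V \<Longrightarrow> T s = T t \<Longrightarrow> T (g s) = T (g t)" for t g
  proof -
    have "coset V R (g s) = coset V R (g t)" if "s \<in> coset V R t" for s
    proof -
      have s: "s \<in> vcarrier V" "T s = T t" using that by (auto simp: fiber[OF t])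
      show ?thesis unfolding fiber[OF g[OF s(1)]] fiber[OF g[OF t]] Tg[OF s] ..
    qed
    moreover have "t \<in> coset V R t" by (simp add: fiber t)
    ultimately show ?thesis by blast
  qed
  have add: "vadd (quotient_superspace V R) (coset V R s) (coset V R t) = coset V R (s + t)"
    if "s \<in> vcarrier V" "t \<in> vcarrier V" for s t
  proof (intro set_eqI iffI)
    fix u assume "u \<in> vadd (quotient_superspace V R) (coset V R s) (coset V R t)"
    then show "u \<in> coset V R (s + t)"
      using that V_add by (auto simp: quotient_superspace_def fiber T_add V_ops)
  next
    fix u assume "u \<in> coset V R (s + t)"
    then have "u - s \<in> coset V R t" "s \<in> coset V R s" "u = s + (u - s)"
      using that V_diff V_add by (auto simp: fiber T_diff T_add)
    then show "u \<in> vadd (quotient_superspace V R) (coset V R s) (coset V R t)"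
      unfolding quotient_superspace_def superspace.simps V_ops by blast
  qed
  have scale: "vscale (quotient_superspace V R) c (coset V R t) = coset V R (c \<odot> t)"
    if "t \<in> vcarrier V" for c t
  proof -
    have "vscale (quotient_superspace V R) c (coset V R t) = (\<Union>s\<in>coset V R t. coset V R (c \<odot> s))"
      by (simp add: quotient_superspace_def V_ops)
    then show ?thesis using union[of t "\<lambda>s. c \<odot> s"] that V_scale by (simp add: T_scale)
  qed
  have car: "vcarrier (quotient_superspace V R) = coset V R ` vcarrier V"
    by (simp add: quotient_superspace_def)
  have "super_iso (quotient_superspace V R) W \<psi>"
    unfolding super_iso_def
  proof (intro conjI ballI allI)
    show "bij_betw \<psi> (vcarrier (quotient_superspace V R)) (vcarrier W)"
      unfolding bij_betw_def car
    proof
      show "inj_on \<psi> (coset V R ` vcarrier V)"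
      proof (rule inj_onI, elim imageE)
        fix S S' s s' assume *: "\<psi> S = \<psi> S'" "S = coset V R s" "s \<in> vcarrier V"
          "S' = coset V R s'" "s' \<in> vcarrier V"
        then have "T s = T s'" by (simp add: \<psi>)
        then show "S = S'" unfolding *(2,4) fiber[OF *(3)] fiber[OF *(5)] by simp
      qed
      have "\<psi> ` coset V R ` vcarrier V = T ` vcarrier V"
        unfolding image_image by (rule image_cong) (auto simp: \<psi>)
      then show "\<psi> ` coset V R ` vcarrier V = vcarrier W" using T_carrier by simp
    qed
    show "\<psi> (vadd (quotient_superspace V R) x y) = vadd W (\<psi> x) (\<psi> y)"
      if "x \<in> vcarrier (quotient_superspace V R)" "y \<in> vcarrier (quotient_superspace V R)" for x y
      using that V_add by (auto simp: car add \<psi> T_add W)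
    show "\<psi> (vscale (quotient_superspace V R) c x) = vscale W c (\<psi> x)"
      if "x \<in> vcarrier (quotient_superspace V R)" for c x
      using that V_scale by (auto simp: car scale \<psi> T_scale W)
    show "\<psi> ` hpart (quotient_superspace V R) a = hpart W a" for a
    proof -
      have "\<psi> ` hpart (quotient_superspace V R) a = \<psi> ` coset V R ` hpart V a"
        by (simp add: quotient_superspace_def)
      also have "\<dots> = T ` hpart V a"
        unfolding image_image using h_sub \<psi> by (intro image_cong) blast+
      finally show ?thesis using T_hpart by simp
    qed
  qed
  moreover have "\<psi> (quotient_act V R act x v) = act' (\<phi> x) (\<psi> v)"
    if x: "x \<in> vcarrier L" and v: "v \<in> vcarrier (quotient_superspace V R)" for x v
  proof -
    obtain t where t: "t \<in> vcarrier V" "v = coset V R t" using v by (auto simp: car)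
    have "quotient_act V R act x v = coset V R (act x t)"
      unfolding quotient_act_def t(2) using t(1) act[OF x] act_T[OF x] by (intro union) auto
    then show ?thesis using t act[OF x] act_T[OF x] by (simp add: \<psi>)
  qed
  ultimately show ?thesis using lie unfolding lie_module_iso_def by blast
qed

lemma ksign_facts:
  "ksign a b * ksign a b = 1" "ksign a b * (ksign a b * z) = z" "ksign b a = ksign a b"
  by (auto simp: ksign_def)

text \<open>The relations of the super exterior square are the super-symmetric tensors: generators are
  symmetric by inspection, and a symmetric tensor is half the sum, over its entries, of symmetrized
  elementary tensors.\<close>

lemma ext_relations_eq:
  assumes "finite I"
  shows "ext_relations I p =
    {t. (\<forall>i j. t (i, j) \<noteq> 0 \<longrightarrow> i \<in> I \<and> j \<in> I) \<and> (\<forall>i j. t (i, j) = ksign (p i) (p j) * t (j, i))}"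
    (is "_ = ?R")
proof
  let ?G = "{tensor v w + ksign a b \<odot> tensor w v | v w a b.
        v \<in> hpart (fspace I p) a \<and> w \<in> hpart (fspace I p) b}"
  have "cfun.subspace ?R"
    unfolding cfun.subspace_def
  proof (intro conjI ballI allI)
    show "x + y \<in> ?R" if "x \<in> ?R" "y \<in> ?R" for x y
    proof -
      have "i \<in> I \<and> j \<in> I" if "x (i, j) + y (i, j) \<noteq> 0" for i j
      proof -
        have "x (i, j) \<noteq> 0 \<or> y (i, j) \<noteq> 0" using that by fastforce
        then show ?thesis using \<open>x \<in> ?R\<close> \<open>y \<in> ?R\<close> by blast
      qed
      moreover have "x (i, j) + y (i, j) = ksign (p i) (p j) * (x (j, i) + y (j, i))" for i j
        using that unfolding distrib_left by (metis (mono_tags, lifting) mem_Collect_eq)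
      ultimately show ?thesis unfolding mem_Collect_eq plus_fun_apply by blast
    qed
    show "c \<odot> x \<in> ?R" if "x \<in> ?R" for c x
    proof -
      have "x (i, j) = ksign (p i) (p j) * x (j, i)" for i j using that by blast
      then have "c * x (i, j) = ksign (p i) (p j) * (c * x (j, i))" for i j
        by (metis mult.left_commute)
      moreover have "i \<in> I \<and> j \<in> I" if "c * x (i, j) \<noteq> 0" for i j
      proof -
        have "x (i, j) \<noteq> 0" using that by simp
        then show ?thesis using \<open>x \<in> ?R\<close> by blast
      qed
      ultimately show ?thesis unfolding mem_Collect_eq fscale_def by blast
    qed
  qed simp
  moreover have "?G \<subseteq> ?R"
  proof
    fix t assume "t \<in> ?G"
    then obtain v w a b where t: "t = tensor v w + ksign a b \<odot> tensor w v"
      and v: "v \<in> hpart (fspace I p) a" and w: "w \<in> hpart (fspace I p) b" by blast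
    have entry: "t (i, j) = v i * w j + ksign a b * (w i * v j)" for i j
      by (simp add: t tensor_def fscale_def)
    have v0: "v i = 0 \<or> (i \<in> I \<and> p i = a)" and w0: "w i = 0 \<or> (i \<in> I \<and> p i = b)" for i
      using v w by (auto simp: fspace_ops)
    have "i \<in> I \<and> j \<in> I" if "t (i, j) \<noteq> 0" for i j
      using that v0[of i] v0[of j] w0[of i] w0[of j] by (auto simp: entry)
    moreover have "t (i, j) = ksign (p i) (p j) * t (j, i)" for i j
      using v0[of i] v0[of j] w0[of i] w0[of j]
      by (auto simp: entry distrib_left ksign_facts mult.commute)
    ultimately show "t \<in> ?R" by blast
  qed
  ultimately show "ext_relations I p \<subseteq> ?R"
    unfolding ext_relations_def by (rule cfun.span_minimal[rotated])
  show "?R \<subseteq> ext_relations I p"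
  proof
    fix t assume t: "t \<in> ?R"
    \<comment> \<open>basis vectors of \<open>V\<close>; \<open>g\<close> symmetrizes their elementary tensors\<close>
    define e :: "'a \<Rightarrow> 'a \<Rightarrow> complex" where "e = (\<lambda>i x. if x = i then 1 else 0)"
    define g where "g = (\<lambda>i j. tensor (e i) (e j) + ksign (p i) (p j) \<odot> tensor (e j) (e i))"
    have sym: "ksign (p i) (p j) * t (j, i) = t (i, j)" for i j
      using t by (metis (mono_tags, lifting) mem_Collect_eq)
    have supp: "i \<in> I \<and> j \<in> I" if "t (i, j) \<noteq> 0" for i j using t that by blast
    have "t = (\<Sum>i\<in>I. \<Sum>j\<in>I. (t (i, j) / 2) \<odot> g i j)"
    proof
      fix x :: "'a \<times> 'a" obtain k l where x: "x = (k, l)" by (cases x)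
      have "(\<Sum>i\<in>I. \<Sum>j\<in>I. (t (i, j) / 2) \<odot> g i j) x =
        (\<Sum>i\<in>I. \<Sum>j\<in>I. (if l = j then if k = i then t (i, j) / 2 else 0 else 0) +
            (if k = j then if l = i then ksign (p i) (p j) * t (i, j) / 2 else 0 else 0))"
        unfolding sum_fun_apply x
        by (intro sum.cong refl) (auto simp: fscale_def g_def tensor_def e_def algebra_simps)
      also have "\<dots> = (\<Sum>i\<in>I. (if k = i then if l \<in> I then t (i, l) / 2 else 0 else 0) +
          (if l = i then if k \<in> I then ksign (p i) (p k) * t (i, k) / 2 else 0 else 0))"
        by (intro sum.cong refl) (auto simp: sum.distrib assms)
      also have "\<dots> = (if k \<in> I \<and> l \<in> I then t (k, l) / 2 + ksign (p l) (p k) * t (l, k) / 2 else 0)"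
        by (auto simp: sum.distrib assms)
      also have "\<dots> = t (k, l)"
        using supp[of k l] sym[of k l] by (auto simp: ksign_facts(3)[of "p k" "p l"])
      finally show "t x = (\<Sum>i\<in>I. \<Sum>j\<in>I. (t (i, j) / 2) \<odot> g i j) x" by (simp add: x)
    qed
    moreover have "g i j \<in> cfun.span ?G" if "i \<in> I" "j \<in> I" for i j
    proof -
      have "e i \<in> hpart (fspace I p) (p i)" "e j \<in> hpart (fspace I p) (p j)"
        using that by (auto simp: fspace_ops e_def)
      then show ?thesis unfolding g_def by (intro cfun.span_base) blast
    qed
    ultimately show "t \<in> ext_relations I p"
      unfolding ext_relations_def by (metis (no_types, lifting) cfun.span_scale cfun.span_sum)
  qed
qed

lemma tensor_act_entry:
  "tensor_act I p X t (i, j) =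
     (\<Sum>k\<in>I. X (i, k) * t (k, j) + ksign (p j \<noteq> p k) (p i) * X (j, k) * t (i, k))"
proof -
  have "tensor_act I p X t (i, j) = (\<Sum>k\<in>I. \<Sum>a\<in>UNIV. hproj (pair_parity p) a X (i, k) * t (k, j)
     + ksign a (p i) * (hproj (pair_parity p) a X (j, k) * t (i, k)))"
    unfolding tensor_act_def by (simp add: UNIV_bool sum.distrib sum_distrib_left)
  also have "\<dots> = (\<Sum>k\<in>I. X (i, k) * t (k, j) + ksign (p j \<noteq> p k) (p i) * X (j, k) * t (i, k))"
    by (rule sum.cong) (auto simp: UNIV_bool hproj_def pair_parity_def ksign_def)
  finally show ?thesis .
qed

section \<open>The Levi subalgebra and nilradical of Lagrangian type\<close>

fun base :: "sidx \<Rightarrow> idx" where "base (Pos a) = a" | "base (Neg a) = a"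

lemma base_dual [simp]: "base (dual i) = base i" by (cases i) auto

lemma idx_odd_base [simp]: "idx_odd (base i) = sidx_odd i" by (cases i) auto

text \<open>The basis \<open>Eps i\<close>, \<open>Del k\<close> of \<open>V\<^bsup>m|n\<^esup>\<close>, placed on the labels in \<open>A\<close>.\<close>

definition half :: "sidx set \<Rightarrow> idx \<Rightarrow> sidx" where
  "half A a = (if Pos a \<in> A then Pos a else Neg a)"

lemma base_half [simp]: "base (half A a) = a" by (simp add: half_def)

lemma odd_half [simp]: "sidx_odd (half A a) = idx_odd a" by (simp add: half_def)

lemma osgn_dual_right:
  "osgn i (dual j) = - ksign (sidx_odd i) (sidx_odd j) * bform i (dual i) * bform j (dual j)"
  by (auto simp: osgn_def ksign_def bform_dual)

text \<open>A matrix acts on the Lagrangian subspace of \<open>A\<close>, and symmetrization supplies the dual action on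
  the complementary half.\<close>

definition levi_embed :: "sidx set \<Rightarrow> idx cmat \<Rightarrow> sidx cmat" where
  "levi_embed A B = osym (\<lambda>(i, j). if i \<in> A \<and> j \<in> A then B (base i, base j) else 0)"

text \<open>The tensor \<open>v \<otimes> w\<close> goes to the operator \<open>u \<mapsto> v B(w, u)\<close>, whence the factor \<open>bform (dual j) j\<close>, and
  symmetrization into \<open>\<oo>\<ss>\<pp>\<close> amounts to super-antisymmetrization of the tensor.\<close>

definition nil_embed :: "sidx set \<Rightarrow> (idx \<times> idx \<Rightarrow> complex) \<Rightarrow> sidx cmat" where
  "nil_embed A t = osym (\<lambda>(i, j). if i \<in> A \<and> dual j \<in> A then bform (dual j) j * t (base i, base j) else 0)"

context
  fixes m n A
  assumes lag: "lagrangian m n A"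
begin

lemma lagrangian_facts:
  "i \<in> A \<Longrightarrow> i \<in> sidx m n" "i \<in> A \<Longrightarrow> dual i \<notin> A" "i \<in> sidx m n \<Longrightarrow> i \<notin> A \<Longrightarrow> dual i \<in> A"
  "dual i \<in> A \<Longrightarrow> i \<in> sidx m n"
  using lag dual_in[of i m n] unfolding lagrangian_def by blast+

lemma half_in [simp]: "half A a \<in> A \<longleftrightarrow> a \<in> idx m n"
  using lagrangian_facts(1)[of "Pos a"] lagrangian_facts(1)[of "Neg a"] lagrangian_facts(3)[of "Pos a"] by (auto simp: half_def)

lemma dual_half_notin [simp]: "dual (half A a) \<notin> A"
  using lagrangian_facts(2)[of "Pos a"] by (auto simp: half_def)

lemma half_base: "i \<in> A \<Longrightarrow> half A (base i) = i"
  using lagrangian_facts(2)[of i] by (cases i) (auto simp: half_def)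

lemma lagrangian_index_cases:
  assumes "i \<in> sidx m n"
  obtains a where "a \<in> idx m n" "i \<in> A" "i = half A a" | a where "a \<in> idx m n" "i \<notin> A" "i = dual (half A a)"
proof (cases "i \<in> A")
  case True
  then show thesis using that(1)[of "base i"] half_base[OF True] assms half_in by metis
next
  case False
  then have "dual i \<in> A" using lagrangian_facts(3) assms by blast
  then have "half A (base i) = dual i" using half_base[of "dual i"] by simp
  then show thesis using that(2)[of "base i"] half_in[of "base i"] \<open>dual i \<in> A\<close> False
    by (metis dual_dual)
qed

lemma sum_half:
  "(\<Sum>k\<in>sidx m n. g k) = (\<Sum>a\<in>idx m n. g (half A a)) + (\<Sum>a\<in>idx m n. g (dual (half A a)))"
  for g :: "sidx \<Rightarrow> complex"
proof -
  have "sidx m n = half A ` idx m n \<union> (\<lambda>a. dual (half A a)) ` idx m n"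
    using lagrangian_index_cases lagrangian_facts(1) half_in by (auto simp: image_iff) (metis dual_in)+
  moreover have "half A ` idx m n \<inter> (\<lambda>a. dual (half A a)) ` idx m n = {}"
  proof -
    have "half A ` idx m n \<subseteq> A" "(\<lambda>a. dual (half A a)) ` idx m n \<inter> A = {}" by auto
    then show ?thesis by blast
  qed
  moreover have "inj_on (half A) (idx m n)" "inj_on (\<lambda>a. dual (half A a)) (idx m n)"
    by (auto simp: inj_on_def) (metis base_half)+
  ultimately show ?thesis
    by (simp add: sum.union_disjoint finite_idx sum.reindex)
qed

lemma levi_lagr_carrier:
  "vcarrier (levi m n (lagr_parabolic m n A)) = {X \<in> osp_carrier m n. \<forall>i j. X (i, j) \<noteq> 0 \<longrightarrow> (i \<in> A \<longleftrightarrow> j \<in> A)}"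
proof -
  have "lagr_parabolic m n A \<subseteq> roots m n" by (simp add: lagr_parabolic_def root_set_subset)
  moreover have sym: "dual_sym (\<lambda>i j. (i \<in> A \<or> dual j \<in> A) \<and> (j \<in> A \<or> dual i \<in> A))"
    by (auto simp: dual_sym_def)
  moreover have "(i = j \<or> root_pair m n i j \<and> (i \<in> A \<or> dual j \<in> A) \<and> (j \<in> A \<or> dual i \<in> A)) \<longleftrightarrow>
      (i \<in> A \<longleftrightarrow> j \<in> A)" if "X \<in> osp_carrier m n" "X (i, j) \<noteq> 0" for X i j
    using osp_support[OF that] lagrangian_dual[OF lag] by (auto simp: root_pair_def)
  ultimately show ?thesis
    unfolding levi_carrier[OF \<open>lagr_parabolic m n A \<subseteq> roots m n\<close>]
    unfolding lagr_parabolic_def levi_roots_root_set[OF dual_sym_lagr] wt_diff_in_root_set[OF sym]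
    by blast
qed

lemma nil_lagr_carrier:
  "vcarrier (nilradical m n (lagr_parabolic m n A)) =
    {X \<in> osp_carrier m n. \<forall>i j. X (i, j) \<noteq> 0 \<longrightarrow> i \<in> A \<and> dual j \<in> A}"
proof -
  have "lagr_parabolic m n A \<subseteq> roots m n" by (simp add: lagr_parabolic_def root_set_subset)
  moreover have "(root_pair m n i j \<and> (i \<in> A \<or> dual j \<in> A) \<and> \<not> (j \<in> A \<or> dual i \<in> A)) \<longleftrightarrow>
      i \<in> A \<and> dual j \<in> A" if "X \<in> osp_carrier m n" "X (i, j) \<noteq> 0" for X i j
    using osp_support[OF that] lagrangian_dual[OF lag] osp_even_dual_zero[OF that(1), of i] that(2)
    by (auto simp: root_pair_def)
  ultimately show ?thesis
    unfolding nilradical_carrier[OF \<open>lagr_parabolic m n A \<subseteq> roots m n\<close>] nil_roots_lagr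
      wt_diff_in_root_set[OF dual_sym_nil[OF dual_sym_lagr]]
    by blast
qed

text \<open>The block outside \<open>A\<close> is determined by the block inside \<open>A\<close> through \<open>osp_sym\<close>.\<close>

lemma levi_lagr_eqI:
  assumes X: "X \<in> vcarrier (levi m n (lagr_parabolic m n A))" and Y: "Y \<in> vcarrier (levi m n (lagr_parabolic m n A))"
    and eq: "\<And>a b. a \<in> idx m n \<Longrightarrow> b \<in> idx m n \<Longrightarrow> X (half A a, half A b) = Y (half A a, half A b)"
  shows "X = Y"
proof
  fix x :: "sidx \<times> sidx" obtain i j where x: "x = (i, j)" by (cases x)
  have osp: "X \<in> osp_carrier m n" "Y \<in> osp_carrier m n"
    and bl: "X (i, j) \<noteq> 0 \<or> Y (i, j) \<noteq> 0 \<Longrightarrow> i \<in> A \<longleftrightarrow> j \<in> A" for i j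
    using X Y by (auto simp: levi_lagr_carrier)
  have "X (i, j) = Y (i, j)"
  proof (cases "i \<in> sidx m n \<and> j \<in> sidx m n \<and> (i \<in> A \<longleftrightarrow> j \<in> A)")
    case False
    then have "X (i, j) = 0" "Y (i, j) = 0" using osp_support osp bl by blast+
    then show ?thesis by simp
  next
    case True
    have 1: "X (k, l) = Y (k, l)" if "k \<in> A" "l \<in> A" for k l
      using eq[of "base k" "base l"] half_in[of "base k"] half_in[of "base l"] that
      by (simp add: half_base)
    show ?thesis
    proof (cases "i \<in> A")
      case True then show ?thesis using 1 \<open>_ \<and> _\<close> by blast
    next
      case False
      then have "X (dual j, dual i) = Y (dual j, dual i)" using 1 lagrangian_facts(3) True by blast
      then show ?thesis using osp_sym[OF osp(1), of "dual i" "dual j"] osp_sym[OF osp(2), of "dual i" "dual j"]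
        by simp
    qed
  qed
  then show "X x = Y x" by (simp add: x)
qed

lemma nil_lagr_eqI:
  assumes X: "X \<in> vcarrier (nilradical m n (lagr_parabolic m n A))" and Y: "Y \<in> vcarrier (nilradical m n (lagr_parabolic m n A))"
    and eq: "\<And>a b. a \<in> idx m n \<Longrightarrow> b \<in> idx m n \<Longrightarrow> X (half A a, dual (half A b)) = Y (half A a, dual (half A b))"
  shows "X = Y"
proof
  fix x :: "sidx \<times> sidx" obtain i j where x: "x = (i, j)" by (cases x)
  have bl: "X (i, j) \<noteq> 0 \<or> Y (i, j) \<noteq> 0 \<Longrightarrow> i \<in> A \<and> dual j \<in> A" for i j
    using X Y by (auto simp: nil_lagr_carrier)
  have "X (i, j) = Y (i, j)"
  proof (cases "i \<in> A \<and> dual j \<in> A")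
    case False
    then have "X (i, j) = 0" "Y (i, j) = 0" using bl by blast+
    then show ?thesis by simp
  next
    case True
    then have "half A (base i) = i" "half A (base j) = dual j" "base i \<in> idx m n" "base j \<in> idx m n"
      using half_base[of i] half_base[of "dual j"] half_in[of "base i"] half_in[of "base j"] by auto
    then show ?thesis using eq[of "base i" "base j"] by simp
  qed
  then show "X x = Y x" by (simp add: x)
qed

lemma levi_embed_entry:
  "a \<in> idx m n \<Longrightarrow> b \<in> idx m n \<Longrightarrow> levi_embed A B (half A a, half A b) = B (a, b)"
  by (simp add: levi_embed_def osym_def)

lemma levi_embed_in: "levi_embed A B \<in> vcarrier (levi m n (lagr_parabolic m n A))"
proof -
  have "levi_embed A B \<in> osp_carrier m n"
    unfolding levi_embed_def by (rule osym_in_osp) (auto simp: lagrangian_facts split: if_splits)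
  then show ?thesis
    using lagrangian_facts(2) lagrangian_facts(4) lagrangian_dual[OF lag]
    by (auto simp: levi_lagr_carrier levi_embed_def osym_def split: if_splits)
qed

lemma levi_lagr_superbracket:
  assumes "X \<in> vcarrier (levi m n (lagr_parabolic m n A))" "Y \<in> vcarrier (levi m n (lagr_parabolic m n A))"
  shows "superbracket (sidx m n) sidx_odd X Y \<in> vcarrier (levi m n (lagr_parabolic m n A))"
  using assms osp_superbracket[of X m n Y] superbracket_nonzero[of "sidx m n" sidx_odd X Y]
  unfolding levi_lagr_carrier by blast

lemma nil_lagr_superbracket:
  assumes "X \<in> vcarrier (levi m n (lagr_parabolic m n A))" "Y \<in> vcarrier (nilradical m n (lagr_parabolic m n A))"
  shows "superbracket (sidx m n) sidx_odd X Y \<in> vcarrier (nilradical m n (lagr_parabolic m n A))"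
proof -
  have "i \<in> A \<and> dual j \<in> A" if nz: "superbracket (sidx m n) sidx_odd X Y (i, j) \<noteq> 0" for i j
  proof -
    obtain k where "(X (i, k) \<noteq> 0 \<and> Y (k, j) \<noteq> 0) \<or> (Y (i, k) \<noteq> 0 \<and> X (k, j) \<noteq> 0)"
      using superbracket_nonzero[OF nz] by blast
    then show ?thesis
      using assms osp_support[of X m n k j] lagrangian_facts unfolding levi_lagr_carrier nil_lagr_carrier
      by blast
  qed
  then show ?thesis
    using assms osp_superbracket[of X m n Y] unfolding levi_lagr_carrier nil_lagr_carrier by blast
qed

text \<open>The inverse restricts a matrix to the block of \<open>A\<close>. Since brackets of Levi elements are again Levi
  elements, the homomorphism property need only be checked on that block, where the bracket is that
  of \<open>\<gg>\<ll>(m|n)\<close>.\<close>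

lemma lie_iso_levi_lagr: "lie_iso (gl_mn m n) (levi m n (lagr_parabolic m n A)) (levi_embed A)"
proof -
  let ?Lv = "levi m n (lagr_parabolic m n A)"
  define \<rho> :: "sidx cmat \<Rightarrow> idx cmat" where
    "\<rho> = (\<lambda>X (a, b). if a \<in> idx m n \<and> b \<in> idx m n then X (half A a, half A b) else 0)"
  have \<rho>_embed: "\<rho> (levi_embed A B) = B" if "B \<in> vcarrier (gl_mn m n)" for B
    using that by (auto simp: gl_mn_def gl_ops \<rho>_def levi_embed_entry fun_eq_iff)
  have embed_\<rho>: "levi_embed A (\<rho> X) = X" if "X \<in> vcarrier ?Lv" for X
    by (rule levi_lagr_eqI[OF levi_embed_in that]) (simp add: levi_embed_entry \<rho>_def)
  have add: "levi_embed A (B + C) = levi_embed A B + levi_embed A C" for B C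
    by (auto simp: levi_embed_def osym_def fun_eq_iff distrib_left)
  have scale: "levi_embed A (c \<odot> B) = c \<odot> levi_embed A B" for c B
    by (auto simp: levi_embed_def osym_def fun_eq_iff fscale_def distrib_left)
  have bracket: "levi_embed A (superbracket (idx m n) idx_odd B C) =
      superbracket (sidx m n) sidx_odd (levi_embed A B) (levi_embed A C)" for B C
  proof (rule levi_lagr_eqI[OF levi_embed_in levi_lagr_superbracket[OF levi_embed_in levi_embed_in]])
    fix a b assume ab: "a \<in> idx m n" "b \<in> idx m n"
    have z: "levi_embed A D (half A x, dual (half A y)) = 0" if "x \<in> idx m n" for D x y
      using that levi_embed_in[of D] half_in[of x] dual_half_notin[of y]
      unfolding levi_lagr_carrier by blast
    show "levi_embed A (superbracket (idx m n) idx_odd B C) (half A a, half A b) =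
      superbracket (sidx m n) sidx_odd (levi_embed A B) (levi_embed A C) (half A a, half A b)"
      using ab by (simp add: superbracket_entry sum_half levi_embed_entry z)
  qed
  have hp: "levi_embed A ` hpart (gl_mn m n) a = hpart ?Lv a" for a
  proof (intro set_eqI iffI)
    fix X assume "X \<in> levi_embed A ` hpart (gl_mn m n) a"
    then obtain B where B: "X = levi_embed A B" "B \<in> hpart (gl_mn m n) a" by blast
    then have "(sidx_odd i \<noteq> sidx_odd j) = a" if "X (i, j) \<noteq> 0" for i j
    proof -
      from that B have "B (base i, base j) \<noteq> 0 \<or> B (base j, base i) \<noteq> 0"
        by (auto simp: levi_embed_def osym_def split: if_splits)
      moreover have "(idx_odd k \<noteq> idx_odd l) = a" if "B (k, l) \<noteq> 0" for k l
        using B(2) that unfolding gl_mn_def gl_ops by blast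
      ultimately show ?thesis by (metis idx_odd_base)
    qed
    then show "X \<in> hpart ?Lv a" using B levi_embed_in by (auto simp: levi_ops)
  next
    fix X assume X: "X \<in> hpart ?Lv a"
    then have "X = levi_embed A (\<rho> X)" using embed_\<rho> by (auto simp: levi_ops)
    moreover have "\<rho> X \<in> hpart (gl_mn m n) a"
    proof -
      have "(idx_odd k \<noteq> idx_odd l) = a" if "X (half A k, half A l) \<noteq> 0" for k l
      proof -
        have "(sidx_odd (half A k) \<noteq> sidx_odd (half A l)) = a"
          using X that unfolding levi_ops by blast
        then show ?thesis by simp
      qed
      then show ?thesis by (auto simp: gl_mn_def gl_ops \<rho>_def)
    qed
    ultimately show "X \<in> levi_embed A ` hpart (gl_mn m n) a" by blast
  qed
  have \<rho>_in: "\<rho> X \<in> vcarrier (gl_mn m n)" for X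
    by (auto simp: gl_mn_def gl_ops \<rho>_def split: if_splits)
  have "bij_betw (levi_embed A) (vcarrier (gl_mn m n)) (vcarrier ?Lv)"
    by (rule bij_betw_byWitness[of _ \<rho>])
      (use \<rho>_embed embed_\<rho> levi_embed_in \<rho>_in in auto)
  then show ?thesis
    using add scale bracket hp unfolding lie_iso_def super_iso_def
    by (simp add: levi_ops gl_mn_def gl_ops)
qed

lemma nil_embed_entry:
  assumes "a \<in> idx m n" "b \<in> idx m n"
  shows "nil_embed A t (half A a, dual (half A b)) =
    bform (half A b) (dual (half A b)) * (t (a, b) - ksign (idx_odd a) (idx_odd b) * t (b, a))"
proof -
  have "nil_embed A t (half A a, dual (half A b)) = bform (half A b) (dual (half A b)) * t (a, b) +
     osgn (half A a) (dual (half A b)) * (bform (half A a) (dual (half A a)) * t (b, a))"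
    using assms by (simp add: nil_embed_def osym_def)
  also have "\<dots> = bform (half A b) (dual (half A b)) * (t (a, b) - ksign (idx_odd a) (idx_odd b) * t (b, a))"
    unfolding osgn_dual_right by (simp add: algebra_simps)
  finally show ?thesis .
qed

lemma nil_embed_in: "nil_embed A t \<in> vcarrier (nilradical m n (lagr_parabolic m n A))"
proof -
  have "nil_embed A t \<in> osp_carrier m n"
    unfolding nil_embed_def by (rule osym_in_osp) (auto simp: lagrangian_facts split: if_splits)
  then show ?thesis
    by (auto simp: nil_lagr_carrier nil_embed_def osym_def split: if_splits)
qed

text \<open>Only the entries in rows from \<open>A\<close> and columns from its dual matter. There both sides are sums over
  the same index set and agree term by term after comparing Koszul signs.\<close>

lemma nil_embed_equivariant:
  "nil_embed A (tensor_act (idx m n) idx_odd B t) =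
   superbracket (sidx m n) sidx_odd (levi_embed A B) (nil_embed A t)"
proof (rule nil_lagr_eqI[OF nil_embed_in nil_lagr_superbracket[OF levi_embed_in nil_embed_in]])
  fix a b assume ab: "a \<in> idx m n" "b \<in> idx m n"
  let ?\<beta> = "\<lambda>a. bform (half A a) (dual (half A a))"
  let ?k = "\<lambda>a b. ksign (idx_odd a) (idx_odd b)"
  have z1: "levi_embed A B (half A a, dual (half A c)) = 0" for c
    using ab levi_embed_in[of B] half_in[of a] dual_half_notin[of c]
    unfolding levi_lagr_carrier by blast
  have z2: "nil_embed A t (half A a, half A c) = 0" for c
    using nil_embed_in[of t] dual_half_notin[of c] unfolding nil_lagr_carrier by blast
  have z3: "levi_embed A B (dual (half A c), dual (half A b)) = osgn (half A b) (half A c) * B (b, c)"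
    if "c \<in> idx m n" for c
    using osp_sym[of "levi_embed A B" m n "half A c" "half A b"] levi_embed_in[of B] that ab
    by (simp add: levi_lagr_carrier levi_embed_entry)
  show "nil_embed A (tensor_act (idx m n) idx_odd B t) (half A a, dual (half A b)) =
    superbracket (sidx m n) sidx_odd (levi_embed A B) (nil_embed A t) (half A a, dual (half A b))"
  proof -
    let ?f = "\<lambda>c. B (a, c) * t (c, b) + ksign (idx_odd b \<noteq> idx_odd c) (idx_odd a) * B (b, c) * t (a, c)
        - ?k a b * (B (b, c) * t (c, a) + ksign (idx_odd a \<noteq> idx_odd c) (idx_odd b) * B (a, c) * t (b, c))"
    have "nil_embed A (tensor_act (idx m n) idx_odd B t) (half A a, dual (half A b)) =
        (\<Sum>c\<in>idx m n. ?\<beta> b * ?f c)"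
      using ab by (simp add: nil_embed_entry tensor_act_entry sum_distrib_left flip: sum_subtractf)
    also have "\<dots> = (\<Sum>c\<in>idx m n. B (a, c) * (?\<beta> b * (t (c, b) - ?k c b * t (b, c)))
       - ksign (idx_odd a \<noteq> idx_odd c) (idx_odd c \<noteq> idx_odd b) *
         (?\<beta> c * (t (a, c) - ?k a c * t (c, a)) * (osgn (half A b) (half A c) * B (b, c))))"
    proof (rule sum.cong[OF refl])
      fix c
      let ?K = "ksign (idx_odd a \<noteq> idx_odd c) (idx_odd c \<noteq> idx_odd b)"
      let ?D = "t (a, c) - ?k a c * t (c, a)"
      have signs: "?\<beta> c * osgn (half A b) (half A c) = - ksign (idx_odd b \<noteq> idx_odd c) (idx_odd c) * ?\<beta> b"
        by (simp add: osgn_def mult.left_commute)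
      have "?K * (?\<beta> c * ?D * (osgn (half A b) (half A c) * B (b, c))) =
         ?K * ((?\<beta> c * osgn (half A b) (half A c)) * ?D * B (b, c))" by (simp only: mult_ac)
      also have "\<dots> = ?K * ((- ksign (idx_odd b \<noteq> idx_odd c) (idx_odd c) * ?\<beta> b) * ?D * B (b, c))"
        unfolding signs ..
      finally have "?K * (?\<beta> c * ?D * (osgn (half A b) (half A c) * B (b, c))) =
         ?K * ((- ksign (idx_odd b \<noteq> idx_odd c) (idx_odd c) * ?\<beta> b) * ?D * B (b, c))" .
      then show "?\<beta> b * ?f c = B (a, c) * (?\<beta> b * (t (c, b) - ?k c b * t (b, c)))
       - ksign (idx_odd a \<noteq> idx_odd c) (idx_odd c \<noteq> idx_odd b) *
         (?\<beta> c * (t (a, c) - ?k a c * t (c, a)) * (osgn (half A b) (half A c) * B (b, c)))"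
        by (cases "idx_odd a"; cases "idx_odd b"; cases "idx_odd c")
          (simp_all add: ksign_def algebra_simps)
    qed
    also have "\<dots> = superbracket (sidx m n) sidx_odd (levi_embed A B) (nil_embed A t) (half A a, dual (half A b))"
      using ab by (simp add: superbracket_entry sum_half z1 z2 z3 levi_embed_entry nil_embed_entry
          sum_subtractf sum_negf)
    finally show ?thesis .
  qed
qed

text \<open>A preimage of \<open>X\<close> under \<open>nil_embed\<close> is half its off-diagonal block, up to the signs of the form:
  antisymmetrizing an antisymmetric tensor doubles it.\<close>

theorem lie_module_iso_lagr:
  "lie_module_iso
     (gl_mn m n) (ext_square (idx m n) idx_odd) (ext_act (idx m n) idx_odd)
     (levi m n (lagr_parabolic m n A)) (nilradical m n (lagr_parabolic m n A)) (brk (osp m n))"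
  unfolding ext_square_def ext_act_def tensor_square_def
proof (rule lie_module_iso_quotient[OF lie_iso_levi_lagr, where T = "nil_embed A"])
  let ?N = "nilradical m n (lagr_parabolic m n A)"
  let ?V = "fspace (idx m n \<times> idx m n) (pair_parity idx_odd)"
  show "vadd ?N = (+)" "vscale ?N = (\<odot>)" by (simp_all add: nilradical_ops)
  show "nil_embed A (s + t) = nil_embed A s + nil_embed A t" for s t
    by (auto simp: nil_embed_def osym_def fun_eq_iff distrib_left)
  show "nil_embed A (c \<odot> t) = c \<odot> nil_embed A t" for c t
    by (auto simp: nil_embed_def osym_def fun_eq_iff fscale_def distrib_left)
  define \<tau> :: "sidx cmat \<Rightarrow> idx \<times> idx \<Rightarrow> complex" where
    "\<tau> = (\<lambda>X (a, b). if a \<in> idx m n \<and> b \<in> idx m n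
       then bform (half A b) (dual (half A b)) * X (half A a, dual (half A b)) / 2 else 0)"
  have \<tau>: "nil_embed A (\<tau> X) = X" if X: "X \<in> vcarrier ?N" for X
  proof (rule nil_lagr_eqI[OF nil_embed_in X])
    fix a b assume ab: "a \<in> idx m n" "b \<in> idx m n"
    let ?\<beta> = "\<lambda>a. bform (half A a) (dual (half A a))"
    have "X (half A b, dual (half A a)) = osgn (half A a) (dual (half A b)) * X (half A a, dual (half A b))"
      using osp_sym[of X m n "dual (half A b)" "half A a"] X by (simp add: nil_lagr_carrier)
    then have flip: "ksign (idx_odd a) (idx_odd b) * (?\<beta> a * X (half A b, dual (half A a))) =
        - (?\<beta> b * X (half A a, dual (half A b)))"
      by (simp add: osgn_dual_right ksign_facts mult.left_commute mult.assoc)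
    have "nil_embed A (\<tau> X) (half A a, dual (half A b)) =
        ?\<beta> b * ((?\<beta> b * X (half A a, dual (half A b)) -
          ksign (idx_odd a) (idx_odd b) * (?\<beta> a * X (half A b, dual (half A a)))) / 2)"
      using ab by (simp add: nil_embed_entry \<tau>_def diff_divide_distrib)
    also have "\<dots> = X (half A a, dual (half A b))" unfolding flip by simp
    finally show "nil_embed A (\<tau> X) (half A a, dual (half A b)) = X (half A a, dual (half A b))" .
  qed
  have "X \<in> nil_embed A ` vcarrier ?V" if "X \<in> vcarrier ?N" for X
    using \<tau>[OF that] by (intro image_eqI[of _ _ "\<tau> X"]) (auto simp: fspace_ops \<tau>_def)
  then show "nil_embed A ` vcarrier ?V = vcarrier ?N"
    using nil_embed_in by blast
  show "nil_embed A ` hpart ?V a = hpart ?N a" for a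
  proof (intro set_eqI iffI)
    fix X assume "X \<in> nil_embed A ` hpart ?V a"
    then obtain t where t: "X = nil_embed A t" "t \<in> hpart ?V a" by blast
    have "(sidx_odd i \<noteq> sidx_odd j) = a" if "X (i, j) \<noteq> 0" for i j
    proof -
      from that t have "t (base i, base j) \<noteq> 0 \<or> t (base j, base i) \<noteq> 0"
        by (auto simp: nil_embed_def osym_def split: if_splits)
      moreover have "(idx_odd k \<noteq> idx_odd l) = a" if "t (k, l) \<noteq> 0" for k l
        using t(2) that unfolding fspace_ops pair_parity_def by blast
      ultimately show ?thesis by (metis idx_odd_base)
    qed
    then show "X \<in> hpart ?N a" using t nil_embed_in by (auto simp: nilradical_ops)
  next
    fix X assume X: "X \<in> hpart ?N a"
    then have "X = nil_embed A (\<tau> X)" using \<tau> by (auto simp: nilradical_ops)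
    moreover have "\<tau> X \<in> hpart ?V a"
    proof -
      have "(idx_odd k \<noteq> idx_odd l) = a" if "X (half A k, dual (half A l)) \<noteq> 0" for k l
      proof -
        have "(sidx_odd (half A k) \<noteq> sidx_odd (dual (half A l))) = a"
          using X that unfolding nilradical_ops by blast
        then show ?thesis by simp
      qed
      then show ?thesis by (auto simp: fspace_ops pair_parity_def \<tau>_def)
    qed
    ultimately show "X \<in> nil_embed A ` hpart ?V a" by blast
  qed
  show "ext_relations (idx m n) idx_odd = {t \<in> vcarrier ?V. nil_embed A t = 0}"
  proof -
    have "nil_embed A t = 0 \<longleftrightarrow> (\<forall>a b. t (a, b) = ksign (idx_odd a) (idx_odd b) * t (b, a))"
      if supp: "\<And>a b. t (a, b) \<noteq> 0 \<Longrightarrow> a \<in> idx m n \<and> b \<in> idx m n" for t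
    proof -
      have "0 \<in> vcarrier ?N" by (simp add: nil_lagr_carrier osp_zero)
      then have "nil_embed A t = 0 \<longleftrightarrow> (\<forall>a\<in>idx m n. \<forall>b\<in>idx m n. nil_embed A t (half A a, dual (half A b)) = 0)"
        using nil_lagr_eqI[OF nil_embed_in, of 0 t] by auto
      also have "\<dots> \<longleftrightarrow> (\<forall>a\<in>idx m n. \<forall>b\<in>idx m n. t (a, b) = ksign (idx_odd a) (idx_odd b) * t (b, a))"
        by (simp add: nil_embed_entry bform_nz)
      also have "\<dots> \<longleftrightarrow> (\<forall>a b. t (a, b) = ksign (idx_odd a) (idx_odd b) * t (b, a))"
        using supp by (metis mult_zero_right)
      finally show ?thesis .
    qed
    then show ?thesis unfolding ext_relations_eq[OF finite_idx] fspace_ops by auto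
  qed
  show "tensor_act (idx m n) idx_odd B t \<in> vcarrier ?V"
    if "B \<in> vcarrier (gl_mn m n)" "t \<in> vcarrier ?V" for B t
  proof -
    have "a \<in> idx m n \<and> b \<in> idx m n" if nz: "tensor_act (idx m n) idx_odd B t (a, b) \<noteq> 0" for a b
    proof (rule ccontr)
      assume out: "\<not> ?thesis"
      have B: "B (x, y) = 0" if "x \<notin> idx m n" for x y
        using \<open>B \<in> _\<close> that by (auto simp: gl_mn_def gl_ops)
      have t: "t (x, y) = 0" if "x \<notin> idx m n \<or> y \<notin> idx m n" for x y
        using \<open>t \<in> _\<close> that by (auto simp: fspace_ops)
      have "tensor_act (idx m n) idx_odd B t (a, b) = 0"
        unfolding tensor_act_entry using out B[of a] B[of b] t[of _ b] t[of a]
        by (intro sum.neutral) auto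
      with nz show False by simp
    qed
    then show ?thesis by (auto simp: fspace_ops)
  qed
  show "nil_embed A (tensor_act (idx m n) idx_odd B t) =
      brk (osp m n) (levi_embed A B) (nil_embed A t)" for B t
    by (simp add: osp_simps nil_embed_equivariant)
qed

end

section \<open>The Levi subalgebra and nilradical of line type\<close>

fun up :: "idx \<Rightarrow> idx" where "up (Eps i) = Eps (Suc i)" | "up (Del k) = Del k"

fun down :: "idx \<Rightarrow> idx" where "down (Eps i) = Eps (i - 1)" | "down (Del k) = Del k"

text \<open>The labels of \<open>V\<^bsup>2m-2|2n\<^esup>\<close> sit in those of \<open>V\<^bsup>2m|2n\<^esup>\<close> as the complement of \<open>\<plusminus>\<epsilon>\<^sub>1\<close>.\<close>

fun shift :: "sidx \<Rightarrow> sidx" where "shift (Pos a) = Pos (up a)" | "shift (Neg a) = Neg (up a)"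

fun unshift :: "sidx \<Rightarrow> sidx" where "unshift (Pos a) = Pos (down a)" | "unshift (Neg a) = Neg (down a)"

definition e1 :: sidx where "e1 = Pos (Eps 1)"

lemma odd_e1 [simp]: "\<not> sidx_odd e1" by (simp add: e1_def)

lemma idx_odd_up [simp]: "idx_odd (up a) = idx_odd a" "idx_odd (down a) = idx_odd a"
  by (cases a; simp)+

lemma down_up [simp]: "down (up a) = a" by (cases a) auto

lemma shift_simps [simp]:
  "sidx_odd (shift i) = sidx_odd i" "sidx_odd (unshift i) = sidx_odd i" "unshift (shift i) = i"
  "shift (dual i) = dual (shift i)" "unshift (dual i) = dual (unshift i)"
  by (cases i; simp)+

lemma osgn_shift [simp]: "osgn (shift i) (shift j) = osgn i j" "osgn (unshift i) (unshift j) = osgn i j"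
  by (cases i; cases j; simp add: osgn_def)+

context
  fixes m n :: nat
  assumes m: "m \<ge> 1"
begin

text \<open>Truncated subtraction is harmless: \<open>Eps 0\<close> and \<open>Eps 1\<close> both go to \<open>Eps 0\<close>, which is not a
  label, so matrices pulled back along \<open>unshift\<close> vanish in the rows and columns of \<open>\<plusminus>\<epsilon>\<^sub>1\<close>.\<close>

lemma unshift_in: "unshift i \<in> sidx (m - 1) n \<longleftrightarrow> i \<in> sidx m n \<and> i \<noteq> e1 \<and> i \<noteq> dual e1"
proof -
  have "down a \<in> idx (m - 1) n \<longleftrightarrow> a \<in> idx m n \<and> a \<noteq> Eps 1" for a
    using m by (cases a) auto
  then show ?thesis by (cases i) (auto simp: e1_def)
qed

lemma shift_in: "i \<in> sidx (m - 1) n \<Longrightarrow> shift i \<in> sidx m n \<and> shift i \<noteq> e1 \<and> shift i \<noteq> dual e1"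
  using unshift_in[of "shift i"] by simp

lemma shift_unshift: "i \<in> sidx m n \<Longrightarrow> shift (unshift i) = i"
proof -
  have "up (down a) = a" if "a \<in> idx m n" for a using that by (cases a) auto
  then show "i \<in> sidx m n \<Longrightarrow> shift (unshift i) = i" by (cases i) auto
qed

lemma e1_in: "e1 \<in> sidx m n" using m by (simp add: e1_def)

lemma sum_shift:
  "(\<Sum>k\<in>sidx m n. g k) = g e1 + g (dual e1) + (\<Sum>k\<in>sidx (m - 1) n. g (shift k))"
  for g :: "sidx \<Rightarrow> complex"
proof -
  have S: "sidx m n = insert e1 (insert (dual e1) (shift ` sidx (m - 1) n))"
  proof (intro set_eqI iffI)
    fix i assume i: "i \<in> sidx m n"
    show "i \<in> insert e1 (insert (dual e1) (shift ` sidx (m - 1) n))"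
    proof (cases "i = e1 \<or> i = dual e1")
      case False
      then have "i = shift (unshift i)" "unshift i \<in> sidx (m - 1) n"
        using i shift_unshift[of i] unshift_in[of i] by auto
      then show ?thesis by blast
    qed blast
  qed (use shift_in e1_in m in auto)
  have "inj_on shift (sidx (m - 1) n)"
    by (rule inj_on_inverseI[of _ unshift]) simp
  moreover have "e1 \<notin> shift ` sidx (m - 1) n" "dual e1 \<notin> shift ` sidx (m - 1) n"
    using shift_in by (metis imageE)+
  moreover have "e1 \<noteq> dual e1" by simp
  ultimately show ?thesis
    unfolding S by (simp add: finite_sidx sum.reindex add.assoc)
qed

lemma levi_line_carrier:
  "vcarrier (levi m n (line_parabolic m n e1)) = {X \<in> osp_carrier m n.
     \<forall>i j. X (i, j) \<noteq> 0 \<longrightarrow> i = j \<or> (i \<noteq> e1 \<and> i \<noteq> dual e1 \<and> j \<noteq> e1 \<and> j \<noteq> dual e1)}"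
proof -
  let ?e = e1
  let ?G = "\<lambda>i j. i = ?e \<or> j = dual ?e \<or> (i \<noteq> dual ?e \<and> j \<noteq> ?e)"
  have S: "line_parabolic m n ?e \<subseteq> roots m n" by (simp add: line_parabolic_def root_set_subset)
  have sym: "dual_sym (\<lambda>i j. ?G i j \<and> ?G j i)"
    using dual_sym_line[of ?e] by (simp add: dual_sym_def)
  have "i = j \<or> root_pair m n i j \<and> ?G i j \<and> ?G j i \<longleftrightarrow>
      i = j \<or> (i \<noteq> ?e \<and> i \<noteq> dual ?e \<and> j \<noteq> ?e \<and> j \<noteq> dual ?e)" 
    if X: "X \<in> osp_carrier m n" "X (i, j) \<noteq> 0" for X i j
  proof -
    have "j \<noteq> dual i" if "\<not> sidx_odd i" using osp_even_dual_zero[OF X(1) that] X(2) by auto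
    moreover have "\<not> sidx_odd ?e" by simp
    moreover have "?e \<noteq> dual ?e" by simp
    ultimately show ?thesis using osp_support[OF X] unfolding root_pair_def
      by (metis dual_dual dual_odd)
  qed
  then show ?thesis
    unfolding levi_carrier[OF S] unfolding line_parabolic_def levi_roots_root_set[OF dual_sym_line] wt_diff_in_root_set[OF sym]
    by blast
qed

lemma nil_line_carrier:
  "vcarrier (nilradical m n (line_parabolic m n e1)) = {X \<in> osp_carrier m n.
     \<forall>i j. X (i, j) \<noteq> 0 \<longrightarrow> (i = e1 \<and> j \<noteq> e1 \<and> j \<noteq> dual e1) \<or> (j = dual e1 \<and> i \<noteq> e1 \<and> i \<noteq> dual e1)}"
proof -
  let ?e = e1
  let ?G = "\<lambda>i j. i = ?e \<or> j = dual ?e \<or> (i \<noteq> dual ?e \<and> j \<noteq> ?e)"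
  have S: "line_parabolic m n ?e \<subseteq> roots m n" by (simp add: line_parabolic_def root_set_subset)
  have "root_pair m n i j \<and> ?G i j \<and> \<not> ?G j i \<longleftrightarrow>
      (i = ?e \<and> j \<noteq> ?e \<and> j \<noteq> dual ?e) \<or> (j = dual ?e \<and> i \<noteq> ?e \<and> i \<noteq> dual ?e)"
    if X: "X \<in> osp_carrier m n" "X (i, j) \<noteq> 0" for X i j
  proof -
    have "j \<noteq> dual i" if "\<not> sidx_odd i" using osp_even_dual_zero[OF X(1) that] X(2) by auto
    moreover have "\<not> sidx_odd ?e" by simp
    moreover have "?e \<noteq> dual ?e" by simp
    ultimately show ?thesis using osp_support[OF X] unfolding root_pair_def
      by (metis dual_dual dual_odd)
  qed
  then show ?thesis
    unfolding nilradical_carrier[OF S] nil_roots_line wt_diff_in_root_set[OF dual_sym_nil[OF dual_sym_line]]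
    by blast
qed

text \<open>A Levi element is block diagonal for the decomposition into \<open>e1\<close>, \<open>dual e1\<close> and the rest, and
  its entry at \<open>dual e1\<close> is minus the one at \<open>e1\<close>.\<close>

lemma levi_line_eqI:
  assumes X: "X \<in> vcarrier (levi m n (line_parabolic m n e1))" and Y: "Y \<in> vcarrier (levi m n (line_parabolic m n e1))"
    and eq: "\<And>i j. i \<in> sidx (m - 1) n \<Longrightarrow> j \<in> sidx (m - 1) n \<Longrightarrow> X (shift i, shift j) = Y (shift i, shift j)"
    and eq1: "X (e1, e1) = Y (e1, e1)"
  shows "X = Y"
proof
  fix x :: "sidx \<times> sidx" obtain i j where x: "x = (i, j)" by (cases x)
  have osp: "X \<in> osp_carrier m n" "Y \<in> osp_carrier m n"
    and bl: "\<And>i j. X (i, j) \<noteq> 0 \<or> Y (i, j) \<noteq> 0 \<Longrightarrow>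
      i = j \<or> (i \<noteq> e1 \<and> i \<noteq> dual e1 \<and> j \<noteq> e1 \<and> j \<noteq> dual e1)"
    using X Y by (auto simp: levi_line_carrier)
  have eq2: "X (dual e1, dual e1) = Y (dual e1, dual e1)"
    using osp_sym[OF osp(1), of e1 e1] osp_sym[OF osp(2), of e1 e1] eq1 by simp
  have "X (i, j) = Y (i, j)"
  proof (cases "X (i, j) = 0 \<and> Y (i, j) = 0")
    case False
    then have ij: "i \<in> sidx m n" "j \<in> sidx m n" using osp osp_support by blast+
    consider "i = j" "i = e1" | "i = j" "i = dual e1" | "i \<noteq> e1" "i \<noteq> dual e1" "j \<noteq> e1" "j \<noteq> dual e1"
      using bl[of i j] False by blast
    then show ?thesis
    proof cases
      case 3
      then show ?thesis
        using eq[of "unshift i" "unshift j"] ij shift_unshift unshift_in by metis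
    qed (use eq1 eq2 in auto)
  qed simp
  then show "X x = Y x" by (simp add: x)
qed

text \<open>The row of \<open>e1\<close> is determined by the column of \<open>dual e1\<close> through \<open>osp_sym\<close>.\<close>

lemma nil_line_eqI:
  assumes X: "X \<in> vcarrier (nilradical m n (line_parabolic m n e1))" and Y: "Y \<in> vcarrier (nilradical m n (line_parabolic m n e1))"
    and eq: "\<And>i. i \<in> sidx (m - 1) n \<Longrightarrow> X (shift i, dual e1) = Y (shift i, dual e1)"
  shows "X = Y"
proof
  fix x :: "sidx \<times> sidx" obtain i j where x: "x = (i, j)" by (cases x)
  have osp: "X \<in> osp_carrier m n" "Y \<in> osp_carrier m n"
    and bl: "\<And>i j. X (i, j) \<noteq> 0 \<or> Y (i, j) \<noteq> 0 \<Longrightarrow>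
      (i = e1 \<and> j \<noteq> e1 \<and> j \<noteq> dual e1) \<or> (j = dual e1 \<and> i \<noteq> e1 \<and> i \<noteq> dual e1)"
    using X Y unfolding nil_line_carrier by blast+
  have col: "X (k, dual e1) = Y (k, dual e1)" if "k \<in> sidx m n" "k \<noteq> e1" "k \<noteq> dual e1" for k
    using eq[of "unshift k"] shift_unshift unshift_in that by metis
  have "X (i, j) = Y (i, j)"
  proof (cases "X (i, j) = 0 \<and> Y (i, j) = 0")
    case False
    then have ij: "i \<in> sidx m n" "j \<in> sidx m n" using osp osp_support by blast+
    consider "i = e1" "j \<noteq> e1" "j \<noteq> dual e1" | "j = dual e1" "i \<noteq> e1" "i \<noteq> dual e1"
      using bl[of i j] False by blast
    then show ?thesis
    proof cases
      case 1
      then have "X (dual j, dual e1) = Y (dual j, dual e1)"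
        using col[of "dual j"] ij by (metis dual_dual dual_in)
      then show ?thesis
        using osp_sym[OF osp(1), of "dual e1" "dual j"] osp_sym[OF osp(2), of "dual e1" "dual j"] 1
        by simp
    next
      case 2 then show ?thesis using col ij by blast
    qed
  qed simp
  then show "X x = Y x" by (simp add: x)
qed

text \<open>The summand \<open>\<complex>\<close> is spanned by the Cartan element dual to \<open>\<epsilon>\<^sub>1\<close>, which acts as the identity on
  the nilradical.\<close>

definition line_embed :: "sidx cmat \<times> complex \<Rightarrow> sidx cmat" where
  "line_embed = (\<lambda>(X, c) (i, j). X (unshift i, unshift j) + c * cartan_basis (Eps 1) (i, j))"

lemma cartan_basis_e1:
  "cartan_basis (Eps 1) (i, j) =
    (if i = e1 \<and> j = e1 then 1 else if i = dual e1 \<and> j = dual e1 then - 1 else 0)"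
  by (auto simp: cartan_basis_def e1_def)

lemma line_embed_entry:
  assumes "X \<in> osp_carrier (m - 1) n"
  shows "i \<in> sidx (m - 1) n \<Longrightarrow> j \<in> sidx (m - 1) n \<Longrightarrow> line_embed (X, c) (shift i, shift j) = X (i, j)"
    and "i \<in> sidx (m - 1) n \<Longrightarrow> k = e1 \<or> k = dual e1 \<Longrightarrow> line_embed (X, c) (shift i, k) = 0"
    and "i \<in> sidx (m - 1) n \<Longrightarrow> k = e1 \<or> k = dual e1 \<Longrightarrow> line_embed (X, c) (k, shift i) = 0"
    and "line_embed (X, c) (e1, e1) = c" "line_embed (X, c) (dual e1, dual e1) = - c"
    and "line_embed (X, c) (e1, dual e1) = 0" "line_embed (X, c) (dual e1, e1) = 0"
proof -
  have off: "unshift k \<notin> sidx (m - 1) n" if "k = e1 \<or> k = dual e1" for k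
    using that unshift_in by blast
  have X0: "X (unshift k, x) = 0" "X (x, unshift k) = 0" if "k = e1 \<or> k = dual e1" for k x
    using off[OF that] osp_support[OF assms] by blast+
  have ne: "e1 \<noteq> dual e1" by simp
  show "line_embed (X, c) (shift i, shift j) = X (i, j)" if "i \<in> sidx (m - 1) n" "j \<in> sidx (m - 1) n"
    using shift_in[OF that(1)] shift_in[OF that(2)] unfolding line_embed_def cartan_basis_e1 by simp
  show "line_embed (X, c) (shift i, k) = 0" "line_embed (X, c) (k, shift i) = 0"
    if "i \<in> sidx (m - 1) n" "k = e1 \<or> k = dual e1"
    using shift_in[OF that(1)] X0[OF that(2)] unfolding line_embed_def cartan_basis_e1 by simp_all
  show "line_embed (X, c) (e1, e1) = c" "line_embed (X, c) (dual e1, dual e1) = - c"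
    "line_embed (X, c) (e1, dual e1) = 0" "line_embed (X, c) (dual e1, e1) = 0"
    using X0[of e1] X0[of "dual e1"] ne unfolding line_embed_def cartan_basis_e1 by simp_all
qed

lemma line_embed_in:
  assumes X: "X \<in> osp_carrier (m - 1) n"
  shows "line_embed (X, c) \<in> vcarrier (levi m n (line_parabolic m n e1))"
proof -
  define X' :: "sidx cmat" where "X' = (\<lambda>(i, j). X (unshift i, unshift j))"
  have supp: "i \<in> sidx m n \<and> i \<noteq> e1 \<and> i \<noteq> dual e1 \<and> j \<in> sidx m n \<and> j \<noteq> e1 \<and> j \<noteq> dual e1"
    if "X' (i, j) \<noteq> 0" for i j
  proof -
    have "X (unshift i, unshift j) \<noteq> 0" using that by (simp add: X'_def)
    from osp_support[OF X this] show ?thesis unfolding unshift_in by blast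
  qed
  have "X' (dual j, dual i) = osgn i j * X' (i, j)" for i j
    using osp_sym[OF X, of "unshift j" "unshift i"] by (simp add: X'_def)
  then have "X' \<in> osp_carrier m n" unfolding osp_iff using supp by blast
  moreover have "cartan_basis (Eps 1) \<in> osp_carrier m n"
    using cartan_basis_cartan[of "Eps 1" m n] m by (simp add: cartan_def osp_simps)
  moreover have eq: "line_embed (X, c) = X' + c \<odot> cartan_basis (Eps 1)"
    by (auto simp: line_embed_def X'_def fscale_def fun_eq_iff)
  ultimately have "line_embed (X, c) \<in> osp_carrier m n"
    by (simp add: osp_add osp_scale)
  moreover have "i = j \<or> (i \<noteq> e1 \<and> i \<noteq> dual e1 \<and> j \<noteq> e1 \<and> j \<noteq> dual e1)"
    if "line_embed (X, c) (i, j) \<noteq> 0" for i j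
  proof (cases "X' (i, j) = 0")
    case True
    then have "cartan_basis (Eps 1) (i, j) \<noteq> 0" using that by (simp add: eq fscale_def)
    then show ?thesis unfolding cartan_basis_e1 by (simp split: if_splits)
  qed (use supp in blast)
  ultimately show ?thesis unfolding levi_line_carrier by blast
qed

lemma levi_line_superbracket:
  assumes "X \<in> vcarrier (levi m n (line_parabolic m n e1))" "Y \<in> vcarrier (levi m n (line_parabolic m n e1))"
  shows "superbracket (sidx m n) sidx_odd X Y \<in> vcarrier (levi m n (line_parabolic m n e1))"
  using assms osp_superbracket[of X m n Y] superbracket_nonzero[of "sidx m n" sidx_odd X Y]
  unfolding levi_line_carrier by blast

lemma nil_line_superbracket:
  assumes "X \<in> vcarrier (levi m n (line_parabolic m n e1))" "Y \<in> vcarrier (nilradical m n (line_parabolic m n e1))"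
  shows "superbracket (sidx m n) sidx_odd X Y \<in> vcarrier (nilradical m n (line_parabolic m n e1))"
  using assms osp_superbracket[of X m n Y] superbracket_nonzero[of "sidx m n" sidx_odd X Y]
  unfolding levi_line_carrier nil_line_carrier by blast

lemma lie_sum_ops:
  "vcarrier (lie_sum (osp k n) lie_C) = osp_carrier k n \<times> UNIV"
  "vadd (lie_sum (osp k n) lie_C) (X, c) (Y, d) = (X + Y, c + d)"
  "vscale (lie_sum (osp k n) lie_C) b (X, c) = (b \<odot> X, b * c)"
  "brk (lie_sum (osp k n) lie_C) (X, c) (Y, d) = (superbracket (sidx k n) sidx_odd X Y, 0)"
  "hpart (lie_sum (osp k n) lie_C) a =
    {X \<in> osp_carrier k n. \<forall>i j. X (i, j) \<noteq> 0 \<longrightarrow> (sidx_odd i \<noteq> sidx_odd j) = a} \<times> (if a then {0} else UNIV)"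
  by (simp_all add: lie_sum_def lie_C_def osp_simps osp_ops)

lemma lie_iso_levi_line:
  "lie_iso (lie_sum (osp (m - 1) n) lie_C) (levi m n (line_parabolic m n e1)) line_embed"
proof -
  let ?Lv = "levi m n (line_parabolic m n e1)"
  let ?O = "osp_carrier (m - 1) n"
  let ?S = "sidx (m - 1) n"
  define \<rho> :: "sidx cmat \<Rightarrow> sidx cmat \<times> complex" where
    "\<rho> = (\<lambda>X. (\<lambda>(i, j). if i \<in> ?S \<and> j \<in> ?S then X (shift i, shift j) else 0, X (e1, e1)))"
  have \<rho>_in: "fst (\<rho> X) \<in> ?O" if "X \<in> vcarrier ?Lv" for X
  proof -
    have X: "X \<in> osp_carrier m n" using that by (simp add: levi_line_carrier)
    have "X (dual (shift j), dual (shift i)) = osgn i j * X (shift i, shift j)" for i j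
      using osp_sym[OF X, of "shift j" "shift i"] by simp
    then show ?thesis by (auto simp: \<rho>_def osp_iff split: if_splits)
  qed
  have \<rho>_embed: "\<rho> (line_embed (X, c)) = (X, c)" if X: "X \<in> ?O" for X c
  proof -
    have "X (i, j) = 0" if "\<not> (i \<in> ?S \<and> j \<in> ?S)" for i j using that osp_support[OF X] by blast
    then show ?thesis unfolding \<rho>_def using line_embed_entry[OF X] by (auto simp: fun_eq_iff)
  qed
  have embed_\<rho>: "line_embed (\<rho> X) = X" if X: "X \<in> vcarrier ?Lv" for X
  proof -
    obtain Y c where Y: "\<rho> X = (Y, c)" by (cases "\<rho> X")
    then have "Y \<in> ?O" using \<rho>_in[OF X] by simp
    note en = line_embed_entry[OF this] and inn = line_embed_in[OF this]
    show ?thesis unfolding Y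
      by (rule levi_line_eqI[OF inn X]) (use Y in \<open>auto simp: en \<rho>_def\<close>)
  qed
  have add: "line_embed (X + Y, c + d) = line_embed (X, c) + line_embed (Y, d)" for X Y c d
    by (auto simp: line_embed_def fun_eq_iff algebra_simps)
  have scale: "line_embed (b \<odot> X, b * c) = b \<odot> line_embed (X, c)" for b X c
    by (auto simp: line_embed_def fun_eq_iff fscale_def algebra_simps)
  have bracket: "line_embed (superbracket ?S sidx_odd X Y, 0) =
      superbracket (sidx m n) sidx_odd (line_embed (X, c)) (line_embed (Y, d))"
    if X: "X \<in> ?O" and Y: "Y \<in> ?O" for X Y c d
  proof -
    note en = line_embed_entry[OF X] line_embed_entry[OF Y] line_embed_entry[OF osp_superbracket[OF X Y]]
    show ?thesis
    proof (rule levi_line_eqI[OF line_embed_in[OF osp_superbracket[OF X Y]]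
          levi_line_superbracket[OF line_embed_in[OF X] line_embed_in[OF Y]]])
      fix i j assume ij: "i \<in> ?S" "j \<in> ?S"
      then show "line_embed (superbracket ?S sidx_odd X Y, 0) (shift i, shift j) =
        superbracket (sidx m n) sidx_odd (line_embed (X, c)) (line_embed (Y, d)) (shift i, shift j)"
        unfolding superbracket_entry sum_shift by (simp add: en superbracket_entry del: One_nat_def)
    next
      show "line_embed (superbracket ?S sidx_odd X Y, 0) (e1, e1) =
        superbracket (sidx m n) sidx_odd (line_embed (X, c)) (line_embed (Y, d)) (e1, e1)"
        unfolding superbracket_entry sum_shift by (simp add: en ksign_def del: One_nat_def)
    qed
  qed
  have hp: "line_embed ` hpart (lie_sum (osp (m - 1) n) lie_C) a = hpart ?Lv a" for a
  proof (intro set_eqI iffI)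
    fix X assume "X \<in> line_embed ` hpart (lie_sum (osp (m - 1) n) lie_C) a"
    then obtain Y c where X: "X = line_embed (Y, c)" and Y: "Y \<in> ?O" "c \<noteq> 0 \<Longrightarrow> \<not> a"
      and par: "\<And>i j. Y (i, j) \<noteq> 0 \<Longrightarrow> (sidx_odd i \<noteq> sidx_odd j) = a"
      by (auto simp: lie_sum_ops split: if_splits)
    have "(sidx_odd i \<noteq> sidx_odd j) = a" if "X (i, j) \<noteq> 0" for i j
    proof (cases "Y (unshift i, unshift j) = 0")
      case True
      then have "c * cartan_basis (Eps 1) (i, j) \<noteq> 0" using that by (simp add: X line_embed_def)
      then show ?thesis using Y(2) by (auto simp: cartan_basis_def split: if_splits)
    next
      case False then show ?thesis using par[of "unshift i" "unshift j"] by simp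
    qed
    then show "X \<in> hpart ?Lv a" using X line_embed_in[OF Y(1)] unfolding levi_ops by blast
  next
    fix X assume "X \<in> hpart ?Lv a"
    then have X: "X \<in> vcarrier ?Lv" and par: "\<And>i j. X (i, j) \<noteq> 0 \<Longrightarrow> (sidx_odd i \<noteq> sidx_odd j) = a"
      unfolding levi_ops by blast+
    have "\<rho> X \<in> hpart (lie_sum (osp (m - 1) n) lie_C) a"
      using \<rho>_in[OF X] par[of e1 e1] par[of "shift i" "shift j" for i j]
      by (auto simp: lie_sum_ops \<rho>_def split: if_splits)
    then show "X \<in> line_embed ` hpart (lie_sum (osp (m - 1) n) lie_C) a"
      using embed_\<rho>[OF X] by (metis imageI)
  qed
  have "bij_betw line_embed (vcarrier (lie_sum (osp (m - 1) n) lie_C)) (vcarrier ?Lv)"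
    unfolding lie_sum_ops
  proof (rule bij_betw_byWitness[of _ \<rho>])
    show "\<rho> ` vcarrier ?Lv \<subseteq> ?O \<times> UNIV" using \<rho>_in mem_Times_iff by blast
  qed (use \<rho>_embed embed_\<rho> line_embed_in in auto)
  then show ?thesis
    unfolding lie_iso_def super_iso_def using hp
    by (auto simp: lie_sum_ops levi_ops add scale bracket simp del: One_nat_def)
qed

text \<open>A vector becomes the column of \<open>dual e1\<close>. That column, unlike the row of \<open>e1\<close>, transforms
  under the Levi subalgebra by plain matrix multiplication.\<close>

definition vector_embed :: "(sidx \<Rightarrow> complex) \<Rightarrow> sidx cmat" where
  "vector_embed v = osym (\<lambda>(i, j). if j = dual e1 then v (unshift i) else 0)"

lemma vector_embed_entry: "vector_embed v (shift i, dual e1) = v i" if "i \<in> sidx (m - 1) n"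
proof -
  have "dual (shift i) \<noteq> dual e1" using shift_in[OF that] by (metis dual_eq_iff)
  then show ?thesis by (simp add: vector_embed_def osym_def del: dual_eq_iff)
qed

lemma vector_embed_in:
  assumes v: "\<And>i. v i \<noteq> 0 \<Longrightarrow> i \<in> sidx (m - 1) n"
  shows "vector_embed v \<in> vcarrier (nilradical m n (line_parabolic m n e1))"
proof -
  let ?M = "\<lambda>(i, j). if j = dual e1 then v (unshift i) else 0"
  have M: "j = dual e1 \<and> i \<in> sidx m n \<and> i \<noteq> e1 \<and> i \<noteq> dual e1" if "?M (i, j) \<noteq> 0" for i j
    using that v[of "unshift i"] unshift_in by (auto split: if_splits)
  have "vector_embed v \<in> osp_carrier m n"
    unfolding vector_embed_def
    by (rule osym_in_osp) (use M e1_in dual_in in blast)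
  moreover have "(i = e1 \<and> j \<noteq> e1 \<and> j \<noteq> dual e1) \<or> (j = dual e1 \<and> i \<noteq> e1 \<and> i \<noteq> dual e1)"
    if "vector_embed v (i, j) \<noteq> 0" for i j
  proof (cases "?M (i, j) = 0")
    case True
    then have "?M (dual j, dual i) \<noteq> 0" using that by (simp add: vector_embed_def osym_def)
    then have "dual i = dual e1 \<and> dual j \<noteq> e1 \<and> dual j \<noteq> dual e1" using M by blast
    then show ?thesis by (metis dual_dual)
  qed (use M in blast)
  ultimately show ?thesis unfolding nil_line_carrier by blast
qed

text \<open>In the column of \<open>dual e1\<close> the first half of the bracket is \<open>X v\<close>. The second half is minus the column times
  the diagonal entry \<open>- c\<close> of the Levi element, without a Koszul sign because \<open>e1\<close> is even.\<close>

lemma vector_embed_equivariant: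
  assumes X: "X \<in> osp_carrier (m - 1) n" and v: "\<And>i. v i \<noteq> 0 \<Longrightarrow> i \<in> sidx (m - 1) n"
  shows "vector_embed (mapply (sidx (m - 1) n) X v + c \<odot> v) =
    superbracket (sidx m n) sidx_odd (line_embed (X, c)) (vector_embed v)"
proof (rule nil_line_eqI)
  have "i \<in> sidx (m - 1) n" if nz: "(mapply (sidx (m - 1) n) X v + c \<odot> v) i \<noteq> 0" for i
  proof (rule ccontr)
    assume "i \<notin> sidx (m - 1) n"
    then have "X (i, k) = 0" "v i = 0" for k using osp_support[OF X] v by blast+
    then show False using nz by (simp add: mapply_def fscale_def)
  qed
  then show "vector_embed (mapply (sidx (m - 1) n) X v + c \<odot> v) \<in> vcarrier (nilradical m n (line_parabolic m n e1))"
    by (rule vector_embed_in)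
  show "superbracket (sidx m n) sidx_odd (line_embed (X, c)) (vector_embed v)
      \<in> vcarrier (nilradical m n (line_parabolic m n e1))"
    by (rule nil_line_superbracket[OF line_embed_in[OF X] vector_embed_in[OF v]])
  fix i assume i: "i \<in> sidx (m - 1) n"
  note en = line_embed_entry[OF X]
  show "vector_embed (mapply (sidx (m - 1) n) X v + c \<odot> v) (shift i, dual e1) =
    superbracket (sidx m n) sidx_odd (line_embed (X, c)) (vector_embed v) (shift i, dual e1)"
    unfolding superbracket_entry sum_shift using i
    by (simp add: en vector_embed_entry ksign_def mapply_def fscale_def del: One_nat_def)
qed

theorem lie_module_iso_line:
  "lie_module_iso
     (lie_sum (osp (m - 1) n) lie_C) (fspace (sidx (m - 1) n) sidx_odd) (std_scalar_act (m - 1) n)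
     (levi m n (line_parabolic m n e1)) (nilradical m n (line_parabolic m n e1)) (brk (osp m n))"
proof -
  let ?N = "nilradical m n (line_parabolic m n e1)"
  let ?S = "sidx (m - 1) n"
  let ?V = "fspace ?S sidx_odd"
  have in_N: "vector_embed v \<in> vcarrier ?N" if "v \<in> vcarrier ?V" for v
    using that by (intro vector_embed_in) (simp add: fspace_ops)
  define \<tau> :: "sidx cmat \<Rightarrow> sidx \<Rightarrow> complex" where
    "\<tau> = (\<lambda>X i. if i \<in> ?S then X (shift i, dual e1) else 0)"
  have \<tau>_in: "\<tau> X \<in> vcarrier ?V" for X by (simp add: fspace_ops \<tau>_def)
  have \<tau>_embed: "\<tau> (vector_embed v) = v" if "v \<in> vcarrier ?V" for v
    using that vector_embed_entry[of _ v] by (auto simp: \<tau>_def fspace_ops fun_eq_iff)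
  have embed_\<tau>: "vector_embed (\<tau> X) = X" if "X \<in> vcarrier ?N" for X
    by (rule nil_line_eqI[OF in_N[OF \<tau>_in] that]) (simp add: vector_embed_entry \<tau>_def)
  have "super_iso ?V ?N vector_embed"
    unfolding super_iso_def
  proof (intro conjI ballI allI)
    show "bij_betw vector_embed (vcarrier ?V) (vcarrier ?N)"
      by (rule bij_betw_byWitness[of _ \<tau>]) (use \<tau>_in \<tau>_embed embed_\<tau> in_N in auto)
    show "vector_embed (vadd ?V v w) = vadd ?N (vector_embed v) (vector_embed w)" for v w
      by (auto simp: fspace_ops nilradical_ops vector_embed_def osym_def fun_eq_iff distrib_left)
    show "vector_embed (vscale ?V c v) = vscale ?N c (vector_embed v)" for c v
      by (auto simp: fspace_ops nilradical_ops vector_embed_def osym_def fun_eq_iff fscale_def distrib_left)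
    show "vector_embed ` hpart ?V a = hpart ?N a" for a
    proof (intro set_eqI iffI)
      fix X assume "X \<in> vector_embed ` hpart ?V a"
      then obtain v where v: "X = vector_embed v" "v \<in> hpart ?V a" by blast
      then have par: "sidx_odd i = a" if "v i \<noteq> 0" for i using that by (simp add: fspace_ops)
      have "(sidx_odd i \<noteq> sidx_odd j) = a" if "X (i, j) \<noteq> 0" for i j
      proof -
        have "(j = dual e1 \<and> v (unshift i) \<noteq> 0) \<or> (dual i = dual e1 \<and> v (unshift (dual j)) \<noteq> 0)"
          using that unfolding v(1) vector_embed_def osym_def by (auto split: if_splits)
        then show ?thesis using par[of "unshift i"] par[of "unshift (dual j)"] by auto
      qed
      moreover have "v \<in> vcarrier ?V" using v(2) by (simp add: fspace_ops)
      ultimately show "X \<in> hpart ?N a" using v(1) in_N unfolding nilradical_ops by blast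
    next
      fix X assume "X \<in> hpart ?N a"
      then have X: "X \<in> vcarrier ?N" and par: "\<And>i j. X (i, j) \<noteq> 0 \<Longrightarrow> (sidx_odd i \<noteq> sidx_odd j) = a"
        unfolding nilradical_ops by blast+
      have "\<tau> X \<in> hpart ?V a"
        using par[of "shift i" "dual e1" for i] by (auto simp: fspace_ops \<tau>_def)
      then show "X \<in> vector_embed ` hpart ?V a" using embed_\<tau>[OF X] by (metis imageI)
    qed
  qed
  moreover have "vector_embed (std_scalar_act (m - 1) n x v) = brk (osp m n) (line_embed x) (vector_embed v)"
    if "x \<in> vcarrier (lie_sum (osp (m - 1) n) lie_C)" "v \<in> vcarrier ?V" for x v
    using that vector_embed_equivariant
    by (auto simp: lie_sum_ops std_scalar_act_def osp_simps fspace_ops)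
  ultimately show ?thesis
    unfolding lie_module_iso_def using lie_iso_levi_line by blast
qed

end

section \<open>The representatives\<close>

definition pos_half :: "nat \<Rightarrow> nat \<Rightarrow> sidx set" where
  "pos_half m n = Pos ` idx m n"

lemma lagrangian_pos_half: "lagrangian m n (pos_half m n)"
proof -
  have "dual j \<in> pos_half m n \<longleftrightarrow> j \<notin> pos_half m n" if "j \<in> sidx m n" for j
    using that by (cases j) (auto simp: pos_half_def)
  then show ?thesis by (auto simp: lagrangian_def pos_half_def)
qed

lemma wt_Neg: "wt (Neg a) = - wt (Pos a)"
  using wt_dual[of "Pos a"] by simp

lemma idx_cases:
  assumes "a \<in> idx m n"
  obtains i where "a = Eps i" "i \<in> {1..m}" | k where "a = Del k" "k \<in> {1..n}"
  using assms that by (cases a) auto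

lemma levi_roots_lagr:
  "levi_roots (lagr_parabolic m n A) =
    root_set m n (\<lambda>i j. (i \<in> A \<or> dual j \<in> A) \<and> (j \<in> A \<or> dual i \<in> A))"
  unfolding lagr_parabolic_def by (rule levi_roots_root_set[OF dual_sym_lagr])

lemma levi_roots_pos_half: "levi_roots (lagr_parabolic m n (pos_half m n)) = L_m m n"
proof -
  let ?D = "{wt (Pos a) - wt (Pos b) | a b. a \<in> idx m n \<and> b \<in> idx m n \<and> a \<noteq> b}"
  have "levi_roots (lagr_parabolic m n (pos_half m n)) = ?D"
  proof (intro set_eqI iffI)
    fix \<alpha> assume "\<alpha> \<in> levi_roots (lagr_parabolic m n (pos_half m n))"
    then obtain i j where \<alpha>: "\<alpha> = wt i - wt j" and r: "root_pair m n i j"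
      and G: "i \<in> pos_half m n \<or> dual j \<in> pos_half m n" "j \<in> pos_half m n \<or> dual i \<in> pos_half m n"
      unfolding levi_roots_lagr root_set_def by blast
    show "\<alpha> \<in> ?D"
    proof (cases i; cases j)
      fix a b assume "i = Pos a" "j = Pos b"
      then show ?thesis using \<alpha> r by (auto simp: root_pair_def)
    next
      fix a b assume "i = Neg a" "j = Neg b"
      then have "\<alpha> = wt (Pos b) - wt (Pos a)" "a \<in> idx m n" "b \<in> idx m n" "b \<noteq> a"
        using \<alpha> r by (auto simp: root_pair_def wt_Neg simp del: wt.simps)
      then show ?thesis by blast
    qed (use G in \<open>auto simp: pos_half_def\<close>)
  next
    fix \<alpha> assume "\<alpha> \<in> ?D"
    then obtain a b where *: "\<alpha> = wt (Pos a) - wt (Pos b)" "a \<in> idx m n" "b \<in> idx m n" "a \<noteq> b"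
      by blast
    then have "root_pair m n (Pos a) (Pos b)" "Pos a \<in> pos_half m n" "Pos b \<in> pos_half m n"
      by (auto simp: root_pair_def pos_half_def)
    then show "\<alpha> \<in> levi_roots (lagr_parabolic m n (pos_half m n))"
      unfolding levi_roots_lagr root_set_def using * by blast
  qed
  also have "\<dots> = L_m m n"
  proof (intro set_eqI iffI)
    fix \<alpha> assume "\<alpha> \<in> ?D"
    then obtain a b where *: "\<alpha> = wt (Pos a) - wt (Pos b)" "a \<in> idx m n" "b \<in> idx m n" "a \<noteq> b"
      by blast
    from *(2) show "\<alpha> \<in> L_m m n"
    proof (cases rule: idx_cases)
      case (1 i) note i = this
      from *(3) show ?thesis
      proof (cases rule: idx_cases)
        case (1 j)
        then show ?thesis using * i unfolding L_m_def eps_wt by blast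
      next
        case (2 k)
        have "\<alpha> = 1 \<odot> (eps i - del k)" using * i 2 by (simp add: eps_wt del_wt fscale_def fun_eq_iff)
        then show ?thesis using i 2 unfolding L_m_def by blast
      qed
    next
      case (2 k) note k = this
      from *(3) show ?thesis
      proof (cases rule: idx_cases)
        case (1 j)
        have "\<alpha> = (- 1) \<odot> (eps j - del k)" using * k 1 by (simp add: eps_wt del_wt fscale_def fun_eq_iff)
        then show ?thesis using k 1 unfolding L_m_def by blast
      next
        case (2 l)
        then show ?thesis using * k unfolding L_m_def del_wt by blast
      qed
    qed
  next
    fix \<alpha> assume "\<alpha> \<in> L_m m n"
    then consider i j where "\<alpha> = eps i - eps j" "i \<in> {1..m}" "j \<in> {1..m}" "i \<noteq> j"
      | k l where "\<alpha> = del k - del l" "k \<in> {1..n}" "l \<in> {1..n}" "k \<noteq> l"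
      | i k where "\<alpha> = eps i - del k" "i \<in> {1..m}" "k \<in> {1..n}"
      | i k where "\<alpha> = del k - eps i" "i \<in> {1..m}" "k \<in> {1..n}"
      unfolding L_m_def by (fastforce simp: fscale_def)
    then show "\<alpha> \<in> ?D"
      unfolding eps_wt del_wt
    proof cases
      case (1 i j)
      then have "Eps i \<in> idx m n" "Eps j \<in> idx m n" "Eps i \<noteq> Eps j" by auto
      then show ?thesis using 1(1) by blast
    next
      case (2 k l)
      then have "Del k \<in> idx m n" "Del l \<in> idx m n" "Del k \<noteq> Del l" by auto
      then show ?thesis using 2(1) by blast
    next
      case (3 i k)
      then have "Eps i \<in> idx m n" "Del k \<in> idx m n" "Eps i \<noteq> Del k" by auto
      then show ?thesis using 3(1) by blast
    next
      case (4 i k)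
      then have "Eps i \<in> idx m n" "Del k \<in> idx m n" "Del k \<noteq> Eps i" by auto
      then show ?thesis using 4(1) by blast
    qed
  qed
  finally show ?thesis .
qed

lemma nil_roots_pos_half: "nil_roots (lagr_parabolic m n (pos_half m n)) = N_m m n"
proof -
  let ?D = "{wt (Pos a) + wt (Pos b) | a b. a \<in> idx m n \<and> b \<in> idx m n \<and> (a = b \<longrightarrow> idx_odd a)}"
  have "nil_roots (lagr_parabolic m n (pos_half m n)) = ?D"
  proof (intro set_eqI iffI)
    fix \<alpha> assume "\<alpha> \<in> nil_roots (lagr_parabolic m n (pos_half m n))"
    then obtain i j where \<alpha>: "\<alpha> = wt i - wt j" and r: "root_pair m n i j"
      and G: "i \<in> pos_half m n \<or> dual j \<in> pos_half m n" "j \<notin> pos_half m n" "dual i \<notin> pos_half m n"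
      unfolding nil_roots_lagr root_set_def by blast
    then obtain a b where "i = Pos a" "j = Neg b"
      by (cases i; cases j) (auto simp: pos_half_def root_pair_def)
    then have "\<alpha> = wt (Pos a) + wt (Pos b)" "a \<in> idx m n" "b \<in> idx m n" "a = b \<longrightarrow> idx_odd a"
      using \<alpha> r by (auto simp: root_pair_def wt_Neg simp del: wt.simps)
    then show "\<alpha> \<in> ?D" by blast
  next
    fix \<alpha> assume "\<alpha> \<in> ?D"
    then obtain a b where *: "\<alpha> = wt (Pos a) + wt (Pos b)" "a \<in> idx m n" "b \<in> idx m n" "a = b \<longrightarrow> idx_odd a"
      by blast
    then have "\<alpha> = wt (Pos a) - wt (Neg b)" "root_pair m n (Pos a) (Neg b)"
      "Pos a \<in> pos_half m n" "Neg b \<notin> pos_half m n" "dual (Pos a) \<notin> pos_half m n"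
      by (auto simp: root_pair_def pos_half_def wt_Neg simp del: wt.simps)
    then show "\<alpha> \<in> nil_roots (lagr_parabolic m n (pos_half m n))"
      unfolding nil_roots_lagr root_set_def by blast
  qed
  also have "\<dots> = N_m m n"
  proof (intro set_eqI iffI)
    fix \<alpha> assume "\<alpha> \<in> ?D"
    then obtain a b where *: "\<alpha> = wt (Pos a) + wt (Pos b)" "a \<in> idx m n" "b \<in> idx m n" "a = b \<longrightarrow> idx_odd a"
      by blast
    from *(2) show "\<alpha> \<in> N_m m n"
    proof (cases rule: idx_cases)
      case (1 i) note i = this
      from *(3) show ?thesis
      proof (cases rule: idx_cases)
        case (1 j)
        then have "i \<noteq> j" using *(4) i by auto
        then show ?thesis using * i 1 unfolding N_m_def eps_wt by blast
      next
        case (2 k)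
        then show ?thesis using * i unfolding N_m_def eps_wt del_wt by blast
      qed
    next
      case (2 k) note k = this
      from *(3) show ?thesis
      proof (cases rule: idx_cases)
        case (1 j)
        have "\<alpha> = eps j + del k" using * k 1 by (simp add: eps_wt del_wt add.commute)
        then show ?thesis using k 1 unfolding N_m_def by blast
      next
        case (2 l)
        show ?thesis
        proof (cases "k = l")
          case True
          then have "\<alpha> = 2 \<odot> del k" using * k 2 by (simp add: del_wt fscale_def fun_eq_iff)
          then show ?thesis using k unfolding N_m_def by blast
        next
          case False
          then show ?thesis using * k 2 unfolding N_m_def del_wt by blast
        qed
      qed
    qed
  next
    fix \<alpha> assume "\<alpha> \<in> N_m m n"
    then consider i j where "\<alpha> = eps i + eps j" "i \<in> {1..m}" "j \<in> {1..m}" "i \<noteq> j"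
      | k l where "\<alpha> = del k + del l" "k \<in> {1..n}" "l \<in> {1..n}"
      | i k where "\<alpha> = eps i + del k" "i \<in> {1..m}" "k \<in> {1..n}"
    proof -
      have two: "2 \<odot> del k = del k + del k" for k by (simp add: fscale_def fun_eq_iff)
      show thesis using \<open>\<alpha> \<in> N_m m n\<close> that unfolding N_m_def two by blast
    qed
    then show "\<alpha> \<in> ?D"
      unfolding eps_wt del_wt
    proof cases
      case (1 i j)
      then have "Eps i \<in> idx m n" "Eps j \<in> idx m n" "Eps i = Eps j \<longrightarrow> idx_odd (Eps i)" by auto
      then show ?thesis using 1(1) by blast
    next
      case (2 k l)
      then have "Del k \<in> idx m n" "Del l \<in> idx m n" "idx_odd (Del k)" by auto
      then show ?thesis using 2(1) by blast
    next
      case (3 i k)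
      then have "Eps i \<in> idx m n" "Del k \<in> idx m n" "Eps i \<noteq> Del k" by auto
      then show ?thesis using 3(1) by blast
    qed
  qed
  finally show ?thesis .
qed

lemma levi_un_nil: "levi_roots P \<union> nil_roots P = P"
  by (auto simp: levi_roots_def nil_roots_def)

lemma P_m_eq: "P_m m n = lagr_parabolic m n (pos_half m n)"
  using levi_un_nil[of "lagr_parabolic m n (pos_half m n)"]
  by (simp add: P_m_def levi_roots_pos_half nil_roots_pos_half)

lemma roots_cases:
  assumes "\<alpha> \<in> roots m n"
  obtains s t i j where "\<alpha> = s \<odot> eps i + t \<odot> eps j" "s \<in> signs" "t \<in> signs" "i \<in> {1..m}" "j \<in> {1..m}" "i \<noteq> j"
  | s t k l where "\<alpha> = s \<odot> del k + t \<odot> del l" "s \<in> signs" "t \<in> signs" "k \<in> {1..n}" "l \<in> {1..n}" "k \<noteq> l"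
  | s k where "\<alpha> = (2 * s) \<odot> del k" "s \<in> signs" "k \<in> {1..n}"
  | s t i k where "\<alpha> = s \<odot> eps i + t \<odot> del k" "s \<in> signs" "t \<in> signs" "i \<in> {1..m}" "k \<in> {1..n}"
  using assms unfolding roots_def by blast

lemma eps_del_coordinate: "eps i (Eps j) = (if j = i then 1 else 0)" "del k (Eps j) = 0"
  by (simp_all add: eps_def del_def)

text \<open>Levi roots and nilradical roots of the line type are separated by the \<open>\<epsilon>\<^sub>1\<close>-coordinate.\<close>

lemma L_1_eq: "L_1 m n = {\<alpha> \<in> roots m n. \<alpha> (Eps 1) = 0}"
proof (intro set_eqI iffI)
  fix \<alpha> assume \<alpha>: "\<alpha> \<in> L_1 m n"
  have "{2..m} \<subseteq> {1..m}" by auto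
  then have "\<alpha> \<in> roots m n" using \<alpha> unfolding L_1_def roots_def by blast
  moreover have "\<alpha> (Eps 1) = 0"
    using \<alpha> by (auto simp: L_1_def fscale_def eps_del_coordinate)
  ultimately show "\<alpha> \<in> {\<alpha> \<in> roots m n. \<alpha> (Eps 1) = 0}" by blast
next
  fix \<alpha> assume "\<alpha> \<in> {\<alpha> \<in> roots m n. \<alpha> (Eps 1) = 0}"
  then have "\<alpha> \<in> roots m n" and zero: "\<alpha> (Eps 1) = 0" by auto
  from this(1) show "\<alpha> \<in> L_1 m n"
  proof (cases rule: roots_cases)
    case (1 s t i j)
    then have "i \<in> {2..m}" "j \<in> {2..m}"
      using zero by (auto simp: fscale_def eps_del_coordinate split: if_splits)
    then show ?thesis using 1 unfolding L_1_def by blast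
  next
    case (2 s t k l) then show ?thesis unfolding L_1_def by blast
  next
    case (3 s k) then show ?thesis unfolding L_1_def by blast
  next
    case (4 s t i k)
    then have "i \<in> {2..m}"
      using zero by (auto simp: fscale_def eps_del_coordinate split: if_splits)
    then show ?thesis using 4 unfolding L_1_def by blast
  qed
qed

lemma N_1_eq:
  assumes m: "m \<ge> 1"
  shows "N_1 m n = {\<alpha> \<in> roots m n. \<alpha> (Eps 1) = 1}"
proof (intro set_eqI iffI)
  fix \<alpha> assume \<alpha>: "\<alpha> \<in> N_1 m n"
  have one: "1 \<odot> eps 1 = eps 1" by (simp add: fscale_def)
  have "\<alpha> \<in> roots m n"
  proof -
    from \<alpha> consider s j where "\<alpha> = 1 \<odot> eps 1 + s \<odot> eps j" "s \<in> signs" "j \<in> {2..m}"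
      | s k where "\<alpha> = 1 \<odot> eps 1 + s \<odot> del k" "s \<in> signs" "k \<in> {1..n}"
      unfolding N_1_def one by blast
    then show ?thesis
    proof cases
      case (1 s j)
      then have "(1::complex) \<in> signs" "1 \<in> {1..m}" "j \<in> {1..m}" "1 \<noteq> j" by auto
      then show ?thesis using 1 unfolding roots_def by blast
    next
      case (2 s k)
      then have "(1::complex) \<in> signs" "1 \<in> {1..m}" using m by auto
      then show ?thesis using 2 unfolding roots_def by blast
    qed
  qed
  moreover have "\<alpha> (Eps 1) = 1"
    using \<alpha> by (auto simp: N_1_def fscale_def eps_del_coordinate)
  ultimately show "\<alpha> \<in> {\<alpha> \<in> roots m n. \<alpha> (Eps 1) = 1}" by blast
next
  fix \<alpha> assume "\<alpha> \<in> {\<alpha> \<in> roots m n. \<alpha> (Eps 1) = 1}"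
  then have "\<alpha> \<in> roots m n" and one: "\<alpha> (Eps 1) = 1" by auto
  from this(1) show "\<alpha> \<in> N_1 m n"
  proof (cases rule: roots_cases)
    case (1 s t i j)
    then consider "i = 1" "s = 1" "j \<in> {2..m}" | "j = 1" "t = 1" "i \<in> {2..m}"
      using one by (auto simp: fscale_def eps_del_coordinate split: if_splits)
    then show ?thesis
    proof cases
      case a: 1
      have "\<alpha> = eps 1 + t \<odot> eps j" using a 1 by (simp add: fscale_def)
      then show ?thesis using a 1 unfolding N_1_def by blast
    next
      case a: 2
      have "\<alpha> = eps 1 + s \<odot> eps i" using a 1 by (simp add: fscale_def add.commute)
      then show ?thesis using a 1 unfolding N_1_def by blast
    qed
  next
    case (2 s t k l) then show ?thesis using one by (simp add: fscale_def eps_del_coordinate)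
  next
    case (3 s k) then show ?thesis using one by (simp add: fscale_def eps_del_coordinate)
  next
    case (4 s t i k)
    then have "i = 1" "s = 1"
      using one by (auto simp: fscale_def eps_del_coordinate split: if_splits)
    then have "\<alpha> = eps 1 + t \<odot> del k" using 4 by (simp add: fscale_def)
    then show ?thesis using 4 unfolding N_1_def by blast
  qed
qed

lemma wt_e1_coordinate: "wt i (Eps 1) = (if i = e1 then 1 else if i = dual e1 then - 1 else 0)"
  by (cases i) (auto simp: e1_def)

lemma levi_roots_line: "levi_roots (line_parabolic m n e1) = L_1 m n"
proof (rule weight_set_eqI)
  let ?G = "\<lambda>i j. i = e1 \<or> j = dual e1 \<or> (i \<noteq> dual e1 \<and> j \<noteq> e1)"
  have sym: "dual_sym (\<lambda>i j. ?G i j \<and> ?G j i)"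
    using dual_sym_line[of e1] by (simp add: dual_sym_def)
  show "wt i - wt j \<in> levi_roots (line_parabolic m n e1) \<longleftrightarrow> wt i - wt j \<in> L_1 m n"
    if "root_pair m n i j" for i j
    using that unfolding line_parabolic_def levi_roots_root_set[OF dual_sym_line] wt_diff_in_root_set[OF sym] L_1_eq
    by (auto simp: wt_diff_in_roots wt_e1_coordinate root_pair_def simp del: One_nat_def split: if_splits)
  show "levi_roots (line_parabolic m n e1) \<subseteq> roots m n" "L_1 m n \<subseteq> roots m n"
    unfolding line_parabolic_def levi_roots_root_set[OF dual_sym_line] L_1_eq using root_set_subset by auto
qed

lemma nil_roots_line_e1: "m \<ge> 1 \<Longrightarrow> nil_roots (line_parabolic m n e1) = N_1 m n"
proof (rule weight_set_eqI)
  assume m: "m \<ge> 1"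
  show "wt i - wt j \<in> nil_roots (line_parabolic m n e1) \<longleftrightarrow> wt i - wt j \<in> N_1 m n"
    if "root_pair m n i j" for i j
    using that unfolding nil_roots_line wt_diff_in_root_set[OF dual_sym_nil[OF dual_sym_line]] N_1_eq[OF m]
    by (auto simp: wt_diff_in_roots wt_e1_coordinate root_pair_def simp del: One_nat_def split: if_splits)
  show "nil_roots (line_parabolic m n e1) \<subseteq> roots m n" "N_1 m n \<subseteq> roots m n"
    unfolding nil_roots_line N_1_eq[OF m] using root_set_subset by auto
qed

lemma P_1_eq: "m \<ge> 1 \<Longrightarrow> P_1 m n = line_parabolic m n e1"
  using levi_un_nil[of "line_parabolic m n e1"]
  by (simp add: P_1_def levi_roots_line nil_roots_line_e1)

definition flip_last :: "nat \<Rightarrow> nat \<Rightarrow> complex" where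
  "flip_last m = (\<lambda>i. if i = m then - 1 else 1)"

text \<open>\<open>pos_half\<close> with \<open>Pos (Eps m)\<close> replaced by \<open>Neg (Eps m)\<close>, written as a preimage so that the results
  on signed permutations apply.\<close>

definition mixed_half :: "nat \<Rightarrow> nat \<Rightarrow> sidx set" where
  "mixed_half m n = reindex id (flip_last m) id (\<lambda>_. 1) -` pos_half m n"

lemma signed_data_flip: "signed_data m n id (flip_last m) id (\<lambda>_. 1)"
  by (auto simp: signed_data_def permutes_id flip_last_def)

text \<open>A signed permutation with a single sign change of the \<open>\<epsilon>\<^sub>i\<close>, hence outside the Weyl group.\<close>

lemma theta_bar_eq: "theta_bar m = signed_perm id (flip_last m) id (\<lambda>_. 1)"
  by (auto simp: theta_bar_def signed_perm_def flip_last_def fun_eq_iff split: idx.splits)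

lemma lagrangian_mixed_half: "lagrangian m n (mixed_half m n)"
  unfolding mixed_half_def by (rule lagrangian_reindex[OF signed_data_flip lagrangian_pos_half])

lemma theta_bar_lagr: "theta_bar m ` lagr_parabolic m n (pos_half m n) = lagr_parabolic m n (mixed_half m n)"
  unfolding theta_bar_eq mixed_half_def by (rule signed_perm_lagr[OF signed_data_flip])

lemma inj_theta_bar: "inj (theta_bar m)"
  by (rule inj_on_inverseI[of _ "theta_bar m"]) (auto simp: theta_bar_def)

lemma theta_bar_uminus: "uminus ` theta_bar m ` P = theta_bar m ` uminus ` P"
  by (simp add: image_image theta_bar_def fun_Compl_def if_distrib cong: if_cong)

lemma levi_roots_theta_bar: "levi_roots (theta_bar m ` P) = theta_bar m ` levi_roots P"
  by (simp add: levi_roots_def theta_bar_uminus image_Int[OF inj_theta_bar])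

lemma nil_roots_theta_bar: "nil_roots (theta_bar m ` P) = theta_bar m ` nil_roots P"
  by (simp add: nil_roots_def theta_bar_uminus image_set_diff[OF inj_theta_bar])

lemma P_m_bar_eq: "P_m_bar m n = theta_bar m ` P_m m n" "P_m_bar m n = lagr_parabolic m n (mixed_half m n)"
  by (simp_all add: P_m_bar_def P_m_def image_Un flip: theta_bar_lagr P_m_eq)

lemma neg_count_pos_half: "neg_count m (pos_half m n) = 0"
  by (auto simp: neg_count_def pos_half_def)

lemma odd_neg_count_mixed_half:
  assumes "m \<ge> 1" shows "odd (neg_count m (mixed_half m n))"
proof -
  have "{i \<in> {1..m}. flip_last m i = - 1} = {m}" using assms by (auto simp: flip_last_def)
  then have "card {i \<in> {1..m}. flip_last m i = - 1} = 1" by simp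
  then show ?thesis
    unfolding mixed_half_def neg_count_reindex[OF signed_data_flip lagrangian_pos_half]
    by (simp add: neg_count_pos_half)
qed

text \<open>Each cominuscule set has one of the two shapes, and within the Lagrangian shape the parity of
  \<open>neg_count\<close> selects the orbit.\<close>

lemma cominuscule_orbits:
  fixes m n :: nat
  assumes m: "m > 1" and n: "n \<ge> 1"
  defines "O0 \<equiv> weyl_orbit m n (lagr_parabolic m n (pos_half m n))"
    and "O1 \<equiv> weyl_orbit m n (line_parabolic m n e1)"
    and "O2 \<equiv> weyl_orbit m n (lagr_parabolic m n (mixed_half m n))"
  shows "weyl_orbit m n ` {P. cominuscule m n P} = {O0, O1, O2}"
    and "card {O0, O1, O2} = 3"
proof -
  have e1: "e1 \<in> sidx m n" "\<not> sidx_odd e1" using m e1_in by auto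
  have m1: "m \<ge> 1" using m by simp
  note lag0 = lagrangian_pos_half[of m n] and lag2 = lagrangian_mixed_half[of m n]
  have odd2: "odd (neg_count m (mixed_half m n))" and even0: "even (neg_count m (pos_half m n))"
    using odd_neg_count_mixed_half[OF m1] neg_count_pos_half by auto
  have O0: "O0 = {lagr_parabolic m n A | A. lagrangian m n A \<and> even (neg_count m A)}"
    unfolding O0_def weyl_orbit_lagr[OF lag0] using even0 by blast
  have O2: "O2 = {lagr_parabolic m n A | A. lagrangian m n A \<and> odd (neg_count m A)}"
    unfolding O2_def weyl_orbit_lagr[OF lag2] using odd2 by blast
  have O1: "O1 = {line_parabolic m n e | e. e \<in> sidx m n \<and> \<not> sidx_odd e}"
    unfolding O1_def by (rule weyl_orbit_line[OF m e1])
  have "weyl_orbit m n P \<in> {O0, O1, O2}" if "cominuscule m n P" for P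
    using that n
  proof (cases rule: cominuscule_cases)
    case (lagr_parabolic A)
    have "weyl_orbit m n P = (if even (neg_count m A) then O0 else O2)"
      unfolding lagr_parabolic(2) weyl_orbit_lagr[OF lagr_parabolic(1)] O0 O2 by auto
    then show ?thesis by simp
  next
    case (line_parabolic e)
    then have "weyl_orbit m n P = O1" unfolding O1 using weyl_orbit_line[OF m] by blast
    then show ?thesis by simp
  qed
  moreover have "O0 \<in> weyl_orbit m n ` {P. cominuscule m n P}" "O1 \<in> weyl_orbit m n ` {P. cominuscule m n P}"
    "O2 \<in> weyl_orbit m n ` {P. cominuscule m n P}"
    unfolding O0_def O1_def O2_def
    using cominuscule_lagr[OF lag0 n] cominuscule_lagr[OF lag2 n] cominuscule_line[OF e1 n] by blast+
  ultimately show "weyl_orbit m n ` {P. cominuscule m n P} = {O0, O1, O2}" by blast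
  have "lagr_parabolic m n (pos_half m n) \<in> O0" "lagr_parabolic m n (mixed_half m n) \<in> O2"
    unfolding O0 O2 using lag0 lag2 even0 odd2 by blast+
  moreover have "lagr_parabolic m n (pos_half m n) \<notin> O2"
    unfolding O2 using lagr_inj[OF lag0 _ m1 n] even0 by blast
  moreover have "lagr_parabolic m n (pos_half m n) \<notin> O1" "lagr_parabolic m n (mixed_half m n) \<notin> O1"
    unfolding O1 using lagr_ne_line[OF _ n] lag0 lag2 by blast+
  ultimately have "O0 \<noteq> O1" "O0 \<noteq> O2" "O1 \<noteq> O2" by auto
  then show "card {O0, O1, O2} = 3" by simp
qed

theorem theorem2p9:
  fixes m n :: nat
  assumes "m > 1" and "n \<ge> 1"
  shows
    "card (weyl_orbit m n ` {P. cominuscule m n P}) = 3 \<and>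
     weyl_orbit m n ` {P. cominuscule m n P} =
       {weyl_orbit m n (P_m m n), weyl_orbit m n (P_1 m n), weyl_orbit m n (P_m_bar m n)} \<and>
     (cominuscule m n (P_m m n) \<and>
      levi_roots (P_m m n) = L_m m n \<and> nil_roots (P_m m n) = N_m m n \<and>
      lie_module_iso
        (gl_mn m n) (ext_square (idx m n) idx_odd) (ext_act (idx m n) idx_odd)
        (levi m n (P_m m n)) (nilradical m n (P_m m n)) (brk (osp m n))) \<and>
     (cominuscule m n (P_1 m n) \<and>
      levi_roots (P_1 m n) = L_1 m n \<and> nil_roots (P_1 m n) = N_1 m n \<and>
      lie_module_iso
        (lie_sum (osp (m - 1) n) lie_C) (fspace (sidx (m - 1) n) sidx_odd) (std_scalar_act (m - 1) n)
        (levi m n (P_1 m n)) (nilradical m n (P_1 m n)) (brk (osp m n))) \<and>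
     (cominuscule m n (P_m_bar m n) \<and>
      levi_roots (P_m_bar m n) = theta_bar m ` L_m m n \<and>
      nil_roots (P_m_bar m n) = theta_bar m ` N_m m n \<and>
      lie_module_iso
        (gl_mn m n) (ext_square (idx m n) idx_odd) (ext_act (idx m n) idx_odd)
        (levi m n (P_m_bar m n)) (nilradical m n (P_m_bar m n)) (brk (osp m n)))"
proof -
  have m1: "m \<ge> 1" and e1: "e1 \<in> sidx m n" using assms(1) e1_in by auto
  note reps = P_m_eq P_1_eq[OF m1] P_m_bar_eq(2)
  note orbits = cominuscule_orbits[OF assms]
  have "levi_roots (P_m_bar m n) = theta_bar m ` L_m m n" "nil_roots (P_m_bar m n) = theta_bar m ` N_m m n"
    unfolding P_m_bar_eq(1) levi_roots_theta_bar nil_roots_theta_bar P_m_eq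
      levi_roots_pos_half nil_roots_pos_half by simp_all
  moreover have "cominuscule m n (P_m m n)" "cominuscule m n (P_1 m n)" "cominuscule m n (P_m_bar m n)"
    unfolding reps
    using cominuscule_lagr[OF lagrangian_pos_half assms(2)] cominuscule_line[OF e1 odd_e1 assms(2)]
      cominuscule_lagr[OF lagrangian_mixed_half assms(2)] by blast+
  ultimately show ?thesis
    using orbits lie_module_iso_lagr[OF lagrangian_pos_half, of m n]
      lie_module_iso_lagr[OF lagrangian_mixed_half, of m n] lie_module_iso_line[OF m1, of n]
      levi_roots_pos_half[of m n] nil_roots_pos_half[of m n] levi_roots_line[of m n] nil_roots_line_e1[OF m1, of n]
    unfolding reps by (simp add: insert_commute)
qed

end
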